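(* Let $k$ be a field, and let $Z\subset\mathbb{P}^n$ be a closed subscheme with (saturated) homogeneous ideal $I_Z\subset R=k[x_0,\dots,x_n]$. Let $\mathcal{A}^p(Z)$ be the $R$-module of polynomial differential $p$-forms vanishing on $Z$ (defined in the context). Then there is an exact sequence of graded $R$-modules $$0\longrightarrow I_Z\otimes\iota_{\mathrm{rad}}\bigwedge^{p+1}V^*\longrightarrow\mathcal{A}^p(Z)\longrightarrow\operatorname{Tor}^R_p(I_Z,k)(p+1)\longrightarrow 0,$$ where $V^*=\langle dx_0,\dots,dx_n\rangle$ and $\mathrm{rad}$ is the radial vector field. Moreover, if $(I_Z)_d=0$, then $\mathcal{A}^p(Z)_d\cong\operatorname{Tor}^R_p(I_Z,k)_{d+p+1}$.
   Context: Let $R=k[x_0,\dots,x_n]$ with its standard grading, let $V^*=\langle dx_0,\dots,dx_n\rangle$, and let $\Omega^q_R=R\otimes_k\bigwedge^qV^*$ be the free $R$-module of polynomial differential $q$-forms. Let $\mathrm{rad}=x_0\frac{\partial}{\partial x_0}+\cdots+x_n\frac{\partial}{\partial x_n}$ be the radial vector field, and let $\iota_{\mathrm{rad}}\colon\Omega^q_R\to\Omega^{q-1}_R$ be the $R$-linear map given by contraction (interior product) with $\mathrm{rad}$. Let $\mathscr{I}_Z$ be the ideal sheaf of $Z$ and $I_Z=\bigoplus_jH^0(\mathbb{P}^n,\mathscr{I}_Z(j))\subset R$ the saturated homogeneous ideal. The module of (twisted) differential $p$-forms vanishing on $Z$ is $$\mathcal{A}^p(Z)=\bigoplus_{d\ge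 0}H^0\left(\mathbb{P}^n,\Omega^p_{\mathbb{P}^n}(d+p+1)\otimes\mathscr{I}_Z\right),$$ with $\mathcal{A}^p(Z)_d=H^0(\mathbb{P}^n,\Omega^p_{\mathbb{P}^n}(d+p+1)\otimes\mathscr{I}_Z)$. Global sections of $\Omega^p_{\mathbb{P}^n}(d+p+1)$ are identified, via the Euler sequence, with the homogeneous $p$-forms $\omega=\sum A_{i_1\dots i_p}\,dx_{i_1}\wedge\dots\wedge dx_{i_p}$ satisfying $\iota_{\mathrm{rad}}\omega=0$ and $\deg A_{i_1\dots i_p}=d+1$. The left-hand term $I_Z\otimes\iota_{\mathrm{rad}}\bigwedge^{p+1}V^*$ denotes the tensor product of $R$-modules $I_Z\otimes\iota_{\mathrm{rad}}\Omega^{p+1}_R$, where $\iota_{\mathrm{rad}}\Omega^{p+1}_R\subset\Omega^p_R$ is the image of $\iota_{\mathrm{rad}}$, the $R$-submodule generated by the forms $\iota_{\mathrm{rad}}\eta$ with $\eta\in\bigwedge^{p+1}V^*$. It maps to $\mathcal{A}^p(Z)$ by multiplication, $F\otimes\iota_{\mathrm{rad}}\eta\mapsto F\,\iota_{\mathrm{rad}}\eta$; for $F\in(I_Z)_d$ and $\eta\in\bigwedge^{p+1}V^*$ this element has degree $d$. For a graded module $M$, $M(a)$ denotes the shift with $M(a)_d=M_{a+d}$. The grading on $\operatorname{Tor}^R_p(I_Z,k)$ is the internal one, with $k=R/(x_0,\dots,x_n)$.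
   Formalization: The left-hand map is not injective in general (e.g. a point in P^3, p=1), so the 0 on the left is replaced by Tor_{p+1}(I_Z,k)(p+1), injecting as the kernel of multiplication; the case p=0 with Z empty, where surjectivity onto Tor_0 fails, is excluded. *)

theory Defs
  imports "HOL-Algebra.Module" "HOL-Algebra.Ideal" "HOL-Library.Poly_Mapping"
begin

section \<open>Graded modules\<close>

record ('r, 'm) gmodule = "('r, 'm) module" +
  hpart :: "int \<Rightarrow> 'm set"

text \<open>The ring fields of a module record include a multiplication and a unit, which have no meaning
  for a module; where a record has to be written out they are left undefined. A graded ring
  is given as a graded module over itself.\<close>

locale graded_module = module R M
  for R :: "('r, 'r) gmodule" (structure) and M :: "('r, 'm) gmodule" (structure) +
  assumes hpart_subgroup: "additive_subgroup (hpart M d) M"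
    and hpart_smult: "\<lbrakk>r \<in> hpart R d; x \<in> hpart M e\<rbrakk> \<Longrightarrow> r \<odot>\<^bsub>M\<^esub> x \<in> hpart M (d + e)"
    and hpart_decomp: "x \<in> carrier M \<Longrightarrow>
      \<exists>!c. (\<forall>d. c d \<in> hpart M d) \<and> finite {d. c d \<noteq> \<zero>\<^bsub>M\<^esub>} \<and> x = finsum M c {d. c d \<noteq> \<zero>\<^bsub>M\<^esub>}"

definition gshift :: "int \<Rightarrow> ('r, 'm) gmodule \<Rightarrow> ('r, 'm) gmodule" where
  "gshift a M = M\<lparr>hpart := \<lambda>d. hpart M (a + d)\<rparr>"

definition gsub :: "('r, 'm) gmodule \<Rightarrow> 'm set \<Rightarrow> ('r, 'm) gmodule" where
  "gsub M H = M\<lparr>carrier := H, hpart := \<lambda>d. hpart M d \<inter> H\<rparr>"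

definition gquot :: "('r, 'm) gmodule \<Rightarrow> 'm set \<Rightarrow> ('r, 'm set) gmodule" where
  "gquot M H =
    \<lparr>carrier = a_rcosets\<^bsub>M\<^esub> H, monoid.mult = undefined, one = undefined,
     zero = H, add = set_add M,
     smult = (\<lambda>r X. \<Union>x\<in>X. H +>\<^bsub>M\<^esub> (r \<odot>\<^bsub>M\<^esub> x)),
     hpart = (\<lambda>d. (\<lambda>x. H +>\<^bsub>M\<^esub> x) ` hpart M d)\<rparr>"

definition graded_hom ::
  "('r, 'r) gmodule \<Rightarrow> ('r, 'm) gmodule \<Rightarrow> ('r, 'n) gmodule \<Rightarrow> ('m \<Rightarrow> 'n) set" where
  "graded_hom R M N =
    {f. f \<in> carrier M \<rightarrow> carrier N \<and>
        (\<forall>x\<in>carrier M. \<forall>y\<in>carrier M. f (x \<oplus>\<^bsub>M\<^esub> y) = f x \<oplus>\<^bsub>N\<^esub> f y) \<and>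
        (\<forall>r\<in>carrier R. \<forall>x\<in>carrier M. f (r \<odot>\<^bsub>M\<^esub> x) = r \<odot>\<^bsub>N\<^esub> f x) \<and>
        (\<forall>d. f ` hpart M d \<subseteq> hpart N d)}"

definition exact_at ::
  "('r, 'r) gmodule \<Rightarrow> ('r, 'l) gmodule \<Rightarrow> ('l \<Rightarrow> 'm) \<Rightarrow> ('r, 'm) gmodule \<Rightarrow> ('m \<Rightarrow> 'n) \<Rightarrow>
   ('r, 'n) gmodule \<Rightarrow> bool" where
  "exact_at R L f M g N \<longleftrightarrow>
    graded_module R L \<and> graded_module R M \<and> graded_module R N \<and>
    f \<in> graded_hom R L M \<and> g \<in> graded_hom R M N \<and>
    f ` carrier L = a_kernel M N g"


section \<open>Tensor products\<close>

text \<open>\<open>M \<otimes>\<^sub>R N\<close> is the free abelian group on \<open>carrier M \<times> carrier N\<close> modulo the bilinearity and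
  balancing relations. The operation \<open>(m, n) \<mapsto> (r m, n)\<close> on the free abelian group becomes a module
  structure only after passing to the quotient.\<close>

definition tensor_free :: "('r, 'm) gmodule \<Rightarrow> ('r, 'n) gmodule \<Rightarrow> ('r, ('m \<times> 'n) \<Rightarrow>\<^sub>0 int) gmodule"
  where
  "tensor_free M N =
    \<lparr>carrier = {c. Poly_Mapping.keys c \<subseteq> carrier M \<times> carrier N},
     monoid.mult = undefined, one = undefined, zero = 0, add = (+),
     smult = (\<lambda>r. frag_extend (\<lambda>(m, n). frag_of (r \<odot>\<^bsub>M\<^esub> m, n))),
     hpart = (\<lambda>d. {c. Poly_Mapping.keys c \<subseteq> (\<Union>i. hpart M i \<times> hpart N (d - i))})\<rparr>"

inductive_set tensor_rel ::
  "('r, 'r) gmodule \<Rightarrow> ('r, 'm) gmodule \<Rightarrow> ('r, 'n) gmodule \<Rightarrow> (('m \<times> 'n) \<Rightarrow>\<^sub>0 int) set"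
  for R :: "('r, 'r) gmodule" and M :: "('r, 'm) gmodule" and N :: "('r, 'n) gmodule" where
  zero: "0 \<in> tensor_rel R M N"
| diff: "a \<in> tensor_rel R M N \<Longrightarrow> b \<in> tensor_rel R M N \<Longrightarrow> a - b \<in> tensor_rel R M N"
| add_left: "m \<in> carrier M \<Longrightarrow> m' \<in> carrier M \<Longrightarrow> n \<in> carrier N \<Longrightarrow>
    frag_of (m \<oplus>\<^bsub>M\<^esub> m', n) - frag_of (m, n) - frag_of (m', n) \<in> tensor_rel R M N"
| add_right: "m \<in> carrier M \<Longrightarrow> n \<in> carrier N \<Longrightarrow> n' \<in> carrier N \<Longrightarrow>
    frag_of (m, n \<oplus>\<^bsub>N\<^esub> n') - frag_of (m, n) - frag_of (m, n') \<in> tensor_rel R M N"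
| balanced: "r \<in> carrier R \<Longrightarrow> m \<in> carrier M \<Longrightarrow> n \<in> carrier N \<Longrightarrow>
    frag_of (r \<odot>\<^bsub>M\<^esub> m, n) - frag_of (m, r \<odot>\<^bsub>N\<^esub> n) \<in> tensor_rel R M N"

definition tensor ::
  "('r, 'r) gmodule \<Rightarrow> ('r, 'm) gmodule \<Rightarrow> ('r, 'n) gmodule \<Rightarrow>
   ('r, (('m \<times> 'n) \<Rightarrow>\<^sub>0 int) set) gmodule" where
  "tensor R M N = gquot (tensor_free M N) (tensor_rel R M N)"

definition pure_tensor ::
  "('r, 'r) gmodule \<Rightarrow> ('r, 'm) gmodule \<Rightarrow> ('r, 'n) gmodule \<Rightarrow> 'm \<Rightarrow> 'n \<Rightarrow>
   (('m \<times> 'n) \<Rightarrow>\<^sub>0 int) set" where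
  "pure_tensor R M N m n = tensor_rel R M N +>\<^bsub>tensor_free M N\<^esub> frag_of (m, n)"

text \<open>The map \<open>f \<otimes> id\<^sub>N\<close> into \<open>M' \<otimes>\<^sub>R N\<close>.\<close>

definition tensor_map ::
  "('r, 'r) gmodule \<Rightarrow> ('r, 'm') gmodule \<Rightarrow> ('r, 'n) gmodule \<Rightarrow> ('m \<Rightarrow> 'm') \<Rightarrow>
   (('m \<times> 'n) \<Rightarrow>\<^sub>0 int) set \<Rightarrow> (('m' \<times> 'n) \<Rightarrow>\<^sub>0 int) set" where
  "tensor_map R M' N f X =
    (\<Union>c\<in>X. tensor_rel R M' N +>\<^bsub>tensor_free M' N\<^esub> frag_extend (\<lambda>(m, n). frag_of (f m, n)) c)"


section \<open>Graded free resolutions and Tor\<close>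

definition graded_free :: "('r, 'r) gmodule \<Rightarrow> ('r, 'm) gmodule \<Rightarrow> bool" where
  "graded_free R M \<longleftrightarrow> graded_module R M \<and>
    (\<exists>B \<subseteq> (\<Union>d. hpart M d). \<forall>x\<in>carrier M.
      \<exists>!c. range c \<subseteq> carrier R \<and> finite {b. c b \<noteq> \<zero>\<^bsub>R\<^esub>} \<and> {b. c b \<noteq> \<zero>\<^bsub>R\<^esub>} \<subseteq> B \<and>
           x = (\<Oplus>\<^bsub>M\<^esub>b\<in>{b. c b \<noteq> \<zero>\<^bsub>R\<^esub>}. c b \<odot>\<^bsub>M\<^esub> b))"

text \<open>\<open>\<dots> \<rightarrow> F 2 \<rightarrow> F 1 \<rightarrow> F 0 \<rightarrow> M \<rightarrow> 0\<close> with differentials \<open>\<delta> i : F (Suc i) \<rightarrow> F i\<close> and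
  augmentation \<open>\<epsilon> : F 0 \<rightarrow> M\<close>.\<close>

definition graded_free_resolution ::
  "('r, 'r) gmodule \<Rightarrow> (nat \<Rightarrow> ('r, 'f) gmodule) \<Rightarrow> (nat \<Rightarrow> 'f \<Rightarrow> 'f) \<Rightarrow> ('f \<Rightarrow> 'm) \<Rightarrow>
   ('r, 'm) gmodule \<Rightarrow> bool" where
  "graded_free_resolution R F \<delta> \<epsilon> M \<longleftrightarrow>
    (\<forall>i. graded_free R (F i)) \<and>
    (\<forall>i. exact_at R (F (Suc (Suc i))) (\<delta> (Suc i)) (F (Suc i)) (\<delta> i) (F i)) \<and>
    exact_at R (F 1) (\<delta> 0) (F 0) \<epsilon> M \<and>
    \<epsilon> ` carrier (F 0) = carrier M"

text \<open>If \<open>F\<close> is a graded free resolution of \<open>M\<close>, this is \<open>Tor\<^sub>q\<^sup>R(M, N)\<close> with its internal grading: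
  the homology of \<open>F \<otimes>\<^sub>R N\<close> in homological degree \<open>q\<close>.\<close>

definition Tor ::
  "('r, 'r) gmodule \<Rightarrow> (nat \<Rightarrow> ('r, 'f) gmodule) \<Rightarrow> (nat \<Rightarrow> 'f \<Rightarrow> 'f) \<Rightarrow> ('r, 'n) gmodule \<Rightarrow> nat \<Rightarrow>
   ('r, (('f \<times> 'n) \<Rightarrow>\<^sub>0 int) set set) gmodule" where
  "Tor R F \<delta> N q =
    gquot
      (gsub (tensor R (F q) N)
        (case q of 0 \<Rightarrow> carrier (tensor R (F 0) N)
         | Suc i \<Rightarrow> a_kernel (tensor R (F (Suc i)) N) (tensor R (F i) N)
                     (tensor_map R (F i) N (\<delta> i))))
      (tensor_map R (F q) N (\<delta> q) ` carrier (tensor R (F (Suc q)) N))"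


section \<open>The polynomial ring\<close>

text \<open>The variables \<open>x\<^sub>0, \<dots>, x\<^sub>n\<close> are indexed by a finite linearly ordered type with \<open>n + 1\<close> elements.\<close>

type_synonym ('v, 'k) mpoly = "('v \<Rightarrow>\<^sub>0 nat) \<Rightarrow>\<^sub>0 'k"

definition var :: "'v \<Rightarrow> ('v, 'k::comm_ring_1) mpoly" where
  "var v = Poly_Mapping.single (Poly_Mapping.single v 1) 1"

definition const :: "'k \<Rightarrow> ('v, 'k::comm_ring_1) mpoly" where
  "const a = Poly_Mapping.single 0 a"

definition homog :: "int \<Rightarrow> ('v::finite, 'k::comm_ring_1) mpoly set" where
  "homog d = {f. \<forall>m\<in>Poly_Mapping.keys f. int (\<Sum>v\<in>UNIV. Poly_Mapping.lookup m v) = d}"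

definition polyR :: "(('v::finite, 'k::comm_ring_1) mpoly, ('v, 'k) mpoly) gmodule" where
  "polyR = \<lparr>carrier = UNIV, monoid.mult = (*), one = 1, zero = 0, add = (+),
            smult = (*), hpart = homog\<rparr>"

definition residue_k :: "(('v::finite, 'k::comm_ring_1) mpoly, ('v, 'k) mpoly set) gmodule" where
  "residue_k = gquot polyR (Idl\<^bsub>polyR\<^esub> (range var))"


section \<open>Closed subschemes of projective space\<close>

text \<open>A closed subscheme \<open>Z\<close> is given by its saturated homogeneous ideal \<open>I\<close>. On the chart where
  \<open>x\<^sub>v\<close> is invertible, the sections of the twists of the ideal sheaf are the homogeneous elements of
  the localization of \<open>I\<close> at \<open>x\<^sub>v\<close>; hence a homogeneous \<open>f\<close> is a global section of a twist of the ideal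
  sheaf iff \<open>is_section I f\<close>. The empty subscheme is the case \<open>I = UNIV\<close>.\<close>

definition homogeneous_ideal :: "('v::finite, 'k::comm_ring_1) mpoly set \<Rightarrow> bool" where
  "homogeneous_ideal I \<longleftrightarrow> ideal I polyR \<and> I = Idl\<^bsub>polyR\<^esub> (I \<inter> (\<Union>d. homog d))"

definition is_section :: "('v::finite, 'k::comm_ring_1) mpoly set \<Rightarrow> ('v, 'k) mpoly \<Rightarrow> bool" where
  "is_section I f \<longleftrightarrow> (\<forall>v. \<exists>N. var v ^ N * f \<in> I)"

definition saturated :: "('v::finite, 'k::comm_ring_1) mpoly set \<Rightarrow> bool" where
  "saturated I \<longleftrightarrow> (\<forall>f. is_section I f \<longrightarrow> f \<in> I)"


section \<open>Polynomial differential forms\<close>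

text \<open>The form \<open>\<Sum>\<^sub>S \<omega>\<^sub>S dx\<^sub>S\<close>, where \<open>dx\<^sub>S\<close> is the wedge product of the \<open>dx\<^sub>v\<close> with \<open>v \<in> S\<close> in increasing
  order, is the family of its coefficients. \<open>forms q\<close> is graded by the degree of the coefficients,
  so that the \<open>dx\<^sub>v\<close> have degree 0.\<close>

type_synonym ('v, 'k) form = "'v set \<Rightarrow> ('v, 'k) mpoly"

definition forms :: "nat \<Rightarrow> (('v::finite, 'k::comm_ring_1) mpoly, ('v, 'k) form) gmodule" where
  "forms q =
    \<lparr>carrier = {\<omega>. \<forall>S. card S \<noteq> q \<longrightarrow> \<omega> S = 0},
     monoid.mult = undefined, one = undefined,
     zero = (\<lambda>S. 0), add = (\<lambda>\<omega> \<eta> S. \<omega> S + \<eta> S), smult = (\<lambda>f \<omega> S. f * \<omega> S),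
     hpart = (\<lambda>d. {\<omega>. (\<forall>S. card S \<noteq> q \<longrightarrow> \<omega> S = 0) \<and> (\<forall>S. \<omega> S \<in> homog d)})\<rparr>"

text \<open>Contraction with the radial field, read off from
  \<open>\<iota> dx\<^sub>S = (\<Sum>v\<in>S. (-1) ^ card {w \<in> S. w < v} x\<^sub>v dx\<^bsub>S - {v}\<^esub>)\<close> with \<open>T = S - {v}\<close>.\<close>

definition contract_rad :: "('v::{finite,linorder}, 'k::comm_ring_1) form \<Rightarrow> ('v, 'k) form" where
  "contract_rad \<omega> T = (\<Sum>v\<in>-T. (-1) ^ card {w \<in> T. w < v} * var v * \<omega> (insert v T))"

text \<open>The image of contraction on \<open>(p+1)\<close>-forms, with the contractions of constant forms
  (whose coefficients are linear) in degree 0.\<close>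

definition rad_image ::
  "nat \<Rightarrow> (('v::{finite,linorder}, 'k::comm_ring_1) mpoly, ('v, 'k) form) gmodule" where
  "rad_image p = gshift 1 (gsub (forms p) (contract_rad ` carrier (forms (Suc p))))"

text \<open>By the Euler sequence, the \<open>p\<close>-forms on projective space form locally a direct summand of
  \<open>\<O>(-p) \<otimes> \<Lambda>\<^sup>pV\<^sup>*\<close>, so a form is a section of \<open>\<Omega>\<^sup>p(d+p+1) \<otimes> \<I>\<^sub>Z\<close> iff it is a section of \<open>\<Omega>\<^sup>p(d+p+1)\<close> whose
  coefficients are sections of \<open>\<I>\<^sub>Z(d+1)\<close>.\<close>

definition vanishing_part ::
  "('v::{finite,linorder}, 'k::comm_ring_1) mpoly set \<Rightarrow> nat \<Rightarrow> int \<Rightarrow> ('v, 'k) form set" where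
  "vanishing_part I p d =
    (if d < 0 then {\<lambda>S. 0}
     else {\<omega> \<in> hpart (forms p) (d + 1). contract_rad \<omega> = (\<lambda>S. 0) \<and> (\<forall>S. is_section I (\<omega> S))})"

definition vanishing_forms ::
  "('v::{finite,linorder}, 'k::comm_ring_1) mpoly set \<Rightarrow> nat \<Rightarrow>
   (('v, 'k) mpoly, ('v, 'k) form) gmodule" where
  "vanishing_forms I p = (forms p)
    \<lparr>carrier := {finsum (forms p) w D | w D. finite D \<and> (\<forall>d\<in>D. w d \<in> vanishing_part I p d)},
     hpart := vanishing_part I p\<rparr>"

definition part_iso ::
  "(('v, 'k::field) mpoly, 'm) gmodule \<Rightarrow> int \<Rightarrow> (('v, 'k) mpoly, 'n) gmodule \<Rightarrow> int \<Rightarrow> bool" where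
  "part_iso M d N e \<longleftrightarrow>
    (\<exists>\<phi>. bij_betw \<phi> (hpart M d) (hpart N e) \<and>
         (\<forall>x\<in>hpart M d. \<forall>y\<in>hpart M d. \<phi> (x \<oplus>\<^bsub>M\<^esub> y) = \<phi> x \<oplus>\<^bsub>N\<^esub> \<phi> y) \<and>
         (\<forall>a. \<forall>x\<in>hpart M d. \<phi> (const a \<odot>\<^bsub>M\<^esub> x) = const a \<odot>\<^bsub>N\<^esub> \<phi> x))"

end

theory Submission
  imports Defs
begin

text \<open>
  Let \<open>K\<close> be the Koszul complex of polynomial forms with contraction as differential. It is a free
  resolution of the residue field, so \<open>Tor\<^sub>q(I, k)\<close> is the homology of \<open>I \<otimes> K\<close>, that is \<open>Z\<^sub>q / B\<^sub>q\<close>: here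
  \<open>Z\<^sub>q\<close> consists of the \<open>q\<close>-forms with coefficients in \<open>I\<close> that contraction kills, and \<open>B\<^sub>q\<close> of the
  contractions of the \<open>(q+1)\<close>-forms with coefficients in \<open>I\<close> (\<open>koszul_homology_tor\<close>).

  Two of the modules in the sequence can be read off from \<open>I \<otimes> K\<close>. As \<open>I\<close> is saturated, the forms
  that vanish on the subscheme are exactly \<open>Z\<^sub>p\<close> (\<open>vanishing_forms_carrier\<close>). As tensor products are
  right exact and \<open>K\<close> is exact, \<open>I\<close> tensored with the contracted \<open>(p+1)\<close>-forms is the module of all
  \<open>(p+1)\<close>-forms with coefficients in \<open>I\<close> modulo \<open>B\<^bsub>p+1\<^esub>\<close> (\<open>tensor_ideal\<close>). Under these
  identifications multiplication becomes the map induced by contraction. Its kernel is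
  \<open>Z\<^bsub>p+1\<^esub> / B\<^bsub>p+1\<^esub> = Tor\<^bsub>p+1\<^esub>\<close>, its image is \<open>B\<^sub>p\<close> and its cokernel is \<open>Z\<^sub>p / B\<^sub>p = Tor\<^sub>p\<close>. If \<open>I\<close> is zero in
  degree \<open>d\<close>, there are no \<open>(p+1)\<close>-forms with coefficients in \<open>I\<^sub>d\<close>, hence \<open>B\<^sub>p\<close> has nothing in degree \<open>d\<close>
  and the last map is an isomorphism there.

  What takes work is that \<open>Tor\<close> is computed from an arbitrary free resolution \<open>F\<close> of \<open>I\<close>. The two ways
  to compute it are compared in the double complex of forms with values in the \<open>F i\<close>. Its columns
  are exact because \<open>F\<close> is a resolution; its rows are exact by a contracting homotopy on monomials that
  involves no division, so that the characteristic does not matter (\<open>koszul_homotopy_contract\<close>,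
  transferred to free modules by coordinates). A class is carried along the antidiagonal from
  \<open>I\<close>-valued \<open>p\<close>-forms to 0-forms with values in \<open>F p\<close>, by steps that lift along \<open>F\<close> and then contract.
  Each step is an additive relation that induces an isomorphism of subquotients (\<open>zigzag_corr\<close>);
  relations compose, and only the composite is turned into a map. All maps have degree 0, so
  homogeneous elements always lift to homogeneous elements (\<open>hpart_preimage\<close>).
\<close>

section \<open>Graded modules\<close>

lemma (in abelian_group) minus_zero_iff:
  assumes "x \<in> carrier G" "y \<in> carrier G"
  shows "x \<ominus> y = \<zero> \<longleftrightarrow> x = y"
proof
  assume "x \<ominus> y = \<zero>"
  then have "\<ominus> (\<ominus> y) = x" using assms by (intro minus_equality) (auto simp: minus_eq)
  then show "x = y" using assms by simp
qed (use assms in \<open>simp add: minus_eq r_neg\<close>)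

lemma finsum_hom:
  assumes "abelian_group M" "abelian_group N" "f \<in> carrier M \<rightarrow> carrier N"
    and add: "\<And>x y. x \<in> carrier M \<Longrightarrow> y \<in> carrier M \<Longrightarrow> f (x \<oplus>\<^bsub>M\<^esub> y) = f x \<oplus>\<^bsub>N\<^esub> f y"
    and c: "\<And>a. a \<in> A \<Longrightarrow> c a \<in> carrier M"
  shows "f (finsum M c A) = finsum N (\<lambda>a. f (c a)) A"
proof -
  interpret M: abelian_group M by fact
  interpret N: abelian_group N by fact
  have f0: "f \<zero>\<^bsub>M\<^esub> = \<zero>\<^bsub>N\<^esub>"
  proof -
    have "f \<zero>\<^bsub>M\<^esub> \<oplus>\<^bsub>N\<^esub> f \<zero>\<^bsub>M\<^esub> = f \<zero>\<^bsub>M\<^esub>" using add[of "\<zero>\<^bsub>M\<^esub>" "\<zero>\<^bsub>M\<^esub>"] by simp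
    then show ?thesis using assms(3) N.add.l_cancel_one by force
  qed
  show ?thesis
  proof (cases "finite A")
    case False
    then show ?thesis by (simp add: f0 M.finsum_infinite N.finsum_infinite)
  next
    case True
    then show ?thesis using c
    proof (induction A)
      case empty
      then show ?case by (simp add: f0)
    next
      case (insert a A)
      have ca: "c a \<in> carrier M" "c \<in> A \<rightarrow> carrier M" using insert by auto
      then have "(\<lambda>a. f (c a)) \<in> A \<rightarrow> carrier N" "f (c a) \<in> carrier N" using assms(3) by auto
      then show ?case using insert ca by (simp add: M.finsum_insert N.finsum_insert add)
    qed
  qed
qed

lemma finsum_sum:
  assumes "abelian_group M"
    and add: "\<And>x y. x \<in> carrier M \<Longrightarrow> y \<in> carrier M \<Longrightarrow> f (x \<oplus>\<^bsub>M\<^esub> y) = f x + f y"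
    and c: "\<And>a. a \<in> A \<Longrightarrow> c a \<in> carrier M"
  shows "f (finsum M c A) = (\<Sum>a\<in>A. (f (c a) :: 'b::ab_group_add))"
proof -
  interpret M: abelian_group M by fact
  have f0: "f \<zero>\<^bsub>M\<^esub> = 0" using add[of "\<zero>\<^bsub>M\<^esub>" "\<zero>\<^bsub>M\<^esub>"] by simp
  show ?thesis
  proof (cases "finite A")
    case False
    then show ?thesis by (simp add: f0 M.finsum_infinite)
  next
    case True
    then show ?thesis using c
    proof (induction A)
      case (insert a A)
      have "c a \<in> carrier M" "c \<in> A \<rightarrow> carrier M" using insert by auto
      then show ?case using insert by (simp add: M.finsum_insert add)
    qed (simp add: f0)
  qed
qed

text \<open>Uniqueness of homogeneous decompositions only has to be checked for the decompositions of zero.\<close>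

lemma graded_moduleI:
  assumes "module R M"
    and "\<And>d. additive_subgroup (hpart M d) M"
    and "\<And>r x d e. r \<in> hpart R d \<Longrightarrow> x \<in> hpart M e \<Longrightarrow> r \<odot>\<^bsub>M\<^esub> x \<in> hpart M (d + e)"
    and ex: "\<And>x. x \<in> carrier M \<Longrightarrow>
      \<exists>A c. finite A \<and> (\<forall>d. c d \<in> hpart M d) \<and> x = finsum M c A"
    and indep: "\<And>A c d. finite A \<Longrightarrow> (\<forall>d. c d \<in> hpart M d) \<Longrightarrow> finsum M c A = \<zero>\<^bsub>M\<^esub> \<Longrightarrow> d \<in> A \<Longrightarrow>
      c d = \<zero>\<^bsub>M\<^esub>"
  shows "graded_module R M"
proof -
  interpret module R M by fact
  have car: "x \<in> hpart M d \<Longrightarrow> x \<in> carrier M" for x d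
    using assms(2)[of d] by (auto dest: additive_subgroup.a_subset)
  have z: "\<zero>\<^bsub>M\<^esub> \<in> hpart M d" for d
    using assms(2)[of d] by (auto dest: additive_subgroup.zero_closed)
  show ?thesis
  proof (rule graded_module.intro[OF assms(1)], rule graded_module_axioms.intro)
    fix x assume x: "x \<in> carrier M"
    obtain A c where A: "finite A" "\<And>d. c d \<in> hpart M d" "x = finsum M c A"
      using ex[OF x] by auto
    let ?c = "\<lambda>d. if d \<in> A then c d else \<zero>\<^bsub>M\<^esub>"
    have fin: "finite {d. ?c d \<noteq> \<zero>\<^bsub>M\<^esub>}" by (rule finite_subset[OF _ A(1)]) auto
    have "finsum M ?c {d. ?c d \<noteq> \<zero>\<^bsub>M\<^esub>} = finsum M c A"
      by (rule M.add.finprod_mono_neutral_cong_left[OF A(1)]) (use A(2) car in auto)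
    with A z fin have P: "(\<forall>d. ?c d \<in> hpart M d) \<and> finite {d. ?c d \<noteq> \<zero>\<^bsub>M\<^esub>} \<and> x = finsum M ?c {d. ?c d \<noteq> \<zero>\<^bsub>M\<^esub>}"
      by simp
    show "\<exists>!c. (\<forall>d. c d \<in> hpart M d) \<and> finite {d. c d \<noteq> \<zero>\<^bsub>M\<^esub>} \<and> x = finsum M c {d. c d \<noteq> \<zero>\<^bsub>M\<^esub>}"
    proof (rule ex1I[of _ ?c])
      show "(\<forall>d. ?c d \<in> hpart M d) \<and> finite {d. ?c d \<noteq> \<zero>\<^bsub>M\<^esub>} \<and> x = finsum M ?c {d. ?c d \<noteq> \<zero>\<^bsub>M\<^esub>}"
        by (rule P)
      fix e assume e: "(\<forall>d. e d \<in> hpart M d) \<and> finite {d. e d \<noteq> \<zero>\<^bsub>M\<^esub>} \<and> x = finsum M e {d. e d \<noteq> \<zero>\<^bsub>M\<^esub>}"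
      let ?B = "{d. ?c d \<noteq> \<zero>\<^bsub>M\<^esub>} \<union> {d. e d \<noteq> \<zero>\<^bsub>M\<^esub>}"
      have finB: "finite ?B" using fin e by auto
      have cc: "?c d \<in> carrier M" "e d \<in> carrier M" for d using A(2) car e by auto
      have 1: "finsum M ?c ?B = x"
        by (subst P[THEN conjunct2, THEN conjunct2]) (rule M.add.finprod_mono_neutral_cong_right[OF finB]; use cc in auto)
      have 2: "finsum M e ?B = x"
        by (subst e[THEN conjunct2, THEN conjunct2]) (rule M.add.finprod_mono_neutral_cong_right[OF finB]; use cc in auto)
      let ?u = "\<lambda>d. ?c d \<ominus>\<^bsub>M\<^esub> e d"
      have "finsum M ?u ?B \<oplus>\<^bsub>M\<^esub> finsum M e ?B = finsum M (\<lambda>d. ?u d \<oplus>\<^bsub>M\<^esub> e d) ?B"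
        using cc by (intro M.finsum_addf[symmetric]) auto
      also have "\<dots> = finsum M ?c ?B"
        by (rule M.finsum_cong') (use cc in \<open>auto simp: M.minus_eq M.a_assoc M.l_neg\<close>)
      finally have "finsum M ?u ?B \<oplus>\<^bsub>M\<^esub> x = x" using 1 2 by simp
      moreover have "finsum M ?u ?B \<in> carrier M" using cc by (intro M.finsum_closed) auto
      ultimately have zero: "finsum M ?u ?B = \<zero>\<^bsub>M\<^esub>"
        using M.add.r_cancel_one x by blast
      have u: "\<forall>d. ?u d \<in> hpart M d"
      proof
        fix d
        interpret S: additive_subgroup "hpart M d" M by (rule assms(2))
        show "?u d \<in> hpart M d" unfolding M.minus_eq
          by (rule S.a_closed) (use P e S.a_inv_closed in blast)+
      qed
      show "e = ?c"
      proof
        fix d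
        have ud: "?u d = \<zero>\<^bsub>M\<^esub>"
        proof (cases "d \<in> ?B")
          case True
          then show ?thesis using indep[OF finB u zero] by blast
        next
          case False
          then have "?c d = \<zero>\<^bsub>M\<^esub>" "e d = \<zero>\<^bsub>M\<^esub>" by auto
          then show ?thesis using M.r_neg[OF M.zero_closed] by (simp add: M.minus_eq)
        qed
        show "e d = ?c d" by (rule iffD1[OF M.minus_zero_iff[OF cc(1)[of d] cc(2)[of d]] ud, symmetric])
      qed
    qed
  qed (use assms in auto)
qed

text \<open>The component of degree \<open>d\<close> in the homogeneous decomposition of \<open>x\<close>.\<close>

definition gcomp :: "('r, 'm) gmodule \<Rightarrow> int \<Rightarrow> 'm \<Rightarrow> 'm" where
  "gcomp M d x = (THE c. (\<forall>d. c d \<in> hpart M d) \<and> finite {d. c d \<noteq> \<zero>\<^bsub>M\<^esub>} \<and>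
      x = finsum M c {d. c d \<noteq> \<zero>\<^bsub>M\<^esub>}) d"

context graded_module
begin

lemma hpart_carrier: "x \<in> hpart M d \<Longrightarrow> x \<in> carrier M"
  using hpart_subgroup[of d] by (auto dest: additive_subgroup.a_subset)

lemma hpart_zero: "\<zero>\<^bsub>M\<^esub> \<in> hpart M d"
  using hpart_subgroup[of d] by (auto dest: additive_subgroup.zero_closed)

lemma hpart_add: "x \<in> hpart M d \<Longrightarrow> y \<in> hpart M d \<Longrightarrow> x \<oplus>\<^bsub>M\<^esub> y \<in> hpart M d"
  using hpart_subgroup[of d] by (auto dest: additive_subgroup.a_closed)

lemma gcomp_props:
  assumes "x \<in> carrier M"
  shows "gcomp M d x \<in> hpart M d" "finite {d. gcomp M d x \<noteq> \<zero>\<^bsub>M\<^esub>}"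
    "x = finsum M (\<lambda>d. gcomp M d x) {d. gcomp M d x \<noteq> \<zero>\<^bsub>M\<^esub>}"
  using theI'[OF hpart_decomp[OF assms]] unfolding gcomp_def by blast+

lemma gcomp_carrier: "x \<in> carrier M \<Longrightarrow> gcomp M d x \<in> carrier M"
  using gcomp_props(1) hpart_carrier by blast

lemma gcomp_sum:
  assumes "x \<in> carrier M" "finite A" "{d. gcomp M d x \<noteq> \<zero>\<^bsub>M\<^esub>} \<subseteq> A"
  shows "x = finsum M (\<lambda>d. gcomp M d x) A"
  by (subst gcomp_props(3)[OF assms(1)],
      rule M.add.finprod_mono_neutral_cong_left) (use assms gcomp_carrier in auto)

lemma gcomp_unique:
  assumes "finite A" "\<And>d. d \<in> A \<Longrightarrow> c d \<in> hpart M d" "x = finsum M c A"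
  shows "gcomp M d x = (if d \<in> A then c d else \<zero>\<^bsub>M\<^esub>)"
proof -
  let ?c = "\<lambda>d. if d \<in> A then c d else \<zero>\<^bsub>M\<^esub>"
  have fin: "finite {d. ?c d \<noteq> \<zero>\<^bsub>M\<^esub>}" by (rule finite_subset[OF _ assms(1)]) auto
  have car: "?c d \<in> carrier M" for d using assms(2) hpart_carrier by auto
  have "finsum M ?c {d. ?c d \<noteq> \<zero>\<^bsub>M\<^esub>} = finsum M c A"
    by (rule M.add.finprod_mono_neutral_cong_left[OF assms(1)]) (use assms(2) hpart_carrier in auto)
  then have P: "(\<forall>d. ?c d \<in> hpart M d) \<and> finite {d. ?c d \<noteq> \<zero>\<^bsub>M\<^esub>} \<and> x = finsum M ?c {d. ?c d \<noteq> \<zero>\<^bsub>M\<^esub>}"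
    using assms fin hpart_zero by simp
  have x: "x \<in> carrier M" using assms hpart_carrier by (auto intro!: M.finsum_closed)
  show ?thesis unfolding gcomp_def by (subst the1_equality[where a = ?c, OF hpart_decomp[OF x] P]) simp
qed

lemma gcomp_hpart:
  assumes "x \<in> hpart M e"
  shows "gcomp M d x = (if d = e then x else \<zero>\<^bsub>M\<^esub>)"
  using gcomp_unique[of "{e}" "\<lambda>_. x" x d] assms hpart_carrier[OF assms] by (auto split: if_splits)

lemma gcomp_add:
  assumes "x \<in> carrier M" "y \<in> carrier M"
  shows "gcomp M d (x \<oplus>\<^bsub>M\<^esub> y) = gcomp M d x \<oplus>\<^bsub>M\<^esub> gcomp M d y"
proof -
  let ?A = "{d. gcomp M d x \<noteq> \<zero>\<^bsub>M\<^esub>} \<union> {d. gcomp M d y \<noteq> \<zero>\<^bsub>M\<^esub>}"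
  have fin: "finite ?A" using assms gcomp_props by auto
  have "x \<oplus>\<^bsub>M\<^esub> y = finsum M (\<lambda>d. gcomp M d x) ?A \<oplus>\<^bsub>M\<^esub> finsum M (\<lambda>d. gcomp M d y) ?A"
    using gcomp_sum[OF assms(1) fin] gcomp_sum[OF assms(2) fin] by simp
  also have "\<dots> = finsum M (\<lambda>d. gcomp M d x \<oplus>\<^bsub>M\<^esub> gcomp M d y) ?A"
    by (rule M.finsum_addf[symmetric]) (use assms gcomp_carrier in auto)
  finally have eq: "x \<oplus>\<^bsub>M\<^esub> y = finsum M (\<lambda>d. gcomp M d x \<oplus>\<^bsub>M\<^esub> gcomp M d y) ?A" .
  show ?thesis
    by (subst gcomp_unique[OF fin _ eq]) (use assms gcomp_props(1) hpart_add in auto)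
qed

lemma gcomp_zero: "gcomp M d \<zero>\<^bsub>M\<^esub> = \<zero>\<^bsub>M\<^esub>"
  using gcomp_hpart[OF hpart_zero, of d d] by simp

lemma gcomp_smult:
  assumes "r \<in> hpart R e" "r \<in> carrier R" "x \<in> carrier M"
  shows "gcomp M d (r \<odot>\<^bsub>M\<^esub> x) = r \<odot>\<^bsub>M\<^esub> gcomp M (d - e) x"
proof -
  let ?A = "{d. gcomp M d x \<noteq> \<zero>\<^bsub>M\<^esub>}"
  have fin: "finite ?A" using assms gcomp_props by auto
  have inj: "inj_on (\<lambda>d. d + e) ?A" by (auto simp: inj_on_def)
  have "r \<odot>\<^bsub>M\<^esub> x = r \<odot>\<^bsub>M\<^esub> finsum M (\<lambda>d. gcomp M d x) ?A" using gcomp_props(3)[OF assms(3)] by simp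
  also have "\<dots> = finsum M (\<lambda>d. r \<odot>\<^bsub>M\<^esub> gcomp M d x) ?A"
    by (rule finsum_hom) (use assms gcomp_carrier smult_r_distr M.abelian_group_axioms in auto)
  also have "\<dots> = finsum M (\<lambda>d. r \<odot>\<^bsub>M\<^esub> gcomp M (d - e) x) ((\<lambda>d. d + e) ` ?A)"
    by (subst M.finsum_reindex[OF _ inj]) (use assms gcomp_carrier in auto)
  finally have eq: "r \<odot>\<^bsub>M\<^esub> x = \<dots>" .
  have mem: "r \<odot>\<^bsub>M\<^esub> gcomp M (d - e) x \<in> hpart M d" for d
    using hpart_smult[OF assms(1) gcomp_props(1)[OF assms(3), of "d - e"]] by simp
  show ?thesis
  proof (subst gcomp_unique[OF _ mem eq])
    have "d \<notin> (\<lambda>d. d + e) ` ?A \<Longrightarrow> gcomp M (d - e) x = \<zero>\<^bsub>M\<^esub>"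
      by (metis (mono_tags, lifting) diff_add_cancel image_eqI mem_Collect_eq)
    then show "(if d \<in> (\<lambda>d. d + e) ` ?A then r \<odot>\<^bsub>M\<^esub> gcomp M (d - e) x else \<zero>\<^bsub>M\<^esub>) = r \<odot>\<^bsub>M\<^esub> gcomp M (d - e) x"
      using assms by auto
  qed (use fin in auto)
qed

end

lemma graded_homD:
  assumes "f \<in> graded_hom R M N"
  shows "x \<in> carrier M \<Longrightarrow> f x \<in> carrier N"
    "x \<in> carrier M \<Longrightarrow> y \<in> carrier M \<Longrightarrow> f (x \<oplus>\<^bsub>M\<^esub> y) = f x \<oplus>\<^bsub>N\<^esub> f y"
    "r \<in> carrier R \<Longrightarrow> x \<in> carrier M \<Longrightarrow> f (r \<odot>\<^bsub>M\<^esub> x) = r \<odot>\<^bsub>N\<^esub> f x"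
    "x \<in> hpart M d \<Longrightarrow> f x \<in> hpart N d"
  using assms unfolding graded_hom_def by blast+

lemma graded_homI:
  assumes "\<And>x. x \<in> carrier M \<Longrightarrow> f x \<in> carrier N"
    "\<And>x y. x \<in> carrier M \<Longrightarrow> y \<in> carrier M \<Longrightarrow> f (x \<oplus>\<^bsub>M\<^esub> y) = f x \<oplus>\<^bsub>N\<^esub> f y"
    "\<And>r x. r \<in> carrier R \<Longrightarrow> x \<in> carrier M \<Longrightarrow> f (r \<odot>\<^bsub>M\<^esub> x) = r \<odot>\<^bsub>N\<^esub> f x"
    "\<And>x d. x \<in> hpart M d \<Longrightarrow> f x \<in> hpart N d"
  shows "f \<in> graded_hom R M N"
  using assms unfolding graded_hom_def by auto

locale graded_map = M: graded_module R M + N: graded_module R N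
  for R :: "('r, 'r) gmodule" and M :: "('r, 'm) gmodule" and N :: "('r, 'n) gmodule" +
  fixes f assumes hom: "f \<in> graded_hom R M N"
begin

lemmas closed = graded_homD(1)[OF hom]
lemmas add = graded_homD(2)[OF hom]
lemmas smult = graded_homD(3)[OF hom]
lemmas hpart = graded_homD(4)[OF hom]

lemma zero: "f \<zero>\<^bsub>M\<^esub> = \<zero>\<^bsub>N\<^esub>"
  by (metis M.M.zero_closed M.R.zero_closed M.smult_l_null N.smult_l_null closed smult)

lemma minus: "x \<in> carrier M \<Longrightarrow> y \<in> carrier M \<Longrightarrow> f (x \<ominus>\<^bsub>M\<^esub> y) = f x \<ominus>\<^bsub>N\<^esub> f y"
  by (metis (no_types, lifting) M.M.minus_closed M.M.add.inv_solve_right M.M.minus_eq N.M.add.inv_solve_right N.M.minus_eq add closed)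

lemma gcomp: "x \<in> carrier M \<Longrightarrow> f (gcomp M d x) = gcomp N d (f x)"
proof -
  assume x: "x \<in> carrier M"
  let ?A = "{d. gcomp M d x \<noteq> \<zero>\<^bsub>M\<^esub>}"
  have fin: "finite ?A" using x M.gcomp_props by auto
  have "f x = f (finsum M (\<lambda>d. gcomp M d x) ?A)" using M.gcomp_props(3)[OF x] by simp
  also have "\<dots> = finsum N (\<lambda>d. f (gcomp M d x)) ?A"
    by (rule finsum_hom) (use x M.gcomp_carrier add closed M.M.abelian_group_axioms N.M.abelian_group_axioms in auto)
  finally have eq: "f x = \<dots>" .
  show ?thesis
    by (subst N.gcomp_unique[OF fin _ eq]) (use hpart M.gcomp_props(1)[OF x] zero in auto)
qed

text \<open>A map of degree 0 lifts homogeneous elements of its image to homogeneous elements: of any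
  preimage, keep the component in the right degree.\<close>

lemma hpart_preimage:
  assumes "f x \<in> hpart N d" "x \<in> carrier M"
  shows "gcomp M d x \<in> hpart M d" "f (gcomp M d x) = f x"
  using M.gcomp_props(1)[OF assms(2)] gcomp[OF assms(2)] N.gcomp_hpart[OF assms(1)] by auto

end

lemma graded_map_intro:
  "graded_module R M \<Longrightarrow> graded_module R N \<Longrightarrow> f \<in> graded_hom R M N \<Longrightarrow> graded_map R M N f"
  by (simp add: graded_map_def graded_map_axioms_def)

lemma (in graded_map) diff_kernel:
  "x \<in> carrier M \<Longrightarrow> y \<in> carrier M \<Longrightarrow> f x = f y \<Longrightarrow> f (x \<ominus>\<^bsub>M\<^esub> y) = \<zero>\<^bsub>N\<^esub>"
  using N.M.minus_zero_iff[of "f y" "f y"] by (simp add: minus closed)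

lemma graded_module_diff:
  assumes "graded_module R M" "x \<in> carrier M" "y \<in> carrier M"
  shows "x \<ominus>\<^bsub>M\<^esub> y \<in> carrier M" "y \<oplus>\<^bsub>M\<^esub> (x \<ominus>\<^bsub>M\<^esub> y) = x" "(x \<ominus>\<^bsub>M\<^esub> y) \<oplus>\<^bsub>M\<^esub> y = x"
proof -
  interpret graded_module R M by fact
  show "x \<ominus>\<^bsub>M\<^esub> y \<in> carrier M" using assms by simp
  show "y \<oplus>\<^bsub>M\<^esub> (x \<ominus>\<^bsub>M\<^esub> y) = x" using assms by (simp add: M.minus_eq M.a_lcomm M.r_neg)
  show "(x \<ominus>\<^bsub>M\<^esub> y) \<oplus>\<^bsub>M\<^esub> y = x" using assms by (simp add: M.minus_eq M.a_assoc M.l_neg)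
qed

text \<open>Gradings pass to images, provided the kernel is spanned by homogeneous elements.\<close>

lemma graded_module_image:
  assumes "graded_module R M"
    and R: "\<And>d. hpart R d \<subseteq> carrier R"
    and onto: "f ` carrier M = carrier N"
    and zero: "f \<zero>\<^bsub>M\<^esub> = \<zero>\<^bsub>N\<^esub>"
    and add: "\<And>x y. x \<in> carrier M \<Longrightarrow> y \<in> carrier M \<Longrightarrow> f (x \<oplus>\<^bsub>M\<^esub> y) = f x \<oplus>\<^bsub>N\<^esub> f y"
    and smult: "\<And>r x. r \<in> carrier R \<Longrightarrow> x \<in> carrier M \<Longrightarrow> f (r \<odot>\<^bsub>M\<^esub> x) = r \<odot>\<^bsub>N\<^esub> f x"
    and hpart: "\<And>d. hpart N d = f ` hpart M d"
    and ker: "\<And>x d. x \<in> carrier M \<Longrightarrow> f x = \<zero>\<^bsub>N\<^esub> \<Longrightarrow> f (gcomp M d x) = \<zero>\<^bsub>N\<^esub>"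
  shows "graded_module R N" "f \<in> graded_hom R M N"
proof -
  interpret M: graded_module R M by fact
  have car: "carrier N = f ` carrier M" using onto by simp
  have cl: "x \<in> carrier M \<Longrightarrow> f x \<in> carrier N" for x using onto by auto
  have N: "abelian_group N"
  proof (rule abelian_groupI)
    fix x y z assume "x \<in> carrier N" "y \<in> carrier N" "z \<in> carrier N"
    then show "x \<oplus>\<^bsub>N\<^esub> y \<oplus>\<^bsub>N\<^esub> z = x \<oplus>\<^bsub>N\<^esub> (y \<oplus>\<^bsub>N\<^esub> z)"
      unfolding car by (auto simp: add[symmetric] M.M.a_assoc)
  next
    fix x y assume "x \<in> carrier N" "y \<in> carrier N"
    then show "x \<oplus>\<^bsub>N\<^esub> y = y \<oplus>\<^bsub>N\<^esub> x" "x \<oplus>\<^bsub>N\<^esub> y \<in> carrier N"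
      unfolding car by (auto simp: add[symmetric] M.M.a_comm)
  next
    show "\<zero>\<^bsub>N\<^esub> \<in> carrier N" using cl[OF M.M.zero_closed] zero by simp
    fix x assume "x \<in> carrier N"
    then show "\<zero>\<^bsub>N\<^esub> \<oplus>\<^bsub>N\<^esub> x = x" "\<exists>y\<in>carrier N. y \<oplus>\<^bsub>N\<^esub> x = \<zero>\<^bsub>N\<^esub>"
      unfolding car by (auto simp: add[symmetric] zero[symmetric])
        (metis M.M.a_inv_closed M.M.l_neg)
  qed
  interpret N: abelian_group N by fact
  have mod: "module R N"
    by (rule moduleI[OF M.cring_axioms N])
       (auto simp: car add[symmetric] smult[symmetric] M.smult_l_distr M.smult_r_distr M.smult_assoc1)
  have fs: "f (finsum M c A) = finsum N (\<lambda>a. f (c a)) A" if "\<And>a. a \<in> A \<Longrightarrow> c a \<in> carrier M"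
    for c :: "'d \<Rightarrow> 'b" and A
    using finsum_hom[OF M.M.abelian_group_axioms N, of f] cl add that by auto
  show "graded_module R N"
  proof (rule graded_moduleI[OF mod])
    fix d
    interpret S: additive_subgroup "hpart M d" M by (rule M.hpart_subgroup)
    have hm: "group_hom (add_monoid M) (add_monoid N) f"
      using M.M.a_group N.a_group cl add by (auto simp: group_hom_def group_hom_axioms_def hom_def)
    show "additive_subgroup (hpart N d) N"
      unfolding hpart by (rule additive_subgroupI)
        (rule group_hom.subgroup_img_is_subgroup[OF hm S.a_subgroup])
  next
    fix r x d e assume "r \<in> hpart R d" "x \<in> hpart N e"
    then obtain y where y: "y \<in> hpart M e" "x = f y" unfolding hpart by auto
    moreover have "r \<in> carrier R" using R \<open>r \<in> hpart R d\<close> by blast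
    ultimately show "r \<odot>\<^bsub>N\<^esub> x \<in> hpart N (d + e)"
      using M.hpart_smult[OF \<open>r \<in> hpart R d\<close>, of y e] M.hpart_carrier[OF y(1)]
      unfolding hpart by (auto simp: smult[symmetric])
  next
    fix x assume "x \<in> carrier N"
    then obtain y where y: "y \<in> carrier M" "x = f y" unfolding car by auto
    let ?A = "{d. gcomp M d y \<noteq> \<zero>\<^bsub>M\<^esub>}"
    have "x = finsum N (\<lambda>d. f (gcomp M d y)) ?A"
      by (subst fs[symmetric]) (use M.gcomp_carrier[OF y(1)] M.gcomp_props(3)[OF y(1)] y in auto)
    then show "\<exists>A c. finite A \<and> (\<forall>d. c d \<in> hpart N d) \<and> x = finsum N c A"
      using M.gcomp_props[OF y(1)] unfolding hpart by (intro exI[of _ ?A] exI[of _ "\<lambda>d. f (gcomp M d y)"]) auto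
  next
    fix A c d
    assume A: "finite A" "\<forall>d. c d \<in> hpart N d" "finsum N c A = \<zero>\<^bsub>N\<^esub>" "d \<in> A"
    have "\<forall>d. \<exists>u. u \<in> hpart M d \<and> c d = f u" using A(2) unfolding hpart by blast
    then obtain u where u: "u d \<in> hpart M d" "c d = f (u d)" for d by metis
    then have uc: "u d \<in> carrier M" for d using M.hpart_carrier by blast
    have "f (finsum M u A) = \<zero>\<^bsub>N\<^esub>"
      using A(3) uc by (subst fs) (auto simp: u(2)[symmetric])
    then have "f (gcomp M d (finsum M u A)) = \<zero>\<^bsub>N\<^esub>"
      by (rule ker[rotated]) (use uc in \<open>auto intro!: M.M.finsum_closed\<close>)
    moreover have "gcomp M d (finsum M u A) = u d"
      using M.gcomp_unique[OF A(1), of u] u A(4) by simp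
    ultimately show "c d = \<zero>\<^bsub>N\<^esub>" using u by simp
  qed
  show "f \<in> graded_hom R M N" by (rule graded_homI) (use cl add smult hpart in auto)
qed

lemma gshift_simps [simp]:
  "carrier (gshift a M) = carrier M" "zero (gshift a M) = zero M" "add (gshift a M) = add M"
  "smult (gshift a M) = smult M" "hpart (gshift a M) d = hpart M (a + d)"
  by (simp_all add: gshift_def)

lemma gsub_simps [simp]:
  "carrier (gsub M H) = H" "zero (gsub M H) = zero M" "add (gsub M H) = add M"
  "smult (gsub M H) = smult M" "hpart (gsub M H) d = hpart M d \<inter> H"
  by (simp_all add: gsub_def)

lemma gquot_simps [simp]:
  "carrier (gquot M H) = a_rcosets\<^bsub>M\<^esub> H" "zero (gquot M H) = H"
  "add (gquot M H) = set_add M"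
  "smult (gquot M H) = (\<lambda>r X. \<Union>x\<in>X. H +>\<^bsub>M\<^esub> (r \<odot>\<^bsub>M\<^esub> x))"
  "hpart (gquot M H) d = (\<lambda>x. H +>\<^bsub>M\<^esub> x) ` hpart M d"
  by (simp_all add: gquot_def)

lemma graded_module_gshift:
  assumes "graded_module R M" shows "graded_module R (gshift a M)"
proof -
  interpret M: graded_module R M by fact
  have ag: "abelian_group (gshift a M)"
    by (rule abelian_groupI) (auto simp: M.M.a_assoc M.M.a_comm M.M.a_lcomm M.M.l_neg intro: M.M.a_inv_closed bexI[of _ "\<ominus>\<^bsub>M\<^esub> x" for x])
  have mod: "module R (gshift a M)"
    by (rule moduleI[OF M.cring_axioms ag])
       (auto simp: M.smult_l_distr M.smult_r_distr M.smult_assoc1)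
  have fs: "finsum (gshift a M) c A = finsum M c A" if "\<And>x. x \<in> A \<Longrightarrow> c x \<in> carrier M"
    for c :: "'d \<Rightarrow> 'b" and A
    using finsum_hom[OF M.M.abelian_group_axioms ag, of "\<lambda>x. x" A c] that by simp
  show ?thesis
  proof (rule graded_moduleI[OF mod])
    show "additive_subgroup (hpart (gshift a M) d) (gshift a M)" for d
      using M.hpart_subgroup[of "a + d"] by (simp add: additive_subgroup_def gshift_def)
    show "r \<odot>\<^bsub>gshift a M\<^esub> x \<in> hpart (gshift a M) (d + e)"
      if "r \<in> hpart R d" "x \<in> hpart (gshift a M) e" for r x d e
      using M.hpart_smult[of r d x "a + e"] that by (simp add: ac_simps)
  next
    fix x assume x: "x \<in> carrier (gshift a M)"
    let ?A = "{d. gcomp M d x \<noteq> \<zero>\<^bsub>M\<^esub>}"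
    have inj: "inj_on (\<lambda>d. d - a) ?A" by (auto simp: inj_on_def)
    have "x = finsum M (\<lambda>d. gcomp M d x) ?A" using M.gcomp_props x by simp
    also have "\<dots> = finsum M (\<lambda>d. gcomp M (a + d) x) ((\<lambda>d. d - a) ` ?A)"
      by (subst M.M.finsum_reindex[OF _ inj]) (use x M.gcomp_carrier in auto)
    finally show "\<exists>A c. finite A \<and> (\<forall>d. c d \<in> hpart (gshift a M) d) \<and> x = finsum (gshift a M) c A"
      using x M.gcomp_props M.gcomp_carrier
      by (intro exI[of _ "(\<lambda>d. d - a) ` ?A"] exI[of _ "\<lambda>d. gcomp M (a + d) x"]) (auto simp: fs)
  next
    fix A c d
    assume A: "finite A" "\<forall>d. c d \<in> hpart (gshift a M) d" "finsum (gshift a M) c A = \<zero>\<^bsub>gshift a M\<^esub>" "d \<in> A"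
    then have cc: "c d \<in> carrier M" for d using M.hpart_carrier by auto
    have inj: "inj_on (\<lambda>d. a + d) A" by (auto simp: inj_on_def)
    have "finsum M (\<lambda>d. c (d - a)) ((\<lambda>d. a + d) ` A) = finsum M c A"
      by (subst M.M.finsum_reindex[OF _ inj]) (use cc in auto)
    then have eq: "\<zero>\<^bsub>M\<^esub> = finsum M (\<lambda>d. c (d - a)) ((\<lambda>d. a + d) ` A)" using A(3) cc by (simp add: fs)
    have "c (e - a) \<in> hpart M e" for e using A(2)[rule_format, of "e - a"] by simp
    from M.gcomp_unique[OF _ this eq, of "a + d"] A show "c d = \<zero>\<^bsub>gshift a M\<^esub>"
      by (simp add: M.gcomp_zero)
  qed
qed

lemma gcomp_gshift:
  assumes "graded_module R M" "x \<in> carrier M"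
  shows "gcomp (gshift a M) d x = gcomp M (a + d) x"
proof -
  interpret M: graded_module R M by fact
  interpret S: graded_module R "gshift a M" by (rule graded_module_gshift[OF M.graded_module_axioms])
  let ?A = "{d. gcomp (gshift a M) d x \<noteq> \<zero>\<^bsub>gshift a M\<^esub>}"
  have x: "x \<in> carrier (gshift a M)" using assms by simp
  note p = S.gcomp_props[OF x] and c = S.gcomp_carrier[OF x]
  have fin: "finite ?A" using p(2) .
  have inj: "inj_on (\<lambda>d. a + d) ?A" by (auto simp: inj_on_def)
  have "x = finsum (gshift a M) (\<lambda>d. gcomp (gshift a M) d x) ?A" by (rule p(3))
  also have "\<dots> = finsum M (\<lambda>d. gcomp (gshift a M) d x) ?A"
    by (rule finsum_hom[OF S.M.abelian_group_axioms M.M.abelian_group_axioms, of "\<lambda>x. x"]) (use c in auto)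
  also have "\<dots> = finsum M (\<lambda>d. gcomp (gshift a M) (d - a) x) ((\<lambda>d. a + d) ` ?A)"
    by (subst M.M.finsum_reindex[OF _ inj]) (use c in auto)
  finally have eq: "x = finsum M (\<lambda>d. gcomp (gshift a M) (d - a) x) ((\<lambda>d. a + d) ` ?A)" .
  have mem: "gcomp (gshift a M) (e - a) x \<in> hpart M e" for e using p(1)[of "e - a"] by simp
  show ?thesis
    using M.gcomp_unique[OF finite_imageI[OF fin] mem eq, of "a + d"] by auto
qed

lemma graded_hom_gshift: "f \<in> graded_hom R M N \<Longrightarrow> f \<in> graded_hom R (gshift a M) (gshift a N)"
  unfolding graded_hom_def by simp

definition graded_submodule where
  "graded_submodule R M H \<longleftrightarrow> H \<subseteq> carrier M \<and> \<zero>\<^bsub>M\<^esub> \<in> H \<and> (\<forall>x\<in>H. \<forall>y\<in>H. x \<oplus>\<^bsub>M\<^esub> y \<in> H) \<and>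
    (\<forall>r\<in>carrier R. \<forall>x\<in>H. r \<odot>\<^bsub>M\<^esub> x \<in> H) \<and> (\<forall>x\<in>H. \<forall>d. gcomp M d x \<in> H)"

lemma graded_submoduleD:
  assumes "graded_submodule R M H"
  shows "x \<in> H \<Longrightarrow> x \<in> carrier M" "\<zero>\<^bsub>M\<^esub> \<in> H" "x \<in> H \<Longrightarrow> y \<in> H \<Longrightarrow> x \<oplus>\<^bsub>M\<^esub> y \<in> H"
    "r \<in> carrier R \<Longrightarrow> x \<in> H \<Longrightarrow> r \<odot>\<^bsub>M\<^esub> x \<in> H" "x \<in> H \<Longrightarrow> gcomp M d x \<in> H"
  using assms unfolding graded_submodule_def by auto

lemma (in module) smult_minus_one:
  "x \<in> carrier M \<Longrightarrow> (\<ominus> \<one>) \<odot>\<^bsub>M\<^esub> x = \<ominus>\<^bsub>M\<^esub> x"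
  by (simp add: smult_l_minus)

lemma (in graded_module) graded_submodule_minus:
  assumes "graded_submodule R M H" "x \<in> H"
  shows "\<ominus>\<^bsub>M\<^esub> x \<in> H"
  using graded_submoduleD(1,4)[OF assms(1)] assms(2) smult_minus_one by (metis R.a_inv_closed R.one_closed)

lemma (in graded_module) graded_submodule_subgroup:
  assumes "graded_submodule R M H" shows "additive_subgroup H M"
  by (rule additive_subgroupI, rule M.add.subgroupI)
    (use graded_submoduleD[OF assms] graded_submodule_minus[OF assms] in \<open>auto simp: a_inv_def\<close>)

lemma graded_module_gsub:
  assumes "graded_module R M" and R: "\<And>d. hpart R d \<subseteq> carrier R"
    and H: "graded_submodule R M H"
  shows "graded_module R (gsub M H)" "(\<lambda>x. x) \<in> graded_hom R (gsub M H) M"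
proof -
  interpret M: graded_module R M by fact
  note HD = graded_submoduleD[OF H]
  note car = HD(1)
  have ag: "abelian_group (gsub M H)"
  proof (rule abelian_groupI)
    fix x assume x: "x \<in> carrier (gsub M H)"
    then show "\<exists>y\<in>carrier (gsub M H). y \<oplus>\<^bsub>gsub M H\<^esub> x = \<zero>\<^bsub>gsub M H\<^esub>"
      using M.graded_submodule_minus[OF H] car M.M.l_neg by (auto intro!: bexI[of _ "\<ominus>\<^bsub>M\<^esub> x"])
  qed (use HD car in \<open>auto simp: M.M.a_assoc M.M.a_comm M.M.a_lcomm\<close>)
  have mod: "module R (gsub M H)"
    by (rule moduleI[OF M.cring_axioms ag])
       (use HD car in \<open>auto simp: M.smult_l_distr M.smult_r_distr M.smult_assoc1\<close>)
  have fs: "finsum (gsub M H) c A = finsum M c A" if "\<And>x. x \<in> A \<Longrightarrow> c x \<in> H"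
    for c :: "'d \<Rightarrow> 'b" and A
    using finsum_hom[OF ag M.M.abelian_group_axioms, of "\<lambda>x. x" A c] that car by auto
  interpret H: additive_subgroup H M by (rule M.graded_submodule_subgroup[OF H])
  show "graded_module R (gsub M H)"
  proof (rule graded_moduleI[OF mod])
    fix d
    interpret D: additive_subgroup "hpart M d" M by (rule M.hpart_subgroup)
    interpret N: abelian_group "gsub M H" by fact
    show "additive_subgroup (hpart (gsub M H) d) (gsub M H)"
    proof (rule additive_subgroupI, rule N.add.subgroupI)
      fix x assume x: "x \<in> hpart (gsub M H) d"
      have "\<ominus>\<^bsub>gsub M H\<^esub> x = \<ominus>\<^bsub>M\<^esub> x"
        by (rule N.minus_equality) (use x car M.M.l_neg M.graded_submodule_minus[OF H] in auto)
      then show "\<ominus>\<^bsub>gsub M H\<^esub> x \<in> hpart (gsub M H) d"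
        using x M.graded_submodule_minus[OF H] D.a_inv_closed by simp
    qed (use HD(2,3) car D.zero_closed in \<open>auto simp: disjoint_iff intro!: exI[of _ "\<zero>\<^bsub>M\<^esub>"]\<close>)
  next
    show "r \<odot>\<^bsub>gsub M H\<^esub> x \<in> hpart (gsub M H) (d + e)"
      if "r \<in> hpart R d" "x \<in> hpart (gsub M H) e" for r x d e
      using that M.hpart_smult subsetD[OF R that(1)] HD(4) by auto
  next
    fix x assume "x \<in> carrier (gsub M H)"
    then have x: "x \<in> H" by simp
    have "x = finsum (gsub M H) (\<lambda>d. gcomp M d x) {d. gcomp M d x \<noteq> \<zero>\<^bsub>M\<^esub>}"
      using M.gcomp_props[OF car[OF x]] HD(5)[OF x] by (simp add: fs)
    then show "\<exists>A c. finite A \<and> (\<forall>d. c d \<in> hpart (gsub M H) d) \<and> x = finsum (gsub M H) c A"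
      using M.gcomp_props[OF car[OF x]] HD(5)[OF x]
      by (intro exI[of _ "{d. gcomp M d x \<noteq> \<zero>\<^bsub>M\<^esub>}"] exI[of _ "\<lambda>d. gcomp M d x"]) auto
  next
    fix A c d
    assume A: "finite A" "\<forall>d. c d \<in> hpart (gsub M H) d" "finsum (gsub M H) c A = \<zero>\<^bsub>gsub M H\<^esub>" "d \<in> A"
    then have eq: "\<zero>\<^bsub>M\<^esub> = finsum M c A" by (simp add: fs)
    show "c d = \<zero>\<^bsub>gsub M H\<^esub>"
      using M.gcomp_unique[OF A(1) _ eq, of d] A by (auto simp: M.gcomp_zero)
  qed
  show "(\<lambda>x. x) \<in> graded_hom R (gsub M H) M"
    by (rule graded_homI) (use car in auto)
qed

lemma graded_hom_gsub:
  assumes "f \<in> graded_hom R M N" "H \<subseteq> carrier M" "\<And>x. x \<in> H \<Longrightarrow> f x \<in> H'"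
  shows "f \<in> graded_hom R (gsub M H) (gsub N H')"
  by (rule graded_homI) (use assms(2,3) graded_homD[OF assms(1)] in \<open>auto simp: subset_iff\<close>)

lemma (in graded_module) gcomp_gsub:
  assumes H: "graded_submodule R M H" and R: "\<And>d. hpart R d \<subseteq> carrier R" and x: "x \<in> H"
  shows "gcomp (gsub M H) d x = gcomp M d x"
proof -
  interpret graded_map R "gsub M H" M "\<lambda>x. x"
    by (rule graded_map_intro) (use graded_module_gsub[OF graded_module_axioms R H] graded_module_axioms in auto)
  show ?thesis using gcomp[of x d] x by simp
qed

context graded_map
begin

lemma kernel_graded_submodule: "graded_submodule R M {x \<in> carrier M. f x = \<zero>\<^bsub>N\<^esub>}"
  unfolding graded_submodule_def
  by (auto simp: add smult zero M.gcomp_carrier gcomp N.gcomp_zero)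

lemma preimage_graded_submodule:
  assumes "graded_submodule R N H"
  shows "graded_submodule R M {x \<in> carrier M. f x \<in> H}"
  using graded_submoduleD[OF assms] unfolding graded_submodule_def
  by (auto simp: add smult zero M.gcomp_carrier gcomp)

lemma image_graded_submodule:
  assumes "graded_submodule R M H"
  shows "graded_submodule R N (f ` H)"
proof -
  note HD = graded_submoduleD[OF assms]
  show ?thesis
    unfolding graded_submodule_def
  proof (intro conjI ballI allI)
    show "\<zero>\<^bsub>N\<^esub> \<in> f ` H" using HD(2) zero by (metis imageI)
    show "x \<oplus>\<^bsub>N\<^esub> y \<in> f ` H" if xy: "x \<in> f ` H" "y \<in> f ` H" for x y
    proof -
      obtain u v where "u \<in> H" "v \<in> H" "x = f u" "y = f v" using xy by auto
      then show ?thesis using HD(1,3) by (auto simp: add[symmetric])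
    qed
    show "r \<odot>\<^bsub>N\<^esub> x \<in> f ` H" if xy: "x \<in> f ` H" "r \<in> carrier R" for x r
    proof -
      obtain u where "u \<in> H" "x = f u" using xy by auto
      then show ?thesis using HD(1,4) xy by (auto simp: smult[symmetric])
    qed
    show "gcomp N d x \<in> f ` H" if xy: "x \<in> f ` H" for x d
    proof -
      obtain u where "u \<in> H" "x = f u" using xy by auto
      then show ?thesis using HD(1,5) by (auto simp: gcomp[symmetric])
    qed
  qed (use HD(1) closed in auto)
qed

end

lemma (in graded_module) graded_submodule_carrier: "graded_submodule R M (carrier M)"
  unfolding graded_submodule_def by (auto simp: gcomp_carrier)

lemma graded_submodule_gsub:
  assumes M: "graded_module R M" and R: "\<And>d. hpart R d \<subseteq> carrier R"
    and K: "graded_submodule R M K" and H: "graded_submodule R M H" and "H \<subseteq> K"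
  shows "graded_submodule R (gsub M K) H"
proof -
  have "gcomp (gsub M K) d x = gcomp M d x" if "x \<in> H" for x d
    by (rule graded_module.gcomp_gsub[OF M K R]) (use that \<open>H \<subseteq> K\<close> in auto)
  then show ?thesis using H \<open>H \<subseteq> K\<close> unfolding graded_submodule_def by auto
qed

lemma graded_module_gquot:
  assumes "graded_module R M" and R: "\<And>d. hpart R d \<subseteq> carrier R"
    and H: "graded_submodule R M H"
  shows "graded_module R (gquot M H)" "(\<lambda>x. H +>\<^bsub>M\<^esub> x) \<in> graded_hom R M (gquot M H)"
    "(\<lambda>x. H +>\<^bsub>M\<^esub> x) ` carrier M = carrier (gquot M H)"
    "\<And>x. x \<in> carrier M \<Longrightarrow> H +>\<^bsub>M\<^esub> x = \<zero>\<^bsub>gquot M H\<^esub> \<longleftrightarrow> x \<in> H"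
proof -
  interpret M: graded_module R M by fact
  note HD = graded_submoduleD[OF H]
  interpret H: abelian_subgroup H M
    by (rule abelian_subgroupI3[OF M.graded_submodule_subgroup[OF H] M.M.abelian_group_axioms])
  show onto: "(\<lambda>x. H +>\<^bsub>M\<^esub> x) ` carrier M = carrier (gquot M H)"
    by (auto simp: A_RCOSETS_def')
  show ker: "H +>\<^bsub>M\<^esub> x = \<zero>\<^bsub>gquot M H\<^esub> \<longleftrightarrow> x \<in> H" if x: "x \<in> carrier M" for x
    using H.a_rcos_self[OF x] M.M.a_coset_join2[OF x H.a_subgroup] by auto
  have z: "H +>\<^bsub>M\<^esub> \<zero>\<^bsub>M\<^esub> = \<zero>\<^bsub>gquot M H\<^esub>" using ker[OF M.M.zero_closed] HD(2) by simp
  have sm: "(\<Union>y\<in>H +>\<^bsub>M\<^esub> x. H +>\<^bsub>M\<^esub> (r \<odot>\<^bsub>M\<^esub> y)) = H +>\<^bsub>M\<^esub> (r \<odot>\<^bsub>M\<^esub> x)"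
    if rx: "r \<in> carrier R" "x \<in> carrier M" for r x
  proof -
    have *: "H +>\<^bsub>M\<^esub> (r \<odot>\<^bsub>M\<^esub> y) = H +>\<^bsub>M\<^esub> (r \<odot>\<^bsub>M\<^esub> x)" if y: "y \<in> H +>\<^bsub>M\<^esub> x" for y
    proof -
      obtain h where h: "h \<in> H" "y = h \<oplus>\<^bsub>M\<^esub> x" using y unfolding a_r_coset_def' by blast
      have "r \<odot>\<^bsub>M\<^esub> y = r \<odot>\<^bsub>M\<^esub> h \<oplus>\<^bsub>M\<^esub> r \<odot>\<^bsub>M\<^esub> x" using h rx HD(1) by (simp add: M.smult_r_distr)
      then have "r \<odot>\<^bsub>M\<^esub> y \<in> H +>\<^bsub>M\<^esub> (r \<odot>\<^bsub>M\<^esub> x)"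
        using HD(4)[OF rx(1) h(1)] unfolding a_r_coset_def' by blast
      then show ?thesis
        by (rule M.M.a_repr_independence[OF _ _ H.a_subgroup, symmetric]) (use rx in simp)
    qed
    show ?thesis
    proof (intro equalityI UN_least)
      show "H +>\<^bsub>M\<^esub> (r \<odot>\<^bsub>M\<^esub> y) \<subseteq> H +>\<^bsub>M\<^esub> (r \<odot>\<^bsub>M\<^esub> x)" if "y \<in> H +>\<^bsub>M\<^esub> x" for y
        using *[OF that] by simp
    qed (use H.a_rcos_self[OF rx(2)] in blast)
  qed
  show "graded_module R (gquot M H)" "(\<lambda>x. H +>\<^bsub>M\<^esub> x) \<in> graded_hom R M (gquot M H)"
    by (rule graded_module_image[OF assms(1) R onto z];
        use H.a_rcos_sum sm ker HD(5) M.gcomp_carrier in auto)+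
qed

text \<open>The induced map has degree 0 because homogeneous elements of \<open>N\<close> have homogeneous preimages.\<close>

lemma graded_hom_factor:
  assumes "graded_map R M N f" "graded_map R M L g"
    and onto: "f ` carrier M = carrier N"
    and ker: "\<And>x. x \<in> carrier M \<Longrightarrow> f x = \<zero>\<^bsub>N\<^esub> \<Longrightarrow> g x = \<zero>\<^bsub>L\<^esub>"
  obtains h where "h \<in> graded_hom R N L" "\<And>x. x \<in> carrier M \<Longrightarrow> h (f x) = g x"
proof -
  interpret f: graded_map R M N f by fact
  interpret g: graded_map R M L g by fact
  define h where "h y = g (SOME x. x \<in> carrier M \<and> f x = y)" for y
  have hf: "h (f x) = g x" if x: "x \<in> carrier M" for x
  proof -
    define y where "y = (SOME y. y \<in> carrier M \<and> f y = f x)"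
    have y: "y \<in> carrier M" "f y = f x"
      unfolding y_def using someI[of "\<lambda>y. y \<in> carrier M \<and> f y = f x" x] x by auto
    have "f (y \<ominus>\<^bsub>M\<^esub> x) = \<zero>\<^bsub>N\<^esub>" using x y f.N.M.minus_zero_iff by (simp add: f.minus f.closed)
    then have "g (y \<ominus>\<^bsub>M\<^esub> x) = \<zero>\<^bsub>L\<^esub>" using ker x y by blast
    then show ?thesis using x y g.N.M.minus_zero_iff by (simp add: g.minus g.closed h_def y_def[symmetric])
  qed
  have "h \<in> graded_hom R N L"
  proof (rule graded_homI)
    show "h x \<in> carrier L" if "x \<in> carrier N" for x
      using that unfolding onto[symmetric] by (auto simp: hf g.closed)
    show "h (x \<oplus>\<^bsub>N\<^esub> y) = h x \<oplus>\<^bsub>L\<^esub> h y" if xy: "x \<in> carrier N" "y \<in> carrier N" for x y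
    proof -
      obtain u v where uv: "u \<in> carrier M" "v \<in> carrier M" "x = f u" "y = f v"
        using xy unfolding onto[symmetric] by auto
      then show ?thesis
        using hf[of "u \<oplus>\<^bsub>M\<^esub> v"] hf[of u] hf[of v] by (simp add: f.add g.add)
    qed
    show "h (r \<odot>\<^bsub>N\<^esub> x) = r \<odot>\<^bsub>L\<^esub> h x" if xy: "r \<in> carrier R" "x \<in> carrier N" for r x
    proof -
      obtain u where uv: "u \<in> carrier M" "x = f u"
        using xy unfolding onto[symmetric] by auto
      then show ?thesis
        using hf[of "r \<odot>\<^bsub>M\<^esub> u"] hf[of u] xy by (simp add: f.smult g.smult)
    qed
    show "h x \<in> hpart L d" if x: "x \<in> hpart N d" for x d
    proof -
      obtain u where u: "u \<in> carrier M" "x = f u" using f.N.hpart_carrier[OF x] onto by auto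
      have "gcomp M d u \<in> hpart M d" "f (gcomp M d u) = x"
        using f.hpart_preimage[of u d] u x by auto
      then show ?thesis using hf[of "gcomp M d u"] u f.M.gcomp_carrier g.hpart by metis
    qed
  qed
  then show thesis using hf that by blast
qed

lemma graded_map_gshift: "graded_map R M N f \<Longrightarrow> graded_map R (gshift a M) (gshift a N) f"
  by (simp add: graded_map_def graded_map_axioms_def graded_module_gshift graded_hom_gshift)

lemma graded_map_comp:
  assumes "graded_map R M N f" "graded_map R N L g"
  shows "graded_map R M L (\<lambda>x. g (f x))"
proof -
  interpret f: graded_map R M N f by fact
  interpret g: graded_map R N L g by fact
  show ?thesis
    by (intro graded_map_intro graded_homI f.M.graded_module_axioms g.N.graded_module_axioms)
       (simp_all only: f.closed f.add f.smult f.hpart g.closed g.add g.smult g.hpart)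
qed

lemma graded_map_exact_at:
  assumes "graded_map R L M f" "graded_map R M N g"
    and "\<And>y. y \<in> carrier M \<Longrightarrow> g y = \<zero>\<^bsub>N\<^esub> \<longleftrightarrow> y \<in> f ` carrier L"
  shows "exact_at R L f M g N"
proof -
  interpret f: graded_map R L M f by fact
  interpret g: graded_map R M N g by fact
  have "f ` carrier L = a_kernel M N g"
    unfolding a_kernel_def' using assms(3) f.closed by blast
  then show ?thesis
    unfolding exact_at_def using assms(2)[unfolded graded_map_def, THEN conjunct1] f.M.graded_module_axioms g.N.graded_module_axioms f.hom g.hom by simp
qed

section \<open>Correspondences of subquotients\<close>

text \<open>An additive relation \<open>Z\<close> that induces an isomorphism of graded modules from \<open>M\<close> modulo \<open>A\<close> to \<open>N\<close> modulo
  \<open>B\<close>. In contrast to isomorphisms between quotients, such relations can be written down without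
  choosing lifts, and they compose as relations.\<close>

definition graded_corr where
  "graded_corr R M A N B Z \<longleftrightarrow> graded_module R M \<and> graded_module R N \<and> Z \<subseteq> carrier M \<times> carrier N \<and>
    (\<forall>x y x' y'. (x, y) \<in> Z \<longrightarrow> (x', y') \<in> Z \<longrightarrow> (x \<oplus>\<^bsub>M\<^esub> x', y \<oplus>\<^bsub>N\<^esub> y') \<in> Z) \<and>
    (\<forall>r x y. r \<in> carrier R \<longrightarrow> (x, y) \<in> Z \<longrightarrow> (r \<odot>\<^bsub>M\<^esub> x, r \<odot>\<^bsub>N\<^esub> y) \<in> Z) \<and>
    (\<forall>d. \<forall>x\<in>hpart M d. \<exists>y\<in>hpart N d. (x, y) \<in> Z) \<and>
    (\<forall>d. \<forall>y\<in>hpart N d. \<exists>x\<in>hpart M d. (x, y) \<in> Z) \<and>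
    (\<forall>x y. (x, y) \<in> Z \<longrightarrow> (x \<in> A \<longleftrightarrow> y \<in> B))"

lemma graded_corrI:
  assumes "graded_module R M" "graded_module R N" 
    "\<And>x y. (x, y) \<in> Z \<Longrightarrow> x \<in> carrier M \<and> y \<in> carrier N"
    "\<And>x y x' y'. (x, y) \<in> Z \<Longrightarrow> (x', y') \<in> Z \<Longrightarrow> (x \<oplus>\<^bsub>M\<^esub> x', y \<oplus>\<^bsub>N\<^esub> y') \<in> Z"
    "\<And>r x y. r \<in> carrier R \<Longrightarrow> (x, y) \<in> Z \<Longrightarrow> (r \<odot>\<^bsub>M\<^esub> x, r \<odot>\<^bsub>N\<^esub> y) \<in> Z"
    "\<And>d x. x \<in> hpart M d \<Longrightarrow> \<exists>y\<in>hpart N d. (x, y) \<in> Z"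
    "\<And>d y. y \<in> hpart N d \<Longrightarrow> \<exists>x\<in>hpart M d. (x, y) \<in> Z"
    "\<And>x y. (x, y) \<in> Z \<Longrightarrow> x \<in> A \<longleftrightarrow> y \<in> B"
  shows "graded_corr R M A N B Z"
  unfolding graded_corr_def using assms by auto

lemma graded_corrD:
  assumes "graded_corr R M A N B Z"
  shows "graded_module R M" "graded_module R N" 
    "(x, y) \<in> Z \<Longrightarrow> x \<in> carrier M \<and> y \<in> carrier N"
    "(x, y) \<in> Z \<Longrightarrow> (x', y') \<in> Z \<Longrightarrow> (x \<oplus>\<^bsub>M\<^esub> x', y \<oplus>\<^bsub>N\<^esub> y') \<in> Z"
    "r \<in> carrier R \<Longrightarrow> (x, y) \<in> Z \<Longrightarrow> (r \<odot>\<^bsub>M\<^esub> x, r \<odot>\<^bsub>N\<^esub> y) \<in> Z"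
    "x \<in> hpart M d \<Longrightarrow> \<exists>y\<in>hpart N d. (x, y) \<in> Z"
    "y \<in> hpart N d \<Longrightarrow> \<exists>x\<in>hpart M d. (x, y) \<in> Z"
    "(x, y) \<in> Z \<Longrightarrow> x \<in> A \<longleftrightarrow> y \<in> B"
  using assms unfolding graded_corr_def by auto

lemma graded_corr_trans:
  assumes "graded_corr R M A N B Z" "graded_corr R N B L C Y"
  shows "graded_corr R M A L C (Z O Y)"
proof -
  note Z = graded_corrD[OF assms(1)] and Y = graded_corrD[OF assms(2)]
  show ?thesis
  proof (rule graded_corrI)
    show "\<exists>y\<in>hpart L d. (x, y) \<in> Z O Y" if "x \<in> hpart M d" for d x
      using Z(6)[OF that] Y(6) by blast
    show "\<exists>x\<in>hpart M d. (x, y) \<in> Z O Y" if "y \<in> hpart L d" for d y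
      using Y(7)[OF that] Z(7) by blast
    show "(x \<oplus>\<^bsub>M\<^esub> x', y \<oplus>\<^bsub>L\<^esub> y') \<in> Z O Y" if "(x, y) \<in> Z O Y" "(x', y') \<in> Z O Y" for x y x' y'
      using that Z(4) Y(4) by (elim relcompEpair) (rule relcompI)
    show "(r \<odot>\<^bsub>M\<^esub> x, r \<odot>\<^bsub>L\<^esub> y) \<in> Z O Y" if "r \<in> carrier R" "(x, y) \<in> Z O Y" for r x y
      using that Z(5) Y(5) by (elim relcompEpair) (rule relcompI)
    show "x \<in> A \<longleftrightarrow> y \<in> C" if "(x, y) \<in> Z O Y" for x y
      using that Z(8) Y(8) by (elim relcompEpair) blast
    show "x \<in> carrier M \<and> y \<in> carrier L" if "(x, y) \<in> Z O Y" for x y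
      using that Z(3) Y(3) by blast
  qed (rule Z(1) Y(2))+
qed

lemma graded_corr_converse:
  "graded_corr R M A N B Z \<Longrightarrow> graded_corr R N B M A (Z\<inverse>)"
  unfolding graded_corr_def by auto

lemma graded_corr_map:
  assumes "graded_map R M N f" and onto: "f ` carrier M = carrier N"
    and AB: "\<And>x. x \<in> carrier M \<Longrightarrow> x \<in> A \<longleftrightarrow> f x \<in> B"
  shows "graded_corr R M A N B {(x, f x) | x. x \<in> carrier M}"
proof -
  interpret graded_map R M N f by fact
  show ?thesis
  proof (rule graded_corrI)
    show "\<exists>x\<in>hpart M d. (x, y) \<in> {(x, f x) | x. x \<in> carrier M}" if y: "y \<in> hpart N d" for y d
    proof -
      obtain u where u: "u \<in> carrier M" "y = f u" using N.hpart_carrier[OF y] onto by auto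
      then show ?thesis using hpart_preimage[of u d] y M.hpart_carrier
        by (intro bexI[of _ "gcomp M d u"]) auto
    qed
  qed (use M.graded_module_axioms N.graded_module_axioms AB in \<open>auto simp: closed add smult hpart M.hpart_carrier\<close>)
qed

text \<open>Related homogeneous elements add up to related elements, so the relation is total. It is
  single-valued because zero is related to zero, and hence to nothing else.\<close>

lemma graded_corr_function:
  assumes "graded_corr R M A N {\<zero>\<^bsub>N\<^esub>} Z"
  obtains f where "graded_map R M N f" "f ` carrier M = carrier N"
    "\<And>x. x \<in> carrier M \<Longrightarrow> f x = \<zero>\<^bsub>N\<^esub> \<longleftrightarrow> x \<in> A"
proof -
  note Z = graded_corrD[OF assms]
  interpret M: graded_module R M by (rule Z(1))
  interpret N: graded_module R N by (rule Z(2))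
  have zz: "(\<zero>\<^bsub>M\<^esub>, \<zero>\<^bsub>N\<^esub>) \<in> Z"
  proof -
    obtain y where y: "(\<zero>\<^bsub>M\<^esub>, y) \<in> Z" using Z(6)[OF M.hpart_zero] by blast
    then show ?thesis using Z(5)[OF M.R.zero_closed y] Z(3)[OF y] by simp
  qed
  have minus: "(x \<ominus>\<^bsub>M\<^esub> x', y \<ominus>\<^bsub>N\<^esub> y') \<in> Z" if "(x, y) \<in> Z" "(x', y') \<in> Z" for x y x' y'
    using Z(4)[OF that(1) Z(5)[OF _ that(2), of "\<ominus>\<^bsub>R\<^esub> \<one>\<^bsub>R\<^esub>"]] Z(3)[OF that(2)]
    by (simp add: M.smult_minus_one N.smult_minus_one M.M.minus_eq N.M.minus_eq)
  have sums: "(finsum M c E, finsum N e E) \<in> Z" if "finite E" "\<And>d. d \<in> E \<Longrightarrow> (c d, e d) \<in> Z"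
    for c e and E :: "int set"
    using that
  proof (induction E)
    case (insert a E)
    have "c a \<in> carrier M" "e a \<in> carrier N" "c \<in> E \<rightarrow> carrier M" "e \<in> E \<rightarrow> carrier N"
      using insert Z(3) by blast+
    then show ?case using insert Z(4) by (simp add: M.M.finsum_insert N.M.finsum_insert)
  qed (simp add: zz)
  have uniq: "y = y'" if "(x, y) \<in> Z" "(x, y') \<in> Z" for x y y'
  proof -
    have "(\<zero>\<^bsub>M\<^esub>, y \<ominus>\<^bsub>N\<^esub> y') \<in> Z"
      using minus[OF that] Z(3)[OF that(1)] M.M.minus_zero_iff[of x x] by simp
    then have "y \<ominus>\<^bsub>N\<^esub> y' = \<zero>\<^bsub>N\<^esub>" using Z(8) zz by blast
    then show ?thesis using N.M.minus_zero_iff that Z(3) by blast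
  qed
  have total: "\<exists>y. (x, y) \<in> Z" if x: "x \<in> carrier M" for x
  proof -
    have "\<forall>d. \<exists>y. (gcomp M d x, y) \<in> Z" using Z(6) M.gcomp_props(1)[OF x] by blast
    then obtain e where "\<And>d. (gcomp M d x, e d) \<in> Z" by metis
    then show ?thesis using sums[of "{d. gcomp M d x \<noteq> \<zero>\<^bsub>M\<^esub>}" "\<lambda>d. gcomp M d x" e]
      M.gcomp_props(2,3)[OF x] by auto
  qed
  have onto: "\<exists>x. (x, y) \<in> Z" if y: "y \<in> carrier N" for y
  proof -
    have "\<forall>d. \<exists>x. (x, gcomp N d y) \<in> Z" using Z(7) N.gcomp_props(1)[OF y] by blast
    then obtain e where "\<And>d. (e d, gcomp N d y) \<in> Z" by metis
    then show ?thesis using sums[of "{d. gcomp N d y \<noteq> \<zero>\<^bsub>N\<^esub>}" e "\<lambda>d. gcomp N d y"]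
      N.gcomp_props(2,3)[OF y] by auto
  qed
  define f where "f x = (THE y. (x, y) \<in> Z)" for x
  have fI: "f x = y" if "(x, y) \<in> Z" for x y
    unfolding f_def using that uniq by blast
  have fZ: "(x, f x) \<in> Z" if "x \<in> carrier M" for x
    using total[OF that] fI by blast
  show thesis
  proof (rule that)
    have "f \<in> graded_hom R M N"
    proof (rule graded_homI)
      show "f x \<in> hpart N d" if "x \<in> hpart M d" for x d
        using Z(6)[OF that] fI by blast
      show "f x \<in> carrier N" if "x \<in> carrier M" for x
        using Z(3)[OF fZ[OF that]] by simp
      show "f (x \<oplus>\<^bsub>M\<^esub> y) = f x \<oplus>\<^bsub>N\<^esub> f y" if "x \<in> carrier M" "y \<in> carrier M" for x y
        using fI[OF Z(4)[OF fZ[OF that(1)] fZ[OF that(2)]]] .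
      show "f (r \<odot>\<^bsub>M\<^esub> x) = r \<odot>\<^bsub>N\<^esub> f x" if "r \<in> carrier R" "x \<in> carrier M" for r x
        using fI[OF Z(5)[OF that(1) fZ[OF that(2)]]] .
    qed
    then show "graded_map R M N f" using Z(1,2) by (intro graded_map_intro)
    show "f ` carrier M = carrier N"
    proof (intro equalityI subsetI)
      fix y assume "y \<in> carrier N"
      then obtain x where x: "(x, y) \<in> Z" using onto by blast
      then show "y \<in> f ` carrier M" using fI[OF x] Z(3)[OF x] by blast
    next
      fix y assume "y \<in> f ` carrier M"
      then show "y \<in> carrier N" using Z(3)[OF fZ] by blast
    qed
    show "f x = \<zero>\<^bsub>N\<^esub> \<longleftrightarrow> x \<in> A" if "x \<in> carrier M" for x
      using Z(8)[OF fZ[OF that]] by simp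
  qed
qed

section \<open>Forms with values in a module\<close>

text \<open>In contrast to \<open>forms\<close>, the \<open>dx\<^sub>v\<close> have degree 1 here. Contraction, which replaces \<open>dx\<^sub>v\<close> by \<open>x\<^sub>v\<close>, then has
  degree 0, and the grading of the Koszul complex matches the internal grading of Tor.\<close>

definition vforms :: "nat \<Rightarrow> ('r, 'm) gmodule \<Rightarrow> ('r, 'v set \<Rightarrow> 'm) gmodule" where
  "vforms q M =
    \<lparr>carrier = {\<omega>. \<forall>S. \<omega> S \<in> carrier M \<and> (card S \<noteq> q \<longrightarrow> \<omega> S = \<zero>\<^bsub>M\<^esub>)},
     monoid.mult = undefined, one = undefined,
     zero = (\<lambda>S. \<zero>\<^bsub>M\<^esub>), add = (\<lambda>\<omega> \<eta> S. \<omega> S \<oplus>\<^bsub>M\<^esub> \<eta> S), smult = (\<lambda>r \<omega> S. r \<odot>\<^bsub>M\<^esub> \<omega> S),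
     hpart = (\<lambda>d. {\<omega>. \<forall>S. \<omega> S \<in> hpart M (d - int q) \<and> (card S \<noteq> q \<longrightarrow> \<omega> S = \<zero>\<^bsub>M\<^esub>)})\<rparr>"

lemma vforms_simps [simp]:
  "\<omega> \<in> carrier (vforms q M) \<longleftrightarrow> (\<forall>S. \<omega> S \<in> carrier M \<and> (card S \<noteq> q \<longrightarrow> \<omega> S = \<zero>\<^bsub>M\<^esub>))"
  "\<zero>\<^bsub>vforms q M\<^esub> = (\<lambda>S. \<zero>\<^bsub>M\<^esub>)" "\<omega> \<oplus>\<^bsub>vforms q M\<^esub> \<eta> = (\<lambda>S. \<omega> S \<oplus>\<^bsub>M\<^esub> \<eta> S)"
  "r \<odot>\<^bsub>vforms q M\<^esub> \<omega> = (\<lambda>S. r \<odot>\<^bsub>M\<^esub> \<omega> S)"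
  "\<omega> \<in> hpart (vforms q M) d \<longleftrightarrow> (\<forall>S. \<omega> S \<in> hpart M (d - int q) \<and> (card S \<noteq> q \<longrightarrow> \<omega> S = \<zero>\<^bsub>M\<^esub>))"
  by (simp_all add: vforms_def)

lemma graded_module_vforms:
  assumes "graded_module R M" and R: "\<And>d. hpart R d \<subseteq> carrier R"
  shows "graded_module R (vforms q M :: ('r, 'v::finite set \<Rightarrow> 'm) gmodule)"
proof -
  let ?F = "vforms q M :: ('r, 'v set \<Rightarrow> 'm) gmodule"
  interpret M: graded_module R M by fact
  have ag: "abelian_group ?F"
  proof (rule abelian_groupI)
    fix x assume x: "x \<in> carrier ?F"
    then show "\<exists>y\<in>carrier ?F. y \<oplus>\<^bsub>?F\<^esub> x = \<zero>\<^bsub>?F\<^esub>"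
      by (intro bexI[of _ "\<lambda>S. \<ominus>\<^bsub>M\<^esub> x S"]) (auto simp: M.M.l_neg)
  qed (auto simp: M.M.a_assoc M.M.a_comm M.M.a_lcomm)
  have mod: "module R ?F"
    by (rule moduleI[OF M.cring_axioms ag])
       (auto simp: M.smult_l_distr M.smult_r_distr M.smult_assoc1)
  interpret F: module R ?F by (rule mod)
  have ev: "finsum ?F c A S = finsum M (\<lambda>a. c a S) A" if "\<And>a. a \<in> A \<Longrightarrow> c a \<in> carrier ?F"
    for c :: "int \<Rightarrow> 'v set \<Rightarrow> 'm" and A S
    by (rule finsum_hom[OF ag M.M.abelian_group_axioms, of "\<lambda>\<omega>. \<omega> S" A c]) (use that in auto)
  show ?thesis
  proof (rule graded_moduleI[OF mod])
    fix d
    interpret D: additive_subgroup "hpart M (d - int q)" M by (rule M.hpart_subgroup)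
    show "additive_subgroup (hpart ?F d) ?F"
    proof (rule additive_subgroupI, rule F.M.add.subgroupI)
      fix x assume x: "x \<in> hpart ?F d"
      then have xc: "x \<in> carrier ?F" using M.hpart_carrier by auto
      have "\<ominus>\<^bsub>?F\<^esub> x = (\<lambda>S. \<ominus>\<^bsub>M\<^esub> x S)"
        by (rule F.M.minus_equality) (use xc M.M.l_neg in auto)
      then show "\<ominus>\<^bsub>?F\<^esub> x \<in> hpart ?F d" using x D.a_inv_closed by simp
    next
      show "hpart ?F d \<noteq> {}"
        using D.zero_closed vforms_simps(5)[of "\<lambda>S. \<zero>\<^bsub>M\<^esub>"] by (metis empty_iff)
    qed (use M.hpart_carrier M.hpart_add in auto)
  next
    show "r \<odot>\<^bsub>?F\<^esub> x \<in> hpart ?F (d + e)" if "r \<in> hpart R d" "x \<in> hpart ?F e" for r x d e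
      using that subsetD[OF R that(1)] M.hpart_smult[of r d _ "e - int q"] by (auto simp: algebra_simps)
  next
    fix x assume x: "x \<in> carrier ?F"
    let ?c = "\<lambda>d S. gcomp M (d - int q) (x S)"
    let ?A = "\<Union>S. {d. gcomp M d (x S) \<noteq> \<zero>\<^bsub>M\<^esub>}"
    have fin: "finite ?A" using x M.gcomp_props(2) by auto
    have c: "?c d \<in> hpart ?F d" for d
      using x M.gcomp_props(1) M.gcomp_zero by auto
    have cc: "?c d \<in> carrier ?F" for d
      using x M.gcomp_carrier M.gcomp_zero by auto
    have inj: "inj_on (\<lambda>d. d + int q) ?A" by (auto simp: inj_on_def)
    have xS: "x S = finsum ?F ?c ((\<lambda>d. d + int q) ` ?A) S" for S
    proof -
      have "x S = finsum M (\<lambda>d. gcomp M d (x S)) ?A"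
        by (rule M.gcomp_sum[OF _ fin]) (use x in auto)
      also have "\<dots> = finsum M (\<lambda>d. ?c d S) ((\<lambda>d. d + int q) ` ?A)"
        by (subst M.M.finsum_reindex[OF _ inj]) (use x M.gcomp_carrier in auto)
      finally show ?thesis using cc by (simp add: ev)
    qed
    show "\<exists>A c. finite A \<and> (\<forall>d. c d \<in> hpart ?F d) \<and> x = finsum ?F c A"
    proof (intro exI conjI allI)
      show "finite ((\<lambda>d. d + int q) ` ?A)" using fin by (rule finite_imageI)
      show "x = finsum ?F ?c ((\<lambda>d. d + int q) ` ?A)" using xS by (rule ext)
    qed (rule c)
  next
    fix A c d
    assume A: "finite A" "\<forall>d. c d \<in> hpart ?F d" "finsum ?F c A = \<zero>\<^bsub>?F\<^esub>" "d \<in> A"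
    have cp: "c d S \<in> hpart M (d - int q)" for d S using A(2) by simp
    have cc: "c d \<in> carrier ?F" for d using A(2) M.hpart_carrier by auto
    have inj: "inj_on (\<lambda>d. d - int q) A" by (auto simp: inj_on_def)
    show "c d = \<zero>\<^bsub>?F\<^esub>"
    proof
      fix S
      have "\<zero>\<^bsub>M\<^esub> = finsum ?F c A S" using A(3) by simp
      also have "\<dots> = finsum M (\<lambda>d. c d S) A" using cc by (simp add: ev)
      also have "\<dots> = finsum M (\<lambda>d. c (d + int q) S) ((\<lambda>d. d - int q) ` A)"
        by (subst M.M.finsum_reindex[OF _ inj]) (use cc in auto)
      finally have eq: "\<zero>\<^bsub>M\<^esub> = \<dots>" .
      have "c (e + int q) S \<in> hpart M e" for e using cp[of "e + int q"] by simp
      from M.gcomp_unique[OF _ this eq, of "d - int q"] A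
      show "c d S = \<zero>\<^bsub>?F\<^esub> S" by (auto simp: M.gcomp_zero split: if_splits)
    qed
  qed
qed

lemma (in graded_map) vforms_map:
  assumes "\<And>d. hpart R d \<subseteq> carrier R"
  shows "graded_map R (vforms q M) (vforms q N) (\<lambda>\<omega> S :: 'v::finite set. f (\<omega> S))"
  by (rule graded_map_intro[OF graded_module_vforms graded_module_vforms], unfold_locales)
     (auto intro!: graded_homI simp: assms closed add smult zero hpart)

lemma (in graded_map) vforms_onto:
  assumes "f ` carrier M = carrier N"
  shows "(\<lambda>\<omega> S. f (\<omega> S)) ` carrier (vforms q M) = carrier (vforms q N)"
proof (intro equalityI subsetI)
  fix \<eta> assume e: "\<eta> \<in> carrier (vforms q N)"
  then have "\<forall>S. \<exists>x. x \<in> carrier M \<and> f x = \<eta> S \<and> (card S \<noteq> q \<longrightarrow> x = \<zero>\<^bsub>M\<^esub>)"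
    using assms zero by (metis M.M.zero_closed imageE vforms_simps(1))
  then obtain \<omega> where "\<And>S. \<omega> S \<in> carrier M \<and> f (\<omega> S) = \<eta> S \<and> (card S \<noteq> q \<longrightarrow> \<omega> S = \<zero>\<^bsub>M\<^esub>)" by metis
  then show "\<eta> \<in> (\<lambda>\<omega> S. f (\<omega> S)) ` carrier (vforms q M)"
    by (intro image_eqI[of _ _ \<omega>]) auto
qed (auto simp: closed zero)

text \<open>Exactness passes to forms because the lifts of the coefficients can be chosen independently.\<close>

lemma (in graded_map) vforms_exact:
  assumes "graded_map R L M g" "g ` carrier L = a_kernel M N f"
    and w: "\<omega> \<in> carrier (vforms q M)" "\<And>S. f (\<omega> S) = \<zero>\<^bsub>N\<^esub>"
  shows "\<exists>\<eta>\<in>carrier (vforms q L). \<omega> = (\<lambda>S. g (\<eta> S))"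
proof -
  interpret g: graded_map R L M g by fact
  have "\<forall>S. \<exists>x. x \<in> carrier L \<and> g x = \<omega> S \<and> (card S \<noteq> q \<longrightarrow> x = \<zero>\<^bsub>L\<^esub>)"
  proof
    fix S
    show "\<exists>x. x \<in> carrier L \<and> g x = \<omega> S \<and> (card S \<noteq> q \<longrightarrow> x = \<zero>\<^bsub>L\<^esub>)"
    proof (cases "card S = q")
      case True
      have "\<omega> S \<in> g ` carrier L" using w unfolding assms(2) a_kernel_def' by simp
      with True show ?thesis by auto
    next
      case False
      then show ?thesis using w g.zero by auto
    qed
  qed
  then obtain \<eta> where "\<And>S. \<eta> S \<in> carrier L \<and> g (\<eta> S) = \<omega> S \<and> (card S \<noteq> q \<longrightarrow> \<eta> S = \<zero>\<^bsub>L\<^esub>)" by metis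
  then show ?thesis by (intro bexI[of _ \<eta>]) auto
qed

section \<open>The polynomial ring\<close>

lemma polyR_simps [simp]:
  "carrier polyR = UNIV" "\<zero>\<^bsub>polyR\<^esub> = 0" "\<one>\<^bsub>polyR\<^esub> = 1" "f \<oplus>\<^bsub>polyR\<^esub> g = f + g"
  "f \<otimes>\<^bsub>polyR\<^esub> g = f * g" "f \<odot>\<^bsub>polyR\<^esub> g = f * g" "hpart polyR = homog"
  by (simp_all add: polyR_def)

lemma cring_polyR: "cring polyR"
proof (rule cringI)
  show "abelian_group (polyR :: (('v::finite, 'k::comm_ring_1) mpoly, _) gmodule)"
    by (rule abelian_groupI) (auto simp: ac_simps intro: exI[of _ "- x" for x])
  show "comm_monoid (polyR :: (('v::finite, 'k::comm_ring_1) mpoly, _) gmodule)"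
    by (rule comm_monoidI) (auto simp: ac_simps)
qed (auto simp: algebra_simps)

definition mdeg :: "('v::finite \<Rightarrow>\<^sub>0 nat) \<Rightarrow> int" where
  "mdeg m = int (\<Sum>v\<in>UNIV. Poly_Mapping.lookup m v)"

lemma mdeg_add: "mdeg (m + m') = mdeg m + mdeg m'"
  by (simp add: mdeg_def lookup_add sum.distrib)

lemma poly_eq_sum_single:
  "(f :: ('v, 'k::comm_ring_1) mpoly) =
    (\<Sum>m\<in>Poly_Mapping.keys f. Poly_Mapping.single m (Poly_Mapping.lookup f m))"
  by (rule poly_mapping_eqI) (auto simp: lookup_sum lookup_single when_def sum.delta in_keys_iff)

lemma lookup_var_mult:
  "Poly_Mapping.lookup (var v * f) m =
    (if Poly_Mapping.lookup m v = 0 then 0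
     else Poly_Mapping.lookup f (m - Poly_Mapping.single v 1))"
proof -
  have "var v * f = (\<Sum>k\<in>Poly_Mapping.keys f. Poly_Mapping.single (Poly_Mapping.single v 1 + k) (Poly_Mapping.lookup f k))"
    by (subst poly_eq_sum_single[of f]) (simp add: sum_distrib_left var_def mult_single)
  then have eq: "Poly_Mapping.lookup (var v * f) m =
      (\<Sum>k\<in>Poly_Mapping.keys f. if Poly_Mapping.single v 1 + k = m then Poly_Mapping.lookup f k else 0)"
    by (simp add: lookup_sum lookup_single when_def)
  show ?thesis
  proof (cases "Poly_Mapping.lookup m v = 0")
    case True
    then have "Poly_Mapping.single v 1 + k \<noteq> m" for k by (auto simp: lookup_add)
    with True show ?thesis unfolding eq by simp
  next
    case False
    have "Poly_Mapping.single v 1 + k = m \<longleftrightarrow> k = m - Poly_Mapping.single v 1" for k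
    proof
      assume "k = m - Poly_Mapping.single v 1"
      then show "Poly_Mapping.single v 1 + k = m" using False
        by (intro poly_mapping_eqI) (auto simp: lookup_add lookup_minus lookup_single when_def)
    qed auto
    with False show ?thesis unfolding eq by (simp add: in_keys_iff)
  qed
qed

lemma lookup_sign_mult:
  "Poly_Mapping.lookup ((-1) ^ c * f) m = (-1) ^ c * Poly_Mapping.lookup (f :: ('v, 'k::comm_ring_1) mpoly) m"
  by (cases "even c") auto

lemma homog_iff: "f \<in> homog d \<longleftrightarrow> (\<forall>m. Poly_Mapping.lookup f m \<noteq> 0 \<longrightarrow> mdeg m = d)"
  by (auto simp: homog_def in_keys_iff mdeg_def simp del: of_nat_sum)

lemma homog_zero [simp]: "0 \<in> homog d"
  by (simp add: homog_iff)

lemma homog_mult: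
  assumes "f \<in> homog d" "g \<in> homog e" shows "f * g \<in> homog (d + e)"
  unfolding homog_iff
proof (intro allI impI)
  fix m assume "Poly_Mapping.lookup (f * g) m \<noteq> 0"
  then have "m \<in> Poly_Mapping.keys (f * g)" by (simp add: in_keys_iff)
  then obtain a b where "a \<in> Poly_Mapping.keys f" "b \<in> Poly_Mapping.keys g" "m = a + b"
    using keys_mult[of f g] by auto
  then show "mdeg m = d + e" using assms by (simp add: homog_iff in_keys_iff mdeg_add)
qed

lemma var_homog [simp]: "var v \<in> homog 1"
proof -
  have "(\<Sum>w\<in>UNIV. Poly_Mapping.lookup (Poly_Mapping.single v (1::nat)) w) = (\<Sum>w\<in>UNIV. if v = w then 1 else 0)"
    by (rule sum.cong) (auto simp: lookup_single when_def)
  then show ?thesis by (auto simp: homog_iff var_def lookup_single when_def mdeg_def simp del: of_nat_sum)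
qed

lemma homog_add: "f \<in> homog d \<Longrightarrow> g \<in> homog d \<Longrightarrow> f + g \<in> homog d"
  unfolding homog_iff lookup_add by (metis add.right_neutral)

lemma homog_uminus: "f \<in> homog d \<Longrightarrow> - f \<in> homog d"
  unfolding homog_iff by simp

lemma one_homog [simp]: "1 \<in> homog 0"
  by (simp add: homog_iff lookup_one when_def mdeg_def)

lemma sign_homog [simp]: "(-1) ^ c \<in> (homog 0 :: ('v::finite, 'k::comm_ring_1) mpoly set)"
  using homog_uminus[OF one_homog] by (cases "even c") auto

lemma homog_neg: "d < 0 \<Longrightarrow> f \<in> homog d \<Longrightarrow> f = 0"
  by (rule poly_mapping_eqI) (fastforce simp: homog_iff mdeg_def simp del: of_nat_sum)

definition hcomp :: "int \<Rightarrow> ('v::finite, 'k::comm_ring_1) mpoly \<Rightarrow> ('v, 'k) mpoly" where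
  "hcomp d f = (\<Sum>m\<in>Poly_Mapping.keys f. if mdeg m = d then Poly_Mapping.single m (Poly_Mapping.lookup f m) else 0)"

lemma lookup_hcomp:
  "Poly_Mapping.lookup (hcomp d f) m = (if mdeg m = d then Poly_Mapping.lookup f m else 0)"
proof -
  have "Poly_Mapping.lookup (hcomp d f) m =
    (\<Sum>m'\<in>Poly_Mapping.keys f. if m' = m then if mdeg m = d then Poly_Mapping.lookup f m else 0 else 0)"
    unfolding hcomp_def lookup_sum
    by (rule sum.cong) (auto simp: lookup_single when_def)
  then show ?thesis by (simp add: in_keys_iff)
qed

lemma finsum_polyR:
  fixes c :: "'a \<Rightarrow> ('v::finite, 'k::comm_ring_1) mpoly"
  shows "finsum polyR c A = sum c A"
proof -
  interpret R: cring "polyR :: (('v, 'k) mpoly, _) gmodule" by (rule cring_polyR)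
  show ?thesis using finsum_sum[of "polyR :: (('v, 'k) mpoly, _) gmodule" "\<lambda>x. x" A c] R.abelian_group_axioms by simp
qed

lemma graded_module_polyR: "graded_module polyR (polyR :: (('v::finite, 'k::comm_ring_1) mpoly, _) gmodule)"
proof -
  let ?R = "polyR :: (('v, 'k) mpoly, _) gmodule"
  interpret R: cring ?R by (rule cring_polyR)
  have mod: "module ?R ?R"
    by (rule moduleI) (auto simp: R.cring_axioms R.abelian_group_axioms algebra_simps)
  show ?thesis
  proof (rule graded_moduleI[OF mod])
    show "additive_subgroup (hpart ?R d) ?R" for d
    proof (rule additive_subgroupI, rule R.add.subgroupI)
      fix f assume f: "f \<in> hpart ?R d"
      have "\<ominus>\<^bsub>?R\<^esub> f = - f" by (rule R.minus_equality) auto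
      then show "\<ominus>\<^bsub>?R\<^esub> f \<in> hpart ?R d" using f by (simp add: homog_uminus)
    next
      show "hpart ?R d \<noteq> {}" using homog_zero[of d] by (metis empty_iff polyR_simps(7))
    qed (auto intro: homog_add)
  next
    fix f :: "('v, 'k) mpoly"
    have "hcomp d f \<in> homog d" for d by (auto simp: homog_iff lookup_hcomp split: if_splits)
    moreover have "f = (\<Sum>d\<in>mdeg ` Poly_Mapping.keys f. hcomp d f)"
      by (rule poly_mapping_eqI) (auto simp: lookup_sum lookup_hcomp in_keys_iff)
    ultimately show "\<exists>A c. finite A \<and> (\<forall>d. c d \<in> hpart ?R d) \<and> f = finsum ?R c A"
      by (intro exI[of _ "mdeg ` Poly_Mapping.keys f"] exI[of _ "\<lambda>d. hcomp d f"]) (simp add: finsum_polyR)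
  next
    fix A c d
    assume A: "finite A" "\<forall>d. c d \<in> hpart ?R d" "finsum ?R c A = \<zero>\<^bsub>?R\<^esub>" "d \<in> A"
    show "c d = \<zero>\<^bsub>?R\<^esub>"
    proof (simp, rule poly_mapping_eqI)
      fix m
      have nz: "Poly_Mapping.lookup (c e) m \<noteq> 0 \<Longrightarrow> mdeg m = e" for e
        using A(2)[rule_format, of e] by (simp add: homog_iff)
      show "Poly_Mapping.lookup (c d) m = Poly_Mapping.lookup 0 m"
      proof (cases "mdeg m = d")
        case True
        have "0 = (\<Sum>e\<in>A. Poly_Mapping.lookup (c e) m)" using A(3) by (simp add: finsum_polyR flip: lookup_sum)
        also have "\<dots> = (\<Sum>e\<in>A. if e = d then Poly_Mapping.lookup (c d) m else 0)"
          by (rule sum.cong) (use nz True in fastforce)+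
        finally show ?thesis using A by simp
      qed (use nz in fastforce)
    qed
  qed (auto intro: homog_mult)
qed

lemma homog_carrier: "hpart polyR d \<subseteq> carrier polyR" by simp

interpretation polyR: graded_module polyR "polyR :: (('v::finite, 'k::comm_ring_1) mpoly, _) gmodule"
  by (rule graded_module_polyR)

lemma gcomp_polyR_zero [simp]: "gcomp polyR d (0 :: ('v::finite, 'k::comm_ring_1) mpoly) = 0"
  using polyR.gcomp_zero[of d] by simp

text \<open>The polynomials all of whose components lie in \<open>I\<close> form an ideal, and it contains the homogeneous
  elements that generate \<open>I\<close>.\<close>

lemma graded_submodule_ideal:
  assumes "homogeneous_ideal I"
  shows "graded_submodule polyR polyR I"
proof -
  have I: "ideal I polyR" and gen: "I = Idl\<^bsub>polyR\<^esub> (I \<inter> (\<Union>d. homog d))"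
    using assms by (auto simp: homogeneous_ideal_def)
  interpret ideal I polyR by fact
  let ?J = "{f. \<forall>d. gcomp polyR d f \<in> I}"
  have add: "gcomp polyR d (f + g) = gcomp polyR d f + gcomp polyR d g" for d and f g :: "('a, 'b) mpoly"
    using polyR.gcomp_add[of f g d] by simp
  have Iadd: "f + g \<in> I" if "f \<in> I" "g \<in> I" for f g using a_closed[OF that] by simp
  have Izero: "0 \<in> I" using zero_closed by simp
  have Imult: "f * g \<in> I" if "g \<in> I" for f g using I_l_closed[OF that, of f] by simp
  have hom: "f * g \<in> ?J" if f: "f \<in> homog e" and g: "g \<in> ?J" for f g e
    using polyR.gcomp_smult[of f e g] f g Imult by simp
  have sums: "sum c A \<in> ?J" if "\<And>a. a \<in> A \<Longrightarrow> c a \<in> ?J" for c and A :: "int set"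
    using that
  proof (induction A rule: infinite_finite_induct)
    case (insert a A)
    then show ?case using Iadd by (auto simp: add)
  qed (use Izero in simp_all)
  have mult: "f * g \<in> ?J" if g: "g \<in> ?J" for f g
  proof -
    have "f = (\<Sum>d\<in>{d. gcomp polyR d f \<noteq> 0}. gcomp polyR d f)"
      using polyR.gcomp_props(3)[of f] by (simp add: finsum_polyR)
    then have "f * g = (\<Sum>d\<in>{d. gcomp polyR d f \<noteq> 0}. gcomp polyR d f * g)"
      by (metis (no_types) sum_distrib_right)
    also have "\<dots> \<in> ?J"
      by (rule sums, rule hom[OF _ g]) (use polyR.gcomp_props(1) in auto)
    finally show ?thesis .
  qed
  have J: "ideal ?J polyR"
  proof (rule idealI)
    show "ring (polyR :: (('a, 'b) mpoly, _) gmodule)" by (rule cring.axioms(1)[OF cring_polyR])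
    show "subgroup ?J (add_monoid (polyR :: (('a, 'b) mpoly, _) gmodule))"
    proof (rule polyR.R.add.subgroupI)
      fix f assume f: "f \<in> ?J"
      have "\<ominus>\<^bsub>polyR\<^esub> f = (-1) * f" by (rule polyR.R.minus_equality) auto
      then show "\<ominus>\<^bsub>polyR\<^esub> f \<in> ?J" using mult[OF f, of "-1"] by simp
    next
      show "?J \<noteq> {}" using Izero by (auto intro!: exI[of _ 0])
    qed (use Iadd in \<open>auto simp: add\<close>)
    show "g \<otimes>\<^bsub>polyR\<^esub> f \<in> ?J" "f \<otimes>\<^bsub>polyR\<^esub> g \<in> ?J" if "f \<in> ?J" for f g
      using mult[OF that, of g] by (simp_all add: mult.commute)
  qed
  have "I \<inter> (\<Union>d. homog d) \<subseteq> ?J"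
    using Izero by (auto simp: polyR.gcomp_hpart)
  then have "I \<subseteq> ?J"
    by (subst gen) (rule polyR.R.genideal_minimal[OF J])
  then show ?thesis
    unfolding graded_submodule_def using Izero Iadd Imult by auto
qed

section \<open>The Koszul complex\<close>

lemma lookup_contract_rad:
  "Poly_Mapping.lookup (contract_rad \<omega> T) m =
    (\<Sum>v\<in>-T. if Poly_Mapping.lookup m v = 0 then 0
       else (-1) ^ card {w \<in> T. w < v} * Poly_Mapping.lookup (\<omega> (insert v T)) (m - Poly_Mapping.single v 1))"
  unfolding contract_rad_def lookup_sum
  by (rule sum.cong) (auto simp: mult.assoc lookup_sign_mult lookup_var_mult)

text \<open>Give \<open>x\<^sup>m dx\<^sub>S\<close> the multidegree \<open>m\<close> plus the indicator of \<open>S\<close>; contraction preserves it. If \<open>v\<close> is the least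
  variable that occurs in a nonzero multidegree, the homotopy sends \<open>x\<^sup>m dx\<^sub>S\<close> to
  \<open>(x\<^sup>m / x\<^sub>v) dx\<^sub>v \<and> dx\<^sub>S\<close> if \<open>v\<close> is not in \<open>S\<close>, and to zero otherwise. In the coefficient of \<open>dx\<^sub>S\<close> of the
  result, \<open>v\<close> is therefore \<open>Min S\<close>, and no sign appears because \<open>dx\<^sub>v\<close> already comes first.\<close>

definition koszul_homotopy ::
  "('v::{finite,linorder}, 'k::comm_ring_1) form \<Rightarrow> ('v, 'k) form" where
  "koszul_homotopy \<omega> S = (if S = {} then 0 else
     (\<Sum>m\<in>Poly_Mapping.keys (\<omega> (S - {Min S})).
        if Poly_Mapping.lookup m (Min S) \<noteq> 0 \<and> (\<forall>w<Min S. Poly_Mapping.lookup m w = 0)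
        then Poly_Mapping.single (m - Poly_Mapping.single (Min S) 1) (Poly_Mapping.lookup (\<omega> (S - {Min S})) m)
        else 0))"

lemma lookup_koszul_homotopy:
  "Poly_Mapping.lookup (koszul_homotopy \<omega> S) m =
    (if S \<noteq> {} \<and> (\<forall>w<Min S. Poly_Mapping.lookup m w = 0)
     then Poly_Mapping.lookup (\<omega> (S - {Min S})) (m + Poly_Mapping.single (Min S) 1) else 0)"
proof (cases "S = {}")
  case False
  let ?v = "Min S"
  let ?e = "Poly_Mapping.single ?v (1::nat)"
  let ?f = "\<omega> (S - {?v})"
  have eq: "(Poly_Mapping.lookup k ?v \<noteq> 0 \<and> (\<forall>w<?v. Poly_Mapping.lookup k w = 0) \<and> k - ?e = m) \<longleftrightarrow>
      (k = m + ?e \<and> (\<forall>w<?v. Poly_Mapping.lookup m w = 0))" (is "?L \<longleftrightarrow> ?R") for k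
  proof
    assume L: ?L
    have "k = m + ?e"
      by (rule poly_mapping_eqI) (use L in \<open>auto simp: lookup_add lookup_minus lookup_single when_def\<close>)
    then show ?R using L by (auto simp: lookup_add lookup_single when_def)
  qed (auto simp: lookup_add lookup_single when_def)
  have "Poly_Mapping.lookup (koszul_homotopy \<omega> S) m =
    (\<Sum>k\<in>Poly_Mapping.keys ?f. if Poly_Mapping.lookup k ?v \<noteq> 0 \<and> (\<forall>w<?v. Poly_Mapping.lookup k w = 0) \<and> k - ?e = m
      then Poly_Mapping.lookup ?f k else 0)"
    using False unfolding koszul_homotopy_def
    by (simp add: lookup_sum) (rule sum.cong, auto simp: lookup_single when_def)
  also have "\<dots> = (\<Sum>k\<in>Poly_Mapping.keys ?f. if k = m + ?e
      then if \<forall>w<?v. Poly_Mapping.lookup m w = 0 then Poly_Mapping.lookup ?f k else 0 else 0)"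
    unfolding eq by (rule sum.cong) auto
  finally show ?thesis using False by (simp add: in_keys_iff del: One_nat_def Min_less_iff Min_gr_iff)
qed (simp add: koszul_homotopy_def)

text \<open>The homotopy contracts all multidegrees except zero, where only constant 0-forms live. For a
  coefficient \<open>x\<^sup>m dx\<^sub>T\<close> let \<open>v\<close> be the least variable of its multidegree. If \<open>v\<close> is not in \<open>T\<close>, only the summand
  for \<open>v\<close> survives in the contraction, and it is the coefficient of \<open>\<omega>\<close>. If \<open>v\<close> is in \<open>T\<close>, the summands are
  those of the equation \<open>contract_rad \<omega> = 0\<close> at \<open>T - {v}\<close> with opposite sign, except that the
  equation has one more summand, the coefficient of \<open>\<omega>\<close>.\<close>

lemma koszul_homotopy_contract:
  fixes \<omega> :: "('v::{finite,linorder}, 'k::comm_ring_1) form"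
  assumes closed: "contract_rad \<omega> = (\<lambda>S. 0)" and const: "Poly_Mapping.lookup (\<omega> {}) 0 = 0"
  shows "contract_rad (koszul_homotopy \<omega>) = \<omega>"
proof (rule ext, rule poly_mapping_eqI)
  fix T :: "'v set" and m :: "'v \<Rightarrow>\<^sub>0 nat"
  let ?e = "\<lambda>v. Poly_Mapping.single (v::'v) (1::nat)"
  let ?A = "T \<union> {v. Poly_Mapping.lookup m v \<noteq> 0}"
  let ?t = "\<lambda>u. if Poly_Mapping.lookup m u = 0 then 0
       else (-1) ^ card {w \<in> T. w < u} * Poly_Mapping.lookup (koszul_homotopy \<omega> (insert u T)) (m - ?e u)"
  have lhs: "Poly_Mapping.lookup (contract_rad (koszul_homotopy \<omega>) T) m = (\<Sum>u\<in>-T. ?t u)"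
    by (rule lookup_contract_rad)
  show "Poly_Mapping.lookup (contract_rad (koszul_homotopy \<omega>) T) m = Poly_Mapping.lookup (\<omega> T) m"
  proof (cases "?A = {}")
    case True
    have "m = 0" by (rule poly_mapping_eqI) (use True in auto)
    moreover have "T = {}" using True by auto
    ultimately show ?thesis unfolding lhs using const by simp
  next
    case False
    define v where "v = Min ?A"
    have vA: "v \<in> ?A" unfolding v_def using False by (intro Min_in) auto
    have vle: "v \<le> w" if "w \<in> ?A" for w unfolding v_def using that by (intro Min_le) auto
    have "w \<notin> ?A" if "w < v" for w using vle[of w] leD that by blast
    then have below: "Poly_Mapping.lookup m w = 0" "w \<notin> T" if "w < v" for w
      using that by blast+
    show ?thesis
    proof (cases "v \<in> T")
      case True
      have minT: "Min (insert u T) = v" if "Poly_Mapping.lookup m u \<noteq> 0" for u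
        by (rule Min_eqI) (use True vle that in auto)
      let ?T = "T - {v}" and ?m = "m + ?e v"
      let ?s = "\<lambda>u. if Poly_Mapping.lookup ?m u = 0 then 0
         else (-1) ^ card {w \<in> ?T. w < u} * Poly_Mapping.lookup (\<omega> (insert u ?T)) (?m - ?e u)"
      have t: "?t u = - ?s u" if u: "u \<in> -T" for u
      proof (cases "Poly_Mapping.lookup m u = 0")
        case True
        then show ?thesis using u \<open>v \<in> T\<close> by (auto simp: lookup_add lookup_single when_def)
      next
        case False
        have uv: "v < u" using vle[of u] False u \<open>v \<in> T\<close> by (cases "u = v") auto
        have "{w \<in> T. w < u} = insert v {w \<in> ?T. w < u}" using uv \<open>v \<in> T\<close> by auto
        then have c: "card {w \<in> T. w < u} = Suc (card {w \<in> ?T. w < u})" by simp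
        have d: "insert u T - {v} = insert u ?T" using uv by auto
        have e: "m - ?e u + ?e v = ?m - ?e u"
          using uv by (intro poly_mapping_eqI) (auto simp: lookup_add lookup_minus lookup_single when_def)
        have f: "\<forall>w<v. Poly_Mapping.lookup (m - ?e u) w = 0" using below by (simp add: lookup_minus)
        show ?thesis using False f uv
          by (simp add: c lookup_koszul_homotopy minT d e lookup_add lookup_single when_def del: One_nat_def)
      qed
      have "0 = Poly_Mapping.lookup (contract_rad \<omega> ?T) ?m" using closed by simp
      also have "\<dots> = (\<Sum>u\<in>-?T. ?s u)" by (rule lookup_contract_rad)
      also have "-?T = insert v (-T)" using True by auto
      also have "(\<Sum>u\<in>insert v (-T). ?s u) = ?s v + (\<Sum>u\<in>-T. ?s u)" using True by simp
      also have "?s v = Poly_Mapping.lookup (\<omega> T) m"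
      proof -
        have "{w \<in> ?T. w < v} = {}" using below by auto
        moreover have "insert v ?T = T" using True by auto
        ultimately show ?thesis by (simp only:) (simp add: lookup_add)
      qed
      finally have "Poly_Mapping.lookup (\<omega> T) m = - (\<Sum>u\<in>-T. ?s u)" by (simp add: eq_neg_iff_add_eq_0)
      also have "\<dots> = (\<Sum>u\<in>-T. ?t u)" unfolding sum_negf[symmetric] by (rule sum.cong) (use t in auto)
      finally show ?thesis unfolding lhs by simp
    next
      case nT: False
      have mv: "Poly_Mapping.lookup m v \<noteq> 0" using vA nT by auto
      have t: "?t u = (if u = v then Poly_Mapping.lookup (\<omega> T) m else 0)" if u: "u \<in> -T" for u
      proof (cases "Poly_Mapping.lookup m u = 0")
        case False
        show ?thesis
        proof (cases "u = v")
          case True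
          have "Min (insert v T) = v" by (rule Min_eqI) (use vle in auto)
          moreover have "{w \<in> T. w < v} = {}" using below by auto
          then have c: "card {w \<in> T. w < v} = 0" by (metis card.empty)
          moreover have "insert v T - {v} = T" using nT by auto
          moreover have "m - ?e v + ?e v = m" using mv
            by (intro poly_mapping_eqI) (auto simp: lookup_add lookup_minus lookup_single when_def)
          ultimately show ?thesis using True mv below
            by (simp add: c lookup_koszul_homotopy lookup_minus)
        next
          case uv: False
          have lt: "v < x" if "x \<in> insert u T" for x
            using vle[of x] that uv nT False by (cases "x = v") auto
          have "v < Min (insert u T)" by (subst Min_gr_iff) (use lt in auto)
          moreover have "Poly_Mapping.lookup (m - ?e u) v \<noteq> 0" using mv uv by (simp add: lookup_minus lookup_single when_def)
          ultimately show ?thesis using uv by (auto simp: lookup_koszul_homotopy)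
        qed
      qed (use mv in auto)
      have "(\<Sum>u\<in>-T. ?t u) = (\<Sum>u\<in>-T. if u = v then Poly_Mapping.lookup (\<omega> T) m else 0)"
        by (rule sum.cong) (use t in auto)
      then show ?thesis unfolding lhs using nT by simp
    qed
  qed
qed

lemma koszul_homotopy_degree:
  assumes "\<And>S. card S \<noteq> q \<Longrightarrow> \<omega> S = 0" "card S \<noteq> Suc q"
  shows "koszul_homotopy \<omega> S = 0"
proof (cases "S = {}")
  case False
  then have "card S = Suc (card (S - {Min S}))" by (intro card.remove Min_in) auto
  then have "card (S - {Min S}) \<noteq> q" using assms(2) by simp
  then have "\<omega> (S - {Min S}) = 0" by (rule assms(1))
  then show ?thesis by (simp add: koszul_homotopy_def)
qed (simp add: koszul_homotopy_def)

lemma koszul_homotopy_zero: "koszul_homotopy (\<lambda>S. 0) = (\<lambda>S. 0)"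
  by (rule ext) (simp add: koszul_homotopy_def)

text \<open>The summands cancel in pairs; this argument does not divide by 2.\<close>

lemma sum_antisymmetric:
  fixes g :: "'v::{finite,linorder} \<Rightarrow> 'v \<Rightarrow> 'a::ab_group_add"
  assumes "\<And>u v. u \<in> A \<Longrightarrow> v \<in> A \<Longrightarrow> u < v \<Longrightarrow> g v u = - g u v"
  shows "(\<Sum>v\<in>A. \<Sum>u\<in>A - {v}. g v u) = 0"
proof -
  let ?P = "{(v, u). v \<in> A \<and> u \<in> A \<and> v < u}" and ?Q = "{(v, u). v \<in> A \<and> u \<in> A \<and> u < v}"
  have "(\<Sum>v\<in>A. \<Sum>u\<in>A - {v}. g v u) = (\<Sum>(v, u)\<in>(SIGMA v:A. A - {v}). g v u)"
    by (rule sum.Sigma) auto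
  also have "(SIGMA v:A. A - {v}) = ?P \<union> ?Q" by auto
  also have "(\<Sum>(v, u)\<in>?P \<union> ?Q. g v u) = (\<Sum>(v, u)\<in>?P. g v u) + (\<Sum>(v, u)\<in>?Q. g v u)"
    by (rule sum.union_disjoint) auto
  also have "(\<Sum>(v, u)\<in>?Q. g v u) = (\<Sum>(v, u)\<in>?P. g u v)"
    by (rule sum.reindex_bij_witness[of _ "\<lambda>(v, u). (u, v)" "\<lambda>(v, u). (u, v)"]) auto
  also have "\<dots> = (\<Sum>(v, u)\<in>?P. - g v u)"
    by (rule sum.cong) (use assms in auto)
  also have "(\<Sum>(v, u)\<in>?P. g v u) + \<dots> = 0"
    by (simp add: sum.distrib[symmetric] split_def)
  finally show ?thesis .
qed

lemma contract_rad_contract_rad: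
  fixes \<omega> :: "('v::{finite,linorder}, 'k::comm_ring_1) form"
  shows "contract_rad (contract_rad \<omega>) = (\<lambda>S. 0)"
proof
  fix T :: "'v set"
  let ?s = "\<lambda>T v. (-1) ^ card {w \<in> T. w < v} :: ('v, 'k) mpoly"
  let ?g = "\<lambda>v u. ?s T v * var v * (?s (insert v T) u * var u * \<omega> (insert u (insert v T)))"
  have "contract_rad (contract_rad \<omega>) T = (\<Sum>v\<in>-T. \<Sum>u\<in>-insert v T. ?g v u)"
    by (simp add: contract_rad_def sum_distrib_left)
  also have "\<dots> = (\<Sum>v\<in>-T. \<Sum>u\<in>-T - {v}. ?g v u)"
    by (intro sum.cong) auto
  also have "\<dots> = 0"
  proof (rule sum_antisymmetric)
    fix u v assume uv: "u \<in> -T" "v \<in> -T" "u < v"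
    have "{w \<in> insert v T. w < u} = {w \<in> T. w < u}" using uv by auto
    moreover have "{w \<in> insert u T. w < v} = insert u {w \<in> T. w < v}" using uv by auto
    then have "card {w \<in> insert u T. w < v} = Suc (card {w \<in> T. w < v})" using uv by simp
    moreover have "insert u (insert v T) = insert v (insert u T)" by auto
    ultimately show "?g v u = - ?g u v" by simp
  qed
  finally show "contract_rad (contract_rad \<omega>) T = 0" .
qed

section \<open>Contraction of module-valued forms\<close>

type_synonym ('v, 'k, 'm) pmodule = "(('v, 'k) mpoly, 'm) gmodule"

definition vcontract :: "('v::{finite,linorder}, 'k::comm_ring_1, 'm) pmodule \<Rightarrow> ('v set \<Rightarrow> 'm) \<Rightarrow> ('v set \<Rightarrow> 'm)" where
  "vcontract M \<omega> T = (\<Oplus>\<^bsub>M\<^esub>v\<in>-T. ((-1) ^ card {w \<in> T. w < v} * var v) \<odot>\<^bsub>M\<^esub> \<omega> (insert v T))"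

lemma vcontract_hom:
  assumes "graded_map polyR M N f" "\<And>S. \<omega> S \<in> carrier M"
  shows "f (vcontract M \<omega> T) = vcontract N (\<lambda>S. f (\<omega> S)) T"
proof -
  interpret graded_map polyR M N f by fact
  show ?thesis unfolding vcontract_def
    by (subst finsum_hom[OF M.M.abelian_group_axioms N.M.abelian_group_axioms, of f])
       (use assms(2) closed add in \<open>auto simp: smult intro!: N.M.finsum_cong'\<close>)
qed

text \<open>Linear functionals carry contraction in \<open>M\<close> to contraction of polynomial forms. For coordinates this
  reduces free modules to the polynomial ring.\<close>

lemma vcontract_functional:
  assumes "graded_module polyR M" "\<And>S. \<omega> S \<in> carrier M"
    and "\<And>x y. x \<in> carrier M \<Longrightarrow> y \<in> carrier M \<Longrightarrow> l (x \<oplus>\<^bsub>M\<^esub> y) = l x + l y"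
    and "\<And>r x. x \<in> carrier M \<Longrightarrow> l (r \<odot>\<^bsub>M\<^esub> x) = r * l x"
  shows "l (vcontract M \<omega> T) = contract_rad (\<lambda>S. l (\<omega> S)) T"
proof -
  interpret graded_module polyR M by fact
  show ?thesis unfolding vcontract_def contract_rad_def
    by (subst finsum_sum[OF M.abelian_group_axioms, of l]) (use assms in auto)
qed

context
  fixes M :: "('v::{finite,linorder}, 'k::comm_ring_1, 'm) pmodule"
  assumes gm: "graded_module polyR M"
begin

interpretation M: graded_module polyR M by (rule gm)

lemma vcontract_carrier: "(\<And>S. \<omega> S \<in> carrier M) \<Longrightarrow> vcontract M \<omega> T \<in> carrier M"
  unfolding vcontract_def by (rule M.M.finsum_closed) auto

lemma vcontract_graded_map:
  "graded_map polyR (vforms (Suc q) M) (vforms q M) (vcontract M)"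
proof (rule graded_map_intro[OF graded_module_vforms[OF gm homog_carrier] graded_module_vforms[OF gm homog_carrier]], rule graded_homI)
  let ?c = "\<lambda>T v. (-1) ^ card {w \<in> T. w < v} * var v :: ('v, 'k) mpoly"
  have deg: "vcontract M \<omega> T = \<zero>\<^bsub>M\<^esub>" if "\<And>S. card S \<noteq> Suc q \<Longrightarrow> \<omega> S = \<zero>\<^bsub>M\<^esub>" "card T \<noteq> q" for \<omega> T
    unfolding vcontract_def by (rule M.M.add.finprod_one_eqI) (use that in auto)
  show "vcontract M \<omega> \<in> carrier (vforms q M)" if w: "\<omega> \<in> carrier (vforms (Suc q) M)" for \<omega>
    using w vcontract_carrier deg by auto
  show "vcontract M (\<omega> \<oplus>\<^bsub>vforms (Suc q) M\<^esub> \<eta>) = vcontract M \<omega> \<oplus>\<^bsub>vforms q M\<^esub> vcontract M \<eta>"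
    if "\<omega> \<in> carrier (vforms (Suc q) M)" "\<eta> \<in> carrier (vforms (Suc q) M)" for \<omega> \<eta>
    by (rule ext) (use that in \<open>simp add: vcontract_def M.smult_r_distr M.M.finsum_addf\<close>)
  show "vcontract M (r \<odot>\<^bsub>vforms (Suc q) M\<^esub> \<omega>) = r \<odot>\<^bsub>vforms q M\<^esub> vcontract M \<omega>"
    if w: "\<omega> \<in> carrier (vforms (Suc q) M)" for r \<omega>
  proof
    fix T
    have "r \<odot>\<^bsub>M\<^esub> vcontract M \<omega> T = (\<Oplus>\<^bsub>M\<^esub>v\<in>-T. r \<odot>\<^bsub>M\<^esub> (?c T v \<odot>\<^bsub>M\<^esub> \<omega> (insert v T)))"
      unfolding vcontract_def
      by (rule finsum_hom) (use w M.M.abelian_group_axioms M.smult_r_distr in auto)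
    also have "\<dots> = vcontract M (\<lambda>S. r \<odot>\<^bsub>M\<^esub> \<omega> S) T"
      unfolding vcontract_def
      by (rule M.M.finsum_cong') (use w M.smult_assoc1[symmetric] in \<open>auto simp: mult.commute\<close>)
    finally show "vcontract M (r \<odot>\<^bsub>vforms (Suc q) M\<^esub> \<omega>) T = (r \<odot>\<^bsub>vforms q M\<^esub> vcontract M \<omega>) T" by simp
  qed
  show "vcontract M \<omega> \<in> hpart (vforms q M) d" if w: "\<omega> \<in> hpart (vforms (Suc q) M) d" for \<omega> d
  proof -
    interpret D: additive_subgroup "hpart M (d - int q)" M by (rule M.hpart_subgroup)
    have mem: "?c T v \<odot>\<^bsub>M\<^esub> \<omega> (insert v T) \<in> hpart M (d - int q)" for T v
    proof -
      have "?c T v \<in> homog 1" using homog_mult[OF sign_homog var_homog] by simp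
      then show ?thesis using M.hpart_smult[of "?c T v" 1 "\<omega> (insert v T)" "d - int (Suc q)"] w by simp
    qed
    have sums: "finsum M c A \<in> hpart M (d - int q)" if "finite A" "\<And>a. a \<in> A \<Longrightarrow> c a \<in> hpart M (d - int q)" for c and A :: "'v set"
      using that
    proof (induction A)
      case (insert a A)
      have "c \<in> A \<rightarrow> carrier M" "c a \<in> carrier M" using insert M.hpart_carrier by auto
      then show ?case using insert by (simp add: M.M.finsum_insert)
    qed simp
    have "vcontract M \<omega> T \<in> hpart M (d - int q)" for T
      unfolding vcontract_def by (rule sums) (use mem in auto)
    then show ?thesis using deg w by auto
  qed
qed

lemma vcontract_zero_form:
  assumes "\<omega> \<in> carrier (vforms 0 M)" shows "vcontract M \<omega> = (\<lambda>S. \<zero>\<^bsub>M\<^esub>)"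
  by (rule ext, unfold vcontract_def, rule M.M.add.finprod_one_eqI) (use assms in auto)

end

text \<open>Acyclicity in positive form degree; in degree 0 the homology is the module modulo its multiples of
  the variables.\<close>

definition koszul_acyclic where
  "koszul_acyclic M \<longleftrightarrow> graded_module polyR M \<and>
    (\<forall>q. \<forall>\<omega>\<in>carrier (vforms q M). vcontract M (vcontract M \<omega>) = (\<lambda>S. \<zero>\<^bsub>M\<^esub>)) \<and>
    (\<forall>q. \<forall>\<omega>\<in>carrier (vforms (Suc q) M). vcontract M \<omega> = (\<lambda>S. \<zero>\<^bsub>M\<^esub>) \<longrightarrow>
       \<omega> \<in> vcontract M ` carrier (vforms (Suc (Suc q)) M))"

text \<open>The coordinate functions with respect to a basis, extended by zero outside the basis.\<close>

locale free_coordinates = M: graded_module polyR M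
  for M :: "('v::{finite,linorder}, 'k::comm_ring_1, 'm) pmodule" +
  fixes B :: "'m set" and coord :: "'m \<Rightarrow> 'm \<Rightarrow> ('v, 'k) mpoly"
  assumes basis: "B \<subseteq> carrier M"
    and coord_finite: "x \<in> carrier M \<Longrightarrow> finite {b. coord x b \<noteq> 0} \<and> {b. coord x b \<noteq> 0} \<subseteq> B"
    and coord_inj: "x \<in> carrier M \<Longrightarrow> y \<in> carrier M \<Longrightarrow> coord x = coord y \<Longrightarrow> x = y"
    and coord_add: "x \<in> carrier M \<Longrightarrow> y \<in> carrier M \<Longrightarrow> coord (x \<oplus>\<^bsub>M\<^esub> y) b = coord x b + coord y b"
    and coord_smult: "x \<in> carrier M \<Longrightarrow> coord (r \<odot>\<^bsub>M\<^esub> x) b = r * coord x b"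
    and coord_comb: "finite C \<Longrightarrow> C \<subseteq> B \<Longrightarrow> coord (\<Oplus>\<^bsub>M\<^esub>b\<in>C. c b \<odot>\<^bsub>M\<^esub> b) b' = (if b' \<in> C then c b' else 0)"
begin

lemma coord_vcontract:
  "(\<And>S. \<omega> S \<in> carrier M) \<Longrightarrow> coord (vcontract M \<omega> T) b = contract_rad (\<lambda>S. coord (\<omega> S) b) T"
  by (rule vcontract_functional[of M \<omega> "\<lambda>x. coord x b"])
     (auto simp: M.graded_module_axioms coord_add coord_smult)

lemma coord_zero: "coord \<zero>\<^bsub>M\<^esub> b = 0"
  using coord_add[of "\<zero>\<^bsub>M\<^esub>" "\<zero>\<^bsub>M\<^esub>" b] by simp

text \<open>The homotopy is applied to each coordinate. For 0-forms it needs the constant terms to vanish.\<close>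

lemma koszul_exact:
  assumes w: "\<omega> \<in> carrier (vforms q M)" and closed: "vcontract M \<omega> = (\<lambda>S. \<zero>\<^bsub>M\<^esub>)"
    and const: "\<And>b. Poly_Mapping.lookup (coord (\<omega> {}) b) 0 = 0"
  shows "\<omega> \<in> vcontract M ` carrier (vforms (Suc q) M)"
proof -
  have wc: "\<omega> S \<in> carrier M" for S using w by simp
  let ?w = "\<lambda>b S. coord (\<omega> S) b"
  let ?C = "\<Union>S. {b. coord (\<omega> S) b \<noteq> 0}"
  have C: "finite ?C" "?C \<subseteq> B" using coord_finite[OF wc] by auto
  define \<eta> where "\<eta> S = (\<Oplus>\<^bsub>M\<^esub>b\<in>?C. koszul_homotopy (?w b) S \<odot>\<^bsub>M\<^esub> b)" for S
  have ec: "\<eta> S \<in> carrier M" for S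
    unfolding \<eta>_def using subsetD[OF subset_trans[OF C(2) basis]] by (intro M.M.finsum_closed) auto
  have coord_eta: "coord (\<eta> S) b = koszul_homotopy (?w b) S" for S b
  proof -
    have "?w b = (\<lambda>S. 0)" if "b \<notin> ?C" using that by auto
    then have "b \<notin> ?C \<Longrightarrow> koszul_homotopy (?w b) S = 0" by (metis koszul_homotopy_zero)
    then show ?thesis unfolding \<eta>_def by (subst coord_comb[OF C]) auto
  qed
  have "vcontract M \<eta> T = \<omega> T" for T
  proof (rule coord_inj)
    show "coord (vcontract M \<eta> T) = coord (\<omega> T)"
    proof
      fix b
      have "contract_rad (?w b) U = 0" for U
        using coord_vcontract[of \<omega> U b, OF wc] closed by (simp add: coord_zero)
      then have "contract_rad (?w b) = (\<lambda>S. 0)" by (rule ext)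
      then show "coord (vcontract M \<eta> T) b = coord (\<omega> T) b"
        using coord_vcontract[of \<eta> T b, OF ec] coord_eta koszul_homotopy_contract[of "?w b"] const[of b] by simp
    qed
  qed (use vcontract_carrier[OF M.graded_module_axioms, of \<eta>, OF ec] wc in auto)
  moreover have "\<eta> \<in> carrier (vforms (Suc q) M)"
  proof -
    have "\<eta> S = \<zero>\<^bsub>M\<^esub>" if "card S \<noteq> Suc q" for S
      using that w by (intro coord_inj ec) (auto simp: fun_eq_iff coord_eta coord_zero intro!: koszul_homotopy_degree)
    then show ?thesis using ec by simp
  qed
  ultimately show ?thesis by (intro image_eqI[of _ _ \<eta>]) auto
qed

lemma koszul_acyclic_free: "koszul_acyclic M"
  unfolding koszul_acyclic_def
proof (intro conjI allI ballI impI)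
  fix q and \<omega> :: "'v set \<Rightarrow> 'm" assume w: "\<omega> \<in> carrier (vforms q M)"
  then have wc: "\<omega> S \<in> carrier M" for S by simp
  note vc = vcontract_carrier[OF M.graded_module_axioms]
  show "vcontract M (vcontract M \<omega>) = (\<lambda>S. \<zero>\<^bsub>M\<^esub>)"
  proof (rule ext, rule coord_inj)
    fix T
    show "coord (vcontract M (vcontract M \<omega>) T) = coord \<zero>\<^bsub>M\<^esub>"
      using coord_vcontract[of "vcontract M \<omega>", OF vc[of \<omega>, OF wc]] coord_vcontract[of \<omega>, OF wc]
      by (simp add: fun_eq_iff coord_zero contract_rad_contract_rad[THEN fun_cong])
  qed (use vc[of "vcontract M \<omega>", OF vc[of \<omega>, OF wc]] in auto)
next
  fix q and \<omega> :: "'v set \<Rightarrow> 'm" assume w: "\<omega> \<in> carrier (vforms (Suc q) M)" "vcontract M \<omega> = (\<lambda>S. \<zero>\<^bsub>M\<^esub>)"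
  then have "\<omega> {} = \<zero>\<^bsub>M\<^esub>" by simp
  then show "\<omega> \<in> vcontract M ` carrier (vforms (Suc (Suc q)) M)"
    by (intro koszul_exact[OF w]) (simp add: coord_zero)
qed (rule M.graded_module_axioms)

end

lemma graded_free_coordinates:
  assumes "graded_free polyR M"
  obtains B coord where "free_coordinates M B coord"
proof -
  interpret M: graded_module polyR M using assms by (simp add: graded_free_def)
  obtain B where B: "B \<subseteq> (\<Union>d. hpart M d)"
    and ex1: "\<And>x. x \<in> carrier M \<Longrightarrow> \<exists>!c. range c \<subseteq> carrier polyR \<and> finite {b. c b \<noteq> \<zero>\<^bsub>polyR\<^esub>} \<and> {b. c b \<noteq> \<zero>\<^bsub>polyR\<^esub>} \<subseteq> B \<and>
           x = (\<Oplus>\<^bsub>M\<^esub>b\<in>{b. c b \<noteq> \<zero>\<^bsub>polyR\<^esub>}. c b \<odot>\<^bsub>M\<^esub> b)"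
    using assms unfolding graded_free_def by auto
  have BM: "B \<subseteq> carrier M" using B M.hpart_carrier by auto
  define P where "P x c \<longleftrightarrow> finite {b. c b \<noteq> 0} \<and> {b. c b \<noteq> 0} \<subseteq> B \<and> x = (\<Oplus>\<^bsub>M\<^esub>b\<in>{b. c b \<noteq> 0}. c b \<odot>\<^bsub>M\<^esub> b)" for x c
  have uniq: "\<exists>!c. P x c" if "x \<in> carrier M" for x
    using ex1[OF that] by (simp add: P_def)
  define coord where "coord x = (THE c. P x c)" for x
  have PC: "P x (coord x)" if "x \<in> carrier M" for x
    unfolding coord_def by (rule theI'[OF uniq[OF that]])
  have coordI: "coord x = c" if "P x c" for x c
  proof -
    have "x \<in> carrier M" using that BM unfolding P_def by (auto intro!: M.M.finsum_closed)
    then show ?thesis unfolding coord_def using uniq that by (simp add: the1_equality)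
  qed
  have Pext: "x = (\<Oplus>\<^bsub>M\<^esub>b\<in>C. c b \<odot>\<^bsub>M\<^esub> b)" if "P x c" "finite C" "{b. c b \<noteq> 0} \<subseteq> C" "C \<subseteq> B" for x c C
  proof -
    have "x = (\<Oplus>\<^bsub>M\<^esub>b\<in>{b. c b \<noteq> 0}. c b \<odot>\<^bsub>M\<^esub> b)" using that by (simp add: P_def)
    also have "\<dots> = (\<Oplus>\<^bsub>M\<^esub>b\<in>C. c b \<odot>\<^bsub>M\<^esub> b)"
      by (rule M.M.add.finprod_mono_neutral_cong_left) (use that BM M.smult_l_null in auto)
    finally show ?thesis .
  qed
  have comb: "P (\<Oplus>\<^bsub>M\<^esub>b\<in>C. c b \<odot>\<^bsub>M\<^esub> b) (\<lambda>b. if b \<in> C then c b else 0)" if "finite C" "C \<subseteq> B" for c C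
  proof -
    have "(\<Oplus>\<^bsub>M\<^esub>b\<in>{b. (if b \<in> C then c b else 0) \<noteq> 0}. (if b \<in> C then c b else 0) \<odot>\<^bsub>M\<^esub> b) = (\<Oplus>\<^bsub>M\<^esub>b\<in>C. c b \<odot>\<^bsub>M\<^esub> b)"
      by (rule M.M.add.finprod_mono_neutral_cong_left) (use that BM M.smult_l_null in \<open>auto split: if_splits\<close>)
    moreover have "finite {b. (if b \<in> C then c b else 0) \<noteq> 0}" by (rule finite_subset[OF _ that(1)]) auto
    ultimately show ?thesis unfolding P_def using that by (auto split: if_splits)
  qed
  have "free_coordinates M B coord"
  proof (unfold_locales)
    fix x y assume xy: "x \<in> carrier M" "y \<in> carrier M"
    show "coord x = coord y \<Longrightarrow> x = y" using PC[OF xy(1)] PC[OF xy(2)] unfolding P_def by metis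
    fix b
    let ?C = "{b. coord x b \<noteq> 0} \<union> {b. coord y b \<noteq> 0}"
    have C: "finite ?C" "?C \<subseteq> B" using PC xy unfolding P_def by blast+
    have "x \<oplus>\<^bsub>M\<^esub> y = (\<Oplus>\<^bsub>M\<^esub>b\<in>?C. coord x b \<odot>\<^bsub>M\<^esub> b) \<oplus>\<^bsub>M\<^esub> (\<Oplus>\<^bsub>M\<^esub>b\<in>?C. coord y b \<odot>\<^bsub>M\<^esub> b)"
      using Pext[OF PC[OF xy(1)] C(1) _ C(2)] Pext[OF PC[OF xy(2)] C(1) _ C(2)] by simp
    also have "\<dots> = (\<Oplus>\<^bsub>M\<^esub>b\<in>?C. coord x b \<odot>\<^bsub>M\<^esub> b \<oplus>\<^bsub>M\<^esub> coord y b \<odot>\<^bsub>M\<^esub> b)"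
      by (rule M.M.finsum_addf[symmetric]) (use C BM in auto)
    also have "\<dots> = (\<Oplus>\<^bsub>M\<^esub>b\<in>?C. (coord x b + coord y b) \<odot>\<^bsub>M\<^esub> b)"
      by (rule M.M.finsum_cong') (use C BM M.smult_l_distr in auto)
    finally show "coord (x \<oplus>\<^bsub>M\<^esub> y) b = coord x b + coord y b"
      using coordI[OF comb[OF C, of "\<lambda>b. coord x b + coord y b"]] by (auto simp: fun_eq_iff)
  next
    fix x b r assume x: "x \<in> carrier M"
    let ?C = "{b. coord x b \<noteq> 0}"
    have C: "finite ?C" "?C \<subseteq> B" "x = (\<Oplus>\<^bsub>M\<^esub>b\<in>?C. coord x b \<odot>\<^bsub>M\<^esub> b)" using PC x unfolding P_def by blast+
    have "r \<odot>\<^bsub>M\<^esub> x = r \<odot>\<^bsub>M\<^esub> (\<Oplus>\<^bsub>M\<^esub>b\<in>?C. coord x b \<odot>\<^bsub>M\<^esub> b)" using C by simp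
    also have "\<dots> = (\<Oplus>\<^bsub>M\<^esub>b\<in>?C. r \<odot>\<^bsub>M\<^esub> (coord x b \<odot>\<^bsub>M\<^esub> b))"
      by (rule finsum_hom) (use C BM M.M.abelian_group_axioms M.smult_r_distr in auto)
    also have "\<dots> = (\<Oplus>\<^bsub>M\<^esub>b\<in>?C. (r * coord x b) \<odot>\<^bsub>M\<^esub> b)"
      by (rule M.M.finsum_cong') (use C BM M.smult_assoc1 in auto)
    finally show "coord (r \<odot>\<^bsub>M\<^esub> x) b = r * coord x b"
      using coordI[OF comb[OF C(1,2), of "\<lambda>b. r * coord x b"]] by (auto simp: fun_eq_iff)
  next
    fix C c b' assume "finite C" "C \<subseteq> B"
    then show "coord (\<Oplus>\<^bsub>M\<^esub>b\<in>C. c b \<odot>\<^bsub>M\<^esub> b) b' = (if b' \<in> C then c b' else 0)"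
      using coordI[OF comb] by auto
  qed (use BM PC in \<open>auto simp: P_def\<close>)
  then show thesis by (rule that)
qed

section \<open>Balancing the double complex of a resolution and the Koszul complex\<close>

text \<open>The double complex consists of forms with values in the modules of a complex, with contraction in
  one direction and the maps of the complex in the other. Zigzags along an antidiagonal start from
  elements \<open>a\<close> for which contraction kills the image of \<open>a\<close>. At the end of the antidiagonal, in form degree 0,
  where contraction kills everything, the right condition is that the image is a contraction.\<close>

definition cycles_over where
  "cycles_over q M N d = {a \<in> carrier (vforms q M). vcontract N (\<lambda>S. d (a S)) = (\<lambda>S. \<zero>\<^bsub>N\<^esub>)}"

definition cycles_mod where
  "cycles_mod q M N d =
    {a \<in> carrier (vforms q M). (\<lambda>S. d (a S)) \<in> vcontract N ` carrier (vforms (Suc q) N)}"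

text \<open>What is divided out at one position of the double complex: contractions plus images under the
  map of the complex.\<close>

definition total_boundaries where
  "total_boundaries q M L e =
    {\<omega>. \<exists>c\<in>carrier (vforms (Suc q) M). \<exists>y\<in>carrier (vforms q L). \<omega> = (\<lambda>S. vcontract M c S \<oplus>\<^bsub>M\<^esub> e (y S))}"

lemma graded_module_pforms:
  "graded_module polyR M \<Longrightarrow> graded_module polyR (vforms q M :: (('v::finite, 'k::comm_ring_1) mpoly, 'v set \<Rightarrow> 'm) gmodule)"
  by (rule graded_module_vforms[OF _ homog_carrier])

locale poly_map = graded_map polyR M N f
  for M :: "('v::{finite,linorder}, 'k::comm_ring_1, 'm) pmodule" and N :: "('v, 'k, 'n) pmodule" and f
begin

sublocale forms: graded_map polyR "vforms q M" "vforms q N" "\<lambda>\<omega> S :: 'v set. f (\<omega> S)" for q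
  by (rule vforms_map[OF homog_carrier])

sublocale contract_source: graded_map polyR "vforms (Suc q) M" "vforms q M" "vcontract M" for q
  by (rule vcontract_graded_map[OF M.graded_module_axioms])

sublocale contract_target: graded_map polyR "vforms (Suc q) N" "vforms q N" "vcontract N" for q
  by (rule vcontract_graded_map[OF N.graded_module_axioms])

lemmas gmM = graded_module_pforms[OF M.graded_module_axioms]
lemmas gmN = graded_module_pforms[OF N.graded_module_axioms]

lemma contract_commute:
  "\<omega> \<in> carrier (vforms q M) \<Longrightarrow> vcontract N (\<lambda>S. f (\<omega> S)) = (\<lambda>S. f (vcontract M \<omega> S))"
  by (rule ext, subst vcontract_hom[OF graded_map_axioms]) auto

lemma forms_closed: "\<omega> \<in> carrier (vforms q M) \<Longrightarrow> (\<lambda>S :: 'v set. f (\<omega> S)) \<in> carrier (vforms q N)"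
  by (rule forms.closed)

lemma cycles_over_submodule: "graded_submodule polyR (vforms q M) (cycles_over q M N f)"
proof (cases q)
  case 0
  have "cycles_over q M N f = carrier (vforms q M)"
    using vcontract_zero_form[OF N.graded_module_axioms forms_closed[of _ 0]] 0 by (auto simp: cycles_over_def simp del: vforms_simps)
  then show ?thesis using graded_module.graded_submodule_carrier[OF gmM] by simp
next
  case (Suc j)
  have "cycles_over q M N f = {a \<in> carrier (vforms q M). (\<lambda>S. f (a S)) \<in> {x \<in> carrier (vforms q N). vcontract N x = \<zero>\<^bsub>vforms j N\<^esub>}}"
    unfolding cycles_over_def using forms_closed[of _ q] by auto
  then show ?thesis
    using forms.preimage_graded_submodule[OF contract_target.kernel_graded_submodule[of j]] Suc by simp
qed

lemma cycles_mod_submodule: "graded_submodule polyR (vforms q M) (cycles_mod q M N f)"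
  unfolding cycles_mod_def
  by (rule forms.preimage_graded_submodule[OF contract_target.image_graded_submodule[OF graded_module.graded_submodule_carrier[OF gmN]]])

end

lemma poly_mapI: "graded_map polyR M N f \<Longrightarrow> poly_map M N f"
  by (simp add: poly_map_def)

lemma koszul_acyclicD:
  assumes "koszul_acyclic M"
  shows "graded_module polyR M"
    "\<omega> \<in> carrier (vforms q M) \<Longrightarrow> vcontract M (vcontract M \<omega>) = (\<lambda>S. \<zero>\<^bsub>M\<^esub>)"
    "\<omega> \<in> carrier (vforms (Suc q) M) \<Longrightarrow> vcontract M \<omega> = (\<lambda>S. \<zero>\<^bsub>M\<^esub>) \<Longrightarrow>
      \<exists>\<eta>\<in>carrier (vforms (Suc (Suc q)) M). \<omega> = vcontract M \<eta>"
  using assms unfolding koszul_acyclic_def by (simp_all add: image_iff del: vforms_simps)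

text \<open>Away from form degree 0, cycles and boundaries of contraction agree, and so do the two conditions.\<close>

lemma cycles_mod_eq_over:
  assumes "poly_map M N d" "koszul_acyclic N"
  shows "cycles_mod (Suc j) M N d = cycles_over (Suc j) M N d"
proof -
  interpret d: poly_map M N d by fact
  have "(\<lambda>S. d (a S)) \<in> vcontract N ` carrier (vforms (Suc (Suc j)) N) \<longleftrightarrow>
      vcontract N (\<lambda>S. d (a S)) = (\<lambda>S. \<zero>\<^bsub>N\<^esub>)" if a: "a \<in> carrier (vforms (Suc j) M)" for a
  proof
    assume "(\<lambda>S. d (a S)) \<in> vcontract N ` carrier (vforms (Suc (Suc j)) N)"
    then obtain c where "c \<in> carrier (vforms (Suc (Suc j)) N)" "(\<lambda>S. d (a S)) = vcontract N c" by (rule imageE)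
    then show "vcontract N (\<lambda>S. d (a S)) = (\<lambda>S. \<zero>\<^bsub>N\<^esub>)" using koszul_acyclicD(2)[OF assms(2)] by simp
  next
    assume "vcontract N (\<lambda>S. d (a S)) = (\<lambda>S. \<zero>\<^bsub>N\<^esub>)"
    from koszul_acyclicD(3)[OF assms(2) d.forms_closed[OF a] this]
    show "(\<lambda>S. d (a S)) \<in> vcontract N ` carrier (vforms (Suc (Suc j)) N)" by blast
  qed
  then show ?thesis unfolding cycles_mod_def cycles_over_def by (intro Collect_cong conj_cong refl)
qed

text \<open>A segment \<open>L' \<rightarrow> L \<rightarrow> M \<rightarrow> N\<close> of a resolution that is exact at \<open>L\<close> and at \<open>M\<close>. Only the rows of the double complex
  at \<open>L\<close> and \<open>M\<close> are exact, since \<open>N\<close> may be the module that is resolved.\<close>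

locale resolution_segment = d: poly_map M N d + e: poly_map L M e + e': poly_map L' L e'
  for N :: "('v::{finite,linorder}, 'k::comm_ring_1, 'n) pmodule" and M :: "('v, 'k, 'm) pmodule"
    and L :: "('v, 'k, 'l) pmodule" and L' :: "('v, 'k, 'l') pmodule" and d e e' +
  assumes acyclic_M: "koszul_acyclic M" and acyclic_L: "koszul_acyclic L"
    and exact_M: "e ` carrier L = a_kernel M N d" and exact_L: "e' ` carrier L' = a_kernel L M e"
begin

lemma d_e: "x \<in> carrier L \<Longrightarrow> d (e x) = \<zero>\<^bsub>N\<^esub>"
  using exact_M unfolding a_kernel_def' by blast

lemma e_e': "x \<in> carrier L' \<Longrightarrow> e (e' x) = \<zero>\<^bsub>M\<^esub>"
  using exact_L unfolding a_kernel_def' by blast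

lemma lift_M: "\<omega> \<in> carrier (vforms q M) \<Longrightarrow> (\<lambda>S :: 'v set. d (\<omega> S)) = (\<lambda>S. \<zero>\<^bsub>N\<^esub>) \<Longrightarrow>
    \<exists>\<eta>\<in>carrier (vforms q L). \<omega> = (\<lambda>S. e (\<eta> S))"
  by (rule d.vforms_exact[OF e.graded_map_axioms exact_M]) (auto dest: fun_cong)

lemma lift_L: "\<omega> \<in> carrier (vforms q L) \<Longrightarrow> (\<lambda>S :: 'v set. e (\<omega> S)) = (\<lambda>S. \<zero>\<^bsub>M\<^esub>) \<Longrightarrow>
    \<exists>\<eta>\<in>carrier (vforms q L'). \<omega> = (\<lambda>S. e' (\<eta> S))"
  by (rule e.vforms_exact[OF e'.graded_map_axioms exact_L]) (auto dest: fun_cong)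

abbreviation zigzag where
  "zigzag j \<equiv> {(a, b). a \<in> cycles_over (Suc j) M N d \<and> b \<in> cycles_mod j L M e \<and>
      vcontract M a = (\<lambda>S. e (b S))}"

text \<open>One step along the antidiagonal: \<open>a\<close> is related to \<open>b\<close> if the contraction of \<open>a\<close> is the image of \<open>b\<close>. Given
  \<open>a\<close>, the element \<open>b\<close> exists by exactness of the column at \<open>M\<close>; given \<open>b\<close>, the element \<open>a\<close> exists by the
  condition on \<open>b\<close>. If \<open>a\<close> is \<open>e y\<close> up to contractions, then \<open>b\<close> and the contraction of \<open>y\<close> have the
  same image and differ by the image of an \<open>L'\<close>-valued form; the converse is symmetric and uses exactness of the row.\<close>

lemma zigzag_corr:
  "graded_corr polyR
     (gsub (vforms (Suc j) M) (cycles_over (Suc j) M N d)) (total_boundaries (Suc j) M L e)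
     (gsub (vforms j L) (cycles_mod j L M e)) (total_boundaries j L L' e') (zigzag j)"
proof (rule graded_corrI)
  let ?A = "vforms (Suc j) M :: (('v, 'k) mpoly, 'v set \<Rightarrow> 'm) gmodule"
  let ?B = "vforms j L :: (('v, 'k) mpoly, 'v set \<Rightarrow> 'l) gmodule"
  note SA = d.cycles_over_submodule[of "Suc j"] and SB = e.cycles_mod_submodule[of j]
  note DA = graded_submoduleD[OF SA] and DB = graded_submoduleD[OF SB]
  show "graded_module polyR (gsub ?A (cycles_over (Suc j) M N d))"
    by (rule graded_module_gsub(1)[OF d.gmM homog_carrier SA])
  show "graded_module polyR (gsub ?B (cycles_mod j L M e))"
    by (rule graded_module_gsub(1)[OF e.gmM homog_carrier SB])
  show "(a \<oplus>\<^bsub>gsub ?A (cycles_over (Suc j) M N d)\<^esub> a', b \<oplus>\<^bsub>gsub ?B (cycles_mod j L M e)\<^esub> b') \<in> zigzag j"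
    if "(a, b) \<in> zigzag j" "(a', b') \<in> zigzag j" for a b a' b'
    using that DA(1,3) DB(1,3) d.contract_source.add[of a j a'] e.forms.add[of b j b'] by auto
  show "(r \<odot>\<^bsub>gsub ?A (cycles_over (Suc j) M N d)\<^esub> a, r \<odot>\<^bsub>gsub ?B (cycles_mod j L M e)\<^esub> b) \<in> zigzag j"
    if "r \<in> carrier polyR" "(a, b) \<in> zigzag j" for r a b
    using that DA(1,4) DB(1,4) d.contract_source.smult[of r a j] e.forms.smult[of r b j] by auto
  show "\<exists>b\<in>hpart (gsub ?B (cycles_mod j L M e)) k. (a, b) \<in> zigzag j"
    if a: "a \<in> hpart (gsub ?A (cycles_over (Suc j) M N d)) k" for a k
  proof -
    have ac: "a \<in> carrier ?A" and az: "vcontract N (\<lambda>S. d (a S)) = (\<lambda>S. \<zero>\<^bsub>N\<^esub>)" and ah: "a \<in> hpart ?A k"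
      and aD: "a \<in> cycles_over (Suc j) M N d"
      using a unfolding cycles_over_def by auto
    have "(\<lambda>S. d (vcontract M a S)) = (\<lambda>S. \<zero>\<^bsub>N\<^esub>)" using d.contract_commute[OF ac] az by simp
    from lift_M[OF d.contract_source.closed[OF ac] this]
    obtain b where b: "b \<in> carrier ?B" "vcontract M a = (\<lambda>S. e (b S))" by blast
    define b' where "b' = gcomp ?B k b"
    have "vcontract M a \<in> hpart (vforms j M) k" by (rule d.contract_source.hpart[OF ah])
    then have b': "b' \<in> hpart ?B k" "vcontract M a = (\<lambda>S. e (b' S))"
      using e.forms.hpart_preimage[of b j k] b unfolding b'_def by auto
    have "b' \<in> carrier ?B" by (rule graded_module.hpart_carrier[OF e.gmM b'(1)])
    then have "b' \<in> cycles_mod j L M e"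
      unfolding cycles_mod_def using b'(2) ac by (auto intro!: image_eqI[of _ _ a])
    then show ?thesis using b' aD by (intro bexI[of _ b']) auto
  qed
  show "\<exists>a\<in>hpart (gsub ?A (cycles_over (Suc j) M N d)) k. (a, b) \<in> zigzag j"
    if b: "b \<in> hpart (gsub ?B (cycles_mod j L M e)) k" for b k
  proof -
    have bc: "b \<in> carrier ?B" and bh: "b \<in> hpart ?B k" and bD: "b \<in> cycles_mod j L M e"
      using b unfolding cycles_mod_def by auto
    obtain a where a: "a \<in> carrier ?A" "vcontract M a = (\<lambda>S. e (b S))"
      using bD unfolding cycles_mod_def by auto
    define a' where "a' = gcomp ?A k a"
    have "vcontract M a \<in> hpart (vforms j M) k" unfolding a(2) by (rule e.forms.hpart[OF bh])
    then have a': "a' \<in> hpart ?A k" "vcontract M a' = (\<lambda>S. e (b S))"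
      using d.contract_source.hpart_preimage[of a j k] a unfolding a'_def by auto
    have ac: "a' \<in> carrier ?A" by (rule graded_module.hpart_carrier[OF d.gmM a'(1)])
    have "vcontract N (\<lambda>S. d (a' S)) = (\<lambda>S. \<zero>\<^bsub>N\<^esub>)"
      using d.contract_commute[OF ac] a'(2) d_e bc by auto
    then have "a' \<in> cycles_over (Suc j) M N d" using ac by (simp add: cycles_over_def)
    then show ?thesis using a' bD by (intro bexI[of _ a']) auto
  qed
  show "a \<in> total_boundaries (Suc j) M L e \<longleftrightarrow> b \<in> total_boundaries j L L' e'" if ab: "(a, b) \<in> zigzag j" for a b
  proof -
    have ac: "a \<in> carrier ?A" and bc: "b \<in> carrier ?B" and eq: "vcontract M a = (\<lambda>S. e (b S))"
      using ab DA(1) DB(1) by auto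
    show ?thesis
    proof
      assume "a \<in> total_boundaries (Suc j) M L e"
      then obtain c y where c: "c \<in> carrier (vforms (Suc (Suc j)) M)" and y: "y \<in> carrier (vforms (Suc j) L)"
        and a: "a = (\<lambda>S. vcontract M c S \<oplus>\<^bsub>M\<^esub> e (y S))" unfolding total_boundaries_def by blast
      have yb: "vcontract L y \<in> carrier ?B" by (rule e.contract_source.closed[OF y])
      have "vcontract M a = vcontract M (vcontract M c \<oplus>\<^bsub>?A\<^esub> (\<lambda>S. e (y S)))" using a by simp
      also have "\<dots> = vcontract M (vcontract M c) \<oplus>\<^bsub>vforms j M\<^esub> vcontract M (\<lambda>S. e (y S))"
        by (rule d.contract_source.add[OF d.contract_source.closed[OF c] e.forms_closed[OF y]])
      also have "\<dots> = (\<lambda>S. e (vcontract L y S))"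
        using koszul_acyclicD(2)[OF acyclic_M c] e.contract_commute[OF y] e.forms_closed[OF yb] by simp
      finally have "(\<lambda>S. e (b S)) = (\<lambda>S. e (vcontract L y S))" using eq by simp
      then have "(\<lambda>S. e ((b \<ominus>\<^bsub>?B\<^esub> vcontract L y) S)) = (\<lambda>S. \<zero>\<^bsub>M\<^esub>)"
        using e.forms.diff_kernel[OF bc yb] by simp
      with lift_L[of "b \<ominus>\<^bsub>?B\<^esub> vcontract L y" j] obtain y' where
        y': "y' \<in> carrier (vforms j L')" "b \<ominus>\<^bsub>?B\<^esub> vcontract L y = (\<lambda>S. e' (y' S))"
        using graded_module_diff(1)[OF e.gmM bc yb] by blast
      have "b = vcontract L y \<oplus>\<^bsub>?B\<^esub> (b \<ominus>\<^bsub>?B\<^esub> vcontract L y)"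
        by (rule graded_module_diff(2)[OF e.gmM bc yb, symmetric])
      then have "b = (\<lambda>S. vcontract L y S \<oplus>\<^bsub>L\<^esub> e' (y' S))" unfolding y'(2) by simp
      then show "b \<in> total_boundaries j L L' e'" unfolding total_boundaries_def using y y' by blast
    next
      assume "b \<in> total_boundaries j L L' e'"
      then obtain c y where c: "c \<in> carrier (vforms (Suc j) L)" and y: "y \<in> carrier (vforms j L')"
        and b: "b = (\<lambda>S. vcontract L c S \<oplus>\<^bsub>L\<^esub> e' (y S))" unfolding total_boundaries_def by blast
      have lc: "vcontract L c \<in> carrier ?B" by (rule e.contract_source.closed[OF c])
      have ec: "(\<lambda>S. e (c S)) \<in> carrier ?A" by (rule e.forms_closed[OF c])
      \<comment> \<open>The converse: subtracting \<open>e c\<close> from \<open>a\<close> leaves a cycle of the row at \<open>M\<close>.\<close>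
      have "(\<lambda>S. e (b S)) = (\<lambda>S. e (vcontract L c S))"
        using b lc e'.forms_closed[OF y] e.forms_closed[OF lc] y by (simp add: e.add e_e')
      then have "vcontract M a = vcontract M (\<lambda>S. e (c S))" using eq e.contract_commute[OF c] by simp
      then have "vcontract M (a \<ominus>\<^bsub>?A\<^esub> (\<lambda>S. e (c S))) = (\<lambda>S. \<zero>\<^bsub>M\<^esub>)"
        using d.contract_source.diff_kernel[OF ac ec] by simp
      with koszul_acyclicD(3)[OF acyclic_M, of "a \<ominus>\<^bsub>?A\<^esub> (\<lambda>S. e (c S))" j] obtain \<eta> where
        \<eta>: "\<eta> \<in> carrier (vforms (Suc (Suc j)) M)" "a \<ominus>\<^bsub>?A\<^esub> (\<lambda>S. e (c S)) = vcontract M \<eta>"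
        using graded_module_diff(1)[OF d.gmM ac ec] by blast
      have "a = (a \<ominus>\<^bsub>?A\<^esub> (\<lambda>S. e (c S))) \<oplus>\<^bsub>?A\<^esub> (\<lambda>S. e (c S))"
        by (rule graded_module_diff(3)[OF d.gmM ac ec, symmetric])
      then have "a = (\<lambda>S. vcontract M \<eta> S \<oplus>\<^bsub>M\<^esub> e (c S))" unfolding \<eta>(2) by simp
      then show "a \<in> total_boundaries (Suc j) M L e" unfolding total_boundaries_def using \<eta>(1) c by blast
    qed
  qed
qed (auto simp: cycles_over_def cycles_mod_def)

end

text \<open>The first step replaces \<open>I\<close>-valued forms by their lifts to forms with values in the first term of
  the resolution.\<close>

lemma augmentation_corr:
  fixes F :: "('v::{finite,linorder}, 'k::comm_ring_1, 'm) pmodule" and I :: "('v, 'k, 'i) pmodule"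
    and G :: "('v, 'k, 'g) pmodule"
  assumes "poly_map F I \<epsilon>" "poly_map G F \<delta>" and onto: "\<epsilon> ` carrier F = carrier I"
    and exact: "\<delta> ` carrier G = a_kernel F I \<epsilon>"
  shows "graded_corr polyR
    (gsub (vforms q F) (cycles_over q F I \<epsilon>)) (total_boundaries q F G \<delta>)
    (gsub (vforms q I) {\<omega> \<in> carrier (vforms q I). vcontract I \<omega> = (\<lambda>S. \<zero>\<^bsub>I\<^esub>)})
    (vcontract I ` carrier (vforms (Suc q) I))
    {(a, (\<lambda>S. \<epsilon> (a S))) | a. a \<in> carrier (gsub (vforms q F) (cycles_over q F I \<epsilon>))}"
proof (rule graded_corr_map)
  interpret \<epsilon>: poly_map F I \<epsilon> by fact
  interpret \<delta>: poly_map G F \<delta> by fact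
  interpret i: poly_map I I "\<lambda>x. x"
    by (intro poly_mapI graded_map_intro \<epsilon>.N.graded_module_axioms graded_homI) auto
  have Z: "{\<omega> \<in> carrier (vforms q I). vcontract I \<omega> = (\<lambda>S. \<zero>\<^bsub>I\<^esub>)} = cycles_over q I I (\<lambda>x. x)"
    by (auto simp: cycles_over_def)
  have lift: "\<exists>\<eta>\<in>carrier (vforms q F). \<omega> = (\<lambda>S. \<epsilon> (\<eta> S))" if "\<omega> \<in> carrier (vforms q I)" for \<omega> :: "'v set \<Rightarrow> 'i" and q
    using \<epsilon>.vforms_onto[OF onto, of q] that by blast
  let ?f = "\<lambda>(a :: 'v set \<Rightarrow> 'm) S. \<epsilon> (a S)"
  have cz: "?f a \<in> cycles_over q I I (\<lambda>x. x)" if "a \<in> cycles_over q F I \<epsilon>" for a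
    using that \<epsilon>.forms_closed[of a q] by (auto simp: cycles_over_def)
  show "graded_map polyR (gsub (vforms q F) (cycles_over q F I \<epsilon>))
     (gsub (vforms q I) {\<omega> \<in> carrier (vforms q I). vcontract I \<omega> = (\<lambda>S. \<zero>\<^bsub>I\<^esub>)}) ?f"
    unfolding Z
  proof (rule graded_map_intro)
    show "graded_module polyR (gsub (vforms q F) (cycles_over q F I \<epsilon>))"
      by (rule graded_module_gsub(1)[OF \<epsilon>.gmM homog_carrier \<epsilon>.cycles_over_submodule])
    show "graded_module polyR (gsub (vforms q I) (cycles_over q I I (\<lambda>x. x)))"
      by (rule graded_module_gsub(1)[OF i.gmM homog_carrier i.cycles_over_submodule])
    show "?f \<in> graded_hom polyR (gsub (vforms q F) (cycles_over q F I \<epsilon>)) (gsub (vforms q I) (cycles_over q I I (\<lambda>x. x)))"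
      by (rule graded_hom_gsub[OF \<epsilon>.forms.hom]) (auto simp: cycles_over_def \<epsilon>.closed \<epsilon>.zero)
  qed
  show "?f ` carrier (gsub (vforms q F) (cycles_over q F I \<epsilon>)) =
      carrier (gsub (vforms q I) {\<omega> \<in> carrier (vforms q I). vcontract I \<omega> = (\<lambda>S. \<zero>\<^bsub>I\<^esub>)})"
    unfolding Z gsub_simps
  proof (intro equalityI subsetI)
    fix \<omega> assume w: "\<omega> \<in> cycles_over q I I (\<lambda>x. x)"
    then obtain \<eta> where "\<eta> \<in> carrier (vforms q F)" "\<omega> = ?f \<eta>" using lift unfolding cycles_over_def by blast
    with w show "\<omega> \<in> ?f ` cycles_over q F I \<epsilon>"
      unfolding cycles_over_def by (intro image_eqI[of _ _ \<eta>]) auto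
  qed (use cz in blast)
  fix a assume "a \<in> carrier (gsub (vforms q F) (cycles_over q F I \<epsilon>))"
  then have ac: "a \<in> carrier (vforms q F)" by (simp add: cycles_over_def)
  show "a \<in> total_boundaries q F G \<delta> \<longleftrightarrow> ?f a \<in> vcontract I ` carrier (vforms (Suc q) I)"
  proof
    assume "a \<in> total_boundaries q F G \<delta>"
    then obtain c y where c: "c \<in> carrier (vforms (Suc q) F)" and y: "y \<in> carrier (vforms q G)"
      and a: "a = (\<lambda>S. vcontract F c S \<oplus>\<^bsub>F\<^esub> \<delta> (y S))" unfolding total_boundaries_def by blast
    have lc: "vcontract F c \<in> carrier (vforms q F)" by (rule \<epsilon>.contract_source.closed[OF c])
    have "\<epsilon> (\<delta> x) = \<zero>\<^bsub>I\<^esub>" if "x \<in> carrier G" for x using exact that unfolding a_kernel_def' by blast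
    then have "?f a = (\<lambda>S. \<epsilon> (vcontract F c S))"
      using a lc \<delta>.forms_closed[OF y] \<epsilon>.forms_closed[OF lc] y by (simp add: \<epsilon>.add)
    then have "?f a = vcontract I (?f c)" using \<epsilon>.contract_commute[OF c] by simp
    then show "?f a \<in> vcontract I ` carrier (vforms (Suc q) I)" using \<epsilon>.forms_closed[OF c] by blast
  next
    assume "?f a \<in> vcontract I ` carrier (vforms (Suc q) I)"
    then obtain \<eta> where "\<eta> \<in> carrier (vforms (Suc q) I)" "?f a = vcontract I \<eta>" by blast
    then obtain c where c: "c \<in> carrier (vforms (Suc q) F)" "?f a = vcontract I (?f c)" using lift by blast
    have lc: "vcontract F c \<in> carrier (vforms q F)" by (rule \<epsilon>.contract_source.closed[OF c(1)])
    have "?f a = ?f (vcontract F c)" using c \<epsilon>.contract_commute by simp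
    then have "?f (a \<ominus>\<^bsub>vforms q F\<^esub> vcontract F c) = (\<lambda>S. \<zero>\<^bsub>I\<^esub>)"
      using \<epsilon>.forms.diff_kernel[OF ac lc] by simp
    then have "\<exists>\<eta>\<in>carrier (vforms q G). a \<ominus>\<^bsub>vforms q F\<^esub> vcontract F c = (\<lambda>S. \<delta> (\<eta> S))"
      by (intro \<epsilon>.vforms_exact[OF \<delta>.graded_map_axioms exact] graded_module_diff(1)[OF \<epsilon>.gmM ac lc]) (auto dest: fun_cong)
    then obtain y where y: "y \<in> carrier (vforms q G)" "a \<ominus>\<^bsub>vforms q F\<^esub> vcontract F c = (\<lambda>S. \<delta> (y S))" by blast
    have "a = vcontract F c \<oplus>\<^bsub>vforms q F\<^esub> (a \<ominus>\<^bsub>vforms q F\<^esub> vcontract F c)"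
      by (rule graded_module_diff(2)[OF \<epsilon>.gmM ac lc, symmetric])
    then have "a = (\<lambda>S. vcontract F c S \<oplus>\<^bsub>F\<^esub> \<delta> (y S))" unfolding y(2) by simp
    then show "a \<in> total_boundaries q F G \<delta>" unfolding total_boundaries_def using c(1) y(1) by blast
  qed
qed

lemma exact_atD:
  assumes "exact_at polyR L f M g N"
  shows "poly_map L M f" "poly_map M N g" "f ` carrier L = a_kernel M N g"
  using assms unfolding exact_at_def by (auto intro: poly_mapI graded_map_intro)

lemma resolutionD:
  assumes "graded_free_resolution polyR F \<delta> \<epsilon> M"
  shows "graded_free polyR (F i)" "koszul_acyclic (F i)" "poly_map (F (Suc i)) (F i) (\<delta> i)" "poly_map (F 0) M \<epsilon>"
    "\<delta> (Suc i) ` carrier (F (Suc (Suc i))) = a_kernel (F (Suc i)) (F i) (\<delta> i)"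
    "\<delta> 0 ` carrier (F (Suc 0)) = a_kernel (F 0) M \<epsilon>" "\<epsilon> ` carrier (F 0) = carrier M"
proof -
  have e: "exact_at polyR (F (Suc (Suc i))) (\<delta> (Suc i)) (F (Suc i)) (\<delta> i) (F i)" "exact_at polyR (F (Suc 0)) (\<delta> 0) (F 0) \<epsilon> M"
    and f: "graded_free polyR (F i)"
    using assms unfolding graded_free_resolution_def by auto
  show "koszul_acyclic (F i)"
    using graded_free_coordinates[OF f] free_coordinates.koszul_acyclic_free by metis
  show "graded_free polyR (F i)" "poly_map (F (Suc i)) (F i) (\<delta> i)" "poly_map (F 0) M \<epsilon>"
    "\<delta> (Suc i) ` carrier (F (Suc (Suc i))) = a_kernel (F (Suc i)) (F i) (\<delta> i)"
    "\<delta> 0 ` carrier (F (Suc 0)) = a_kernel (F 0) M \<epsilon>"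
    using exact_atD[OF e(1)] exact_atD[OF e(2)] f by auto
  show "\<epsilon> ` carrier (F 0) = carrier M" using assms unfolding graded_free_resolution_def by auto
qed

definition koszul_cycles where
  "koszul_cycles q M = {\<omega> \<in> carrier (vforms q M). vcontract M \<omega> = (\<lambda>S. \<zero>\<^bsub>M\<^esub>)}"

definition koszul_boundaries where
  "koszul_boundaries q M = vcontract M ` carrier (vforms (Suc q) M)"

lemma resolution_corr:
  fixes F :: "nat \<Rightarrow> ('v::{finite,linorder}, 'k::comm_ring_1, 'm) pmodule" and M :: "('v, 'k, 'i) pmodule"
  assumes res: "graded_free_resolution polyR F \<delta> \<epsilon> M"
  shows "\<exists>Z. graded_corr polyR (gsub (vforms (i + j) M) (koszul_cycles (i + j) M)) (koszul_boundaries (i + j) M)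
    (gsub (vforms j (F i)) (case i of 0 \<Rightarrow> cycles_over j (F 0) M \<epsilon> | Suc i' \<Rightarrow> cycles_mod j (F i) (F i') (\<delta> i')))
    (total_boundaries j (F i) (F (Suc i)) (\<delta> i)) Z"
proof (induction i arbitrary: j)
  case 0
  show ?case
    using graded_corr_converse[OF augmentation_corr[OF resolutionD(4,3)[OF res] resolutionD(7,6)[OF res]]]
    unfolding koszul_cycles_def koszul_boundaries_def by auto
next
  case (Suc i)
  have step: "\<exists>Z. graded_corr polyR
    (gsub (vforms (Suc j) (F i)) (case i of 0 \<Rightarrow> cycles_over (Suc j) (F 0) M \<epsilon> | Suc i' \<Rightarrow> cycles_mod (Suc j) (F i) (F i') (\<delta> i')))
    (total_boundaries (Suc j) (F i) (F (Suc i)) (\<delta> i))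
    (gsub (vforms j (F (Suc i))) (cycles_mod j (F (Suc i)) (F i) (\<delta> i)))
    (total_boundaries j (F (Suc i)) (F (Suc (Suc i))) (\<delta> (Suc i))) Z"
  proof (cases i)
    case 0
    interpret resolution_segment M "F 0" "F (Suc 0)" "F (Suc (Suc 0))" \<epsilon> "\<delta> 0" "\<delta> (Suc 0)"
      by (intro resolution_segment.intro resolution_segment_axioms.intro resolutionD[OF res])
    show ?thesis using zigzag_corr 0 by auto
  next
    case (Suc i')
    interpret resolution_segment "F i'" "F i" "F (Suc i)" "F (Suc (Suc i))" "\<delta> i'" "\<delta> i" "\<delta> (Suc i)"
      unfolding Suc by (intro resolution_segment.intro resolution_segment_axioms.intro resolutionD[OF res])
    have "cycles_mod (Suc j) (F i) (F i') (\<delta> i') = cycles_over (Suc j) (F i) (F i') (\<delta> i')"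
      by (rule cycles_mod_eq_over[OF d.poly_map_axioms resolutionD(2)[OF res]])
    then show ?thesis using zigzag_corr[of j] Suc by auto
  qed
  show ?case using Suc.IH[of "Suc j"] step graded_corr_trans by (simp only: add_Suc_shift nat.case) blast
qed

section \<open>Tensor products of graded modules\<close>

text \<open>The additive extension of \<open>\<beta>\<close> to the free abelian group.\<close>

definition zlin :: "('x \<Rightarrow> 'a::comm_ring_1) \<Rightarrow> ('x \<Rightarrow>\<^sub>0 int) \<Rightarrow> 'a" where
  "zlin \<beta> c = (\<Sum>x\<in>Poly_Mapping.keys c. of_int (Poly_Mapping.lookup c x) * \<beta> x)"

lemma zlin_superset:
  "finite A \<Longrightarrow> Poly_Mapping.keys c \<subseteq> A \<Longrightarrow> zlin \<beta> c = (\<Sum>x\<in>A. of_int (Poly_Mapping.lookup c x) * \<beta> x)"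
  unfolding zlin_def by (rule sum.mono_neutral_left) (auto simp: in_keys_iff)

lemma zlin_diff: "zlin \<beta> (a - b) = zlin \<beta> a - zlin \<beta> b"
proof -
  let ?A = "Poly_Mapping.keys a \<union> Poly_Mapping.keys b"
  have "Poly_Mapping.keys (a - b) \<subseteq> ?A" by (rule keys_diff)
  then show ?thesis
    using zlin_superset[of ?A "a - b" \<beta>] zlin_superset[of ?A a \<beta>] zlin_superset[of ?A b \<beta>]
    by (simp add: lookup_minus algebra_simps sum_subtractf)
qed

lemma zlin_zero [simp]: "zlin \<beta> 0 = 0"
  by (simp add: zlin_def)

lemma zlin_of [simp]: "zlin \<beta> (frag_of x) = \<beta> x"
  by (simp add: zlin_def)

lemma zlin_sum: "finite A \<Longrightarrow> zlin \<beta> (\<Sum>a\<in>A. c a) = (\<Sum>a\<in>A. zlin \<beta> (c a))"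
proof (induction A rule: finite_induct)
  case (insert a A)
  have "zlin \<beta> (x + y) = zlin \<beta> x + zlin \<beta> y" for x y
    using zlin_diff[of \<beta> "x + y" y] by simp
  with insert show ?case by simp
qed simp

text \<open>The universal property of the tensor product, in the form in which it shows tensors to be
  nonzero: a map that is bilinear and balanced modulo \<open>K\<close> sends the tensor relations into \<open>K\<close>. The
  values are families of ring elements, so that forms and coordinate vectors are covered.\<close>

lemma tensor_rel_zlin:
  assumes zero: "(\<lambda>s. 0) \<in> K" and diff: "\<And>f g. f \<in> K \<Longrightarrow> g \<in> K \<Longrightarrow> (\<lambda>s. f s - g s) \<in> K"
    and left: "\<And>m m' n. m \<in> carrier M \<Longrightarrow> m' \<in> carrier M \<Longrightarrow> n \<in> carrier N \<Longrightarrow>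
      (\<lambda>s. \<beta> (m \<oplus>\<^bsub>M\<^esub> m', n) s - \<beta> (m, n) s - \<beta> (m', n) s) \<in> K"
    and right: "\<And>m n n'. m \<in> carrier M \<Longrightarrow> n \<in> carrier N \<Longrightarrow> n' \<in> carrier N \<Longrightarrow>
      (\<lambda>s. \<beta> (m, n \<oplus>\<^bsub>N\<^esub> n') s - \<beta> (m, n) s - \<beta> (m, n') s) \<in> K"
    and bal: "\<And>r m n. r \<in> carrier R \<Longrightarrow> m \<in> carrier M \<Longrightarrow> n \<in> carrier N \<Longrightarrow>
      (\<lambda>s. \<beta> (r \<odot>\<^bsub>M\<^esub> m, n) s - \<beta> (m, r \<odot>\<^bsub>N\<^esub> n) s) \<in> K"
    and c: "c \<in> tensor_rel R M N"
  shows "(\<lambda>s. zlin (\<lambda>x. \<beta> x s) c) \<in> K"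
  using c by induction (simp_all add: zlin_diff zero diff left right bal)

lemma tensor_rel_add:
  "a \<in> tensor_rel R M N \<Longrightarrow> b \<in> tensor_rel R M N \<Longrightarrow> a + b \<in> tensor_rel R M N"
  using tensor_rel.diff[OF _ tensor_rel.diff[OF tensor_rel.zero]] by fastforce

lemma tensor_rel_uminus: "a \<in> tensor_rel R M N \<Longrightarrow> - a \<in> tensor_rel R M N"
  using tensor_rel.diff[OF tensor_rel.zero] by fastforce

lemma tensor_rel_sum: "(\<And>x. x \<in> A \<Longrightarrow> f x \<in> tensor_rel R M N) \<Longrightarrow> sum f A \<in> tensor_rel R M N"
  by (induction A rule: infinite_finite_induct) (auto intro: tensor_rel_add tensor_rel.zero)

definition tensor_cls where
  "tensor_cls R M N c = tensor_rel R M N +>\<^bsub>tensor_free M N\<^esub> c"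

lemma tensor_cls_def': "tensor_cls R M N c = {x. x - c \<in> tensor_rel R M N}"
proof -
  have "\<exists>h\<in>tensor_rel R M N. x = h + c" if "x - c \<in> tensor_rel R M N" for x
    using that by (intro bexI[of _ "x - c"]) auto
  then show ?thesis by (auto simp: tensor_cls_def a_r_coset_def' tensor_free_def)
qed

lemma tensor_cls_eq_iff: "tensor_cls R M N c = tensor_cls R M N c' \<longleftrightarrow> c - c' \<in> tensor_rel R M N"
proof
  assume "tensor_cls R M N c = tensor_cls R M N c'"
  moreover have "c \<in> tensor_cls R M N c" by (simp add: tensor_cls_def' tensor_rel.zero)
  ultimately show "c - c' \<in> tensor_rel R M N" by (simp add: tensor_cls_def')
next
  assume *: "c - c' \<in> tensor_rel R M N"
  have "x - c \<in> tensor_rel R M N \<longleftrightarrow> x - c' \<in> tensor_rel R M N" for x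
    using tensor_rel_add[OF _ *, of "x - c"] tensor_rel.diff[OF _ *, of "x - c'"] by auto
  then show "tensor_cls R M N c = tensor_cls R M N c'" by (simp add: tensor_cls_def')
qed

lemma tensor_zero: "\<zero>\<^bsub>tensor R M N\<^esub> = tensor_cls R M N 0"
  by (simp add: tensor_def tensor_cls_def')

lemma tensor_cls_zero_iff: "tensor_cls R M N c = \<zero>\<^bsub>tensor R M N\<^esub> \<longleftrightarrow> c \<in> tensor_rel R M N"
  by (simp add: tensor_zero tensor_cls_eq_iff)

lemma tensor_carrier: "carrier (tensor R M N) = tensor_cls R M N ` carrier (tensor_free M N)"
  by (auto simp: tensor_def A_RCOSETS_def' tensor_cls_def)

lemma tensor_hpart: "hpart (tensor R M N) d = tensor_cls R M N ` hpart (tensor_free M N) d"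
  by (simp add: tensor_def tensor_cls_def)

lemma tensor_add: "tensor_cls R M N c \<oplus>\<^bsub>tensor R M N\<^esub> tensor_cls R M N c' = tensor_cls R M N (c + c')"
proof -
  have "\<exists>a b. a - c \<in> tensor_rel R M N \<and> b - c' \<in> tensor_rel R M N \<and> x = a + b"
    if "x - (c + c') \<in> tensor_rel R M N" for x
    using that by (intro exI[of _ "x - c'"] exI[of _ c']) (auto simp: tensor_rel.zero algebra_simps)
  moreover have "a + b - (c + c') \<in> tensor_rel R M N" if "a - c \<in> tensor_rel R M N" "b - c' \<in> tensor_rel R M N" for a b
    using tensor_rel_add[OF that] by (simp add: algebra_simps)
  ultimately show ?thesis
    unfolding tensor_def gquot_simps set_add_def' tensor_cls_def' by (auto simp: tensor_free_def)
qed

lemma tensor_cls_map: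
  assumes "\<And>c. c \<in> tensor_rel R M N \<Longrightarrow> g c \<in> tensor_rel R M' N"
    and "\<And>a b. g (a - b) = g a - g b"
  shows "(\<Union>x\<in>tensor_cls R M N c. tensor_cls R M' N (g x)) = tensor_cls R M' N (g c)"
proof -
  have "tensor_cls R M' N (g x) = tensor_cls R M' N (g c)" if "x \<in> tensor_cls R M N c" for x
  proof -
    have "g x - g c \<in> tensor_rel R M' N" using that assms(1)[of "x - c"] by (simp add: tensor_cls_def' assms(2))
    then show ?thesis by (simp add: tensor_cls_eq_iff)
  qed
  moreover have "c \<in> tensor_cls R M N c" by (simp add: tensor_cls_def' tensor_rel.zero)
  ultimately show ?thesis by blast
qed

lemma tensor_rel_map:
  assumes f: "\<And>m. m \<in> carrier M \<Longrightarrow> f m \<in> carrier M'"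
    "\<And>m m'. m \<in> carrier M \<Longrightarrow> m' \<in> carrier M \<Longrightarrow> f (m \<oplus>\<^bsub>M\<^esub> m') = f m \<oplus>\<^bsub>M'\<^esub> f m'"
    "\<And>r m. r \<in> carrier R \<Longrightarrow> m \<in> carrier M \<Longrightarrow> f (r \<odot>\<^bsub>M\<^esub> m) = r \<odot>\<^bsub>M'\<^esub> f m"
    and c: "c \<in> tensor_rel R M N"
  shows "frag_extend (\<lambda>(m, n). frag_of (f m, n)) c \<in> tensor_rel R M' N"
  using c by induction (auto simp: frag_extend_diff f intro: tensor_rel.intros)

lemma tensor_map_cls:
  assumes "graded_map R M M' f"
  shows "tensor_map R M' N f (tensor_cls R M N c) = tensor_cls R M' N (frag_extend (\<lambda>(m, n). frag_of (f m, n)) c)"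
proof -
  interpret graded_map R M M' f by fact
  show ?thesis
    unfolding tensor_map_def tensor_cls_def[of R M' N, symmetric]
    by (rule tensor_cls_map, rule tensor_rel_map) (auto simp: closed add smult frag_extend_diff)
qed

lemma tensor_smult:
  assumes "module R M" "r \<in> carrier R"
  shows "r \<odot>\<^bsub>tensor R M N\<^esub> tensor_cls R M N c = tensor_cls R M N (frag_extend (\<lambda>(m, n). frag_of (r \<odot>\<^bsub>M\<^esub> m, n)) c)"
proof -
  interpret module R M by fact
  have "r \<odot>\<^bsub>M\<^esub> (s \<odot>\<^bsub>M\<^esub> m) = s \<odot>\<^bsub>M\<^esub> (r \<odot>\<^bsub>M\<^esub> m)" if "s \<in> carrier R" "m \<in> carrier M" for s m
    using that assms(2) by (simp add: smult_assoc1[symmetric] R.m_comm)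
  then have "(\<Union>x\<in>tensor_cls R M N c. tensor_cls R M N (frag_extend (\<lambda>(m, n). frag_of (r \<odot>\<^bsub>M\<^esub> m, n)) x)) =
      tensor_cls R M N (frag_extend (\<lambda>(m, n). frag_of (r \<odot>\<^bsub>M\<^esub> m, n)) c)"
    using assms(2) by (intro tensor_cls_map tensor_rel_map) (auto simp: smult_r_distr frag_extend_diff)
  then show ?thesis by (simp add: tensor_def tensor_cls_def[symmetric]) (simp add: tensor_free_def)
qed

text \<open>If \<open>\<phi>\<close> is linear up to the tensor relations and hits every pure tensor, the tensor product is an image
  of \<open>V\<close> and inherits the module structure and the grading from \<open>V\<close>. No projections to graded parts have
  to be constructed on the free abelian group.\<close>

lemma tensor_presentation:
  assumes "graded_module R V" and R: "\<And>d. hpart R d \<subseteq> carrier R" and M: "graded_module R M"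
    and car: "\<And>x. x \<in> carrier V \<Longrightarrow> \<phi> x \<in> carrier (tensor_free M N)"
    and add: "\<And>x y. x \<in> carrier V \<Longrightarrow> y \<in> carrier V \<Longrightarrow> \<phi> (x \<oplus>\<^bsub>V\<^esub> y) - \<phi> x - \<phi> y \<in> tensor_rel R M N"
    and smult: "\<And>r x. r \<in> carrier R \<Longrightarrow> x \<in> carrier V \<Longrightarrow>
      \<phi> (r \<odot>\<^bsub>V\<^esub> x) - frag_extend (\<lambda>(m, n). frag_of (r \<odot>\<^bsub>M\<^esub> m, n)) (\<phi> x) \<in> tensor_rel R M N"
    and onto: "\<And>m n. m \<in> carrier M \<Longrightarrow> n \<in> carrier N \<Longrightarrow>
      \<exists>x\<in>carrier V. frag_of (m, n) - \<phi> x \<in> tensor_rel R M N"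
    and hpart: "\<And>x d. x \<in> hpart V d \<Longrightarrow> \<exists>c\<in>hpart (tensor_free M N) d. \<phi> x - c \<in> tensor_rel R M N"
    and hpart_onto: "\<And>m n i d. m \<in> hpart M i \<Longrightarrow> n \<in> hpart N (d - i) \<Longrightarrow>
      \<exists>x\<in>hpart V d. frag_of (m, n) - \<phi> x \<in> tensor_rel R M N"
    and ker: "\<And>x d. x \<in> carrier V \<Longrightarrow> \<phi> x \<in> tensor_rel R M N \<Longrightarrow> \<phi> (gcomp V d x) \<in> tensor_rel R M N"
  shows "graded_map R V (tensor R M N) (\<lambda>x. tensor_cls R M N (\<phi> x))"
    "(\<lambda>x. tensor_cls R M N (\<phi> x)) ` carrier V = carrier (tensor R M N)"
proof -
  interpret V: graded_module R V by fact
  interpret M: graded_module R M by fact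
  let ?rel = "tensor_rel R M N"
  have minus: "\<phi> (x \<ominus>\<^bsub>V\<^esub> y) - (\<phi> x - \<phi> y) \<in> ?rel" if xy: "x \<in> carrier V" "y \<in> carrier V" for x y
    using tensor_rel_uminus[OF add[of "x \<ominus>\<^bsub>V\<^esub> y" y]] graded_module_diff[OF V.graded_module_axioms xy] xy
    by (simp add: algebra_simps)
  have zero: "\<phi> \<zero>\<^bsub>V\<^esub> \<in> ?rel"
    using tensor_rel_uminus[OF add[of "\<zero>\<^bsub>V\<^esub>" "\<zero>\<^bsub>V\<^esub>"]] by simp
  \<comment> \<open>Used below with \<open>H\<close> the whole module and with \<open>H\<close> one homogeneous part.\<close>
  have lift: "\<exists>x\<in>H. c - \<phi> x \<in> ?rel"
    if keys: "Poly_Mapping.keys c \<subseteq> S" and H: "H \<subseteq> carrier V" "\<zero>\<^bsub>V\<^esub> \<in> H" "\<And>x y. x \<in> H \<Longrightarrow> y \<in> H \<Longrightarrow> x \<ominus>\<^bsub>V\<^esub> y \<in> H"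
      and S: "\<And>m n. (m, n) \<in> S \<Longrightarrow> \<exists>x\<in>H. frag_of (m, n) - \<phi> x \<in> ?rel" for c S H
    using keys
  proof (induction c rule: frag_induction)
    case zero
    show ?case using H(2) tensor_rel_uminus[OF \<open>\<phi> \<zero>\<^bsub>V\<^esub> \<in> ?rel\<close>] by (intro bexI[of _ "\<zero>\<^bsub>V\<^esub>"]) auto
  next
    case (one x)
    then show ?case using S by (cases x) auto
  next
    case (diff a b)
    then obtain x y where xy: "x \<in> H" "y \<in> H" "a - \<phi> x \<in> ?rel" "b - \<phi> y \<in> ?rel" by auto
    have "(a - \<phi> x) - (b - \<phi> y) - (\<phi> (x \<ominus>\<^bsub>V\<^esub> y) - (\<phi> x - \<phi> y)) \<in> ?rel"
      by (intro tensor_rel.diff[OF tensor_rel.diff] xy minus) (use xy H(1) in auto)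
    then show ?case using xy H(3) by (intro bexI[of _ "x \<ominus>\<^bsub>V\<^esub> y"]) (auto simp: algebra_simps)
  qed
  have ontoT: "(\<lambda>x. tensor_cls R M N (\<phi> x)) ` carrier V = carrier (tensor R M N)"
  proof (intro equalityI subsetI)
    fix X assume "X \<in> carrier (tensor R M N)"
    then obtain c where c: "Poly_Mapping.keys c \<subseteq> carrier M \<times> carrier N" "X = tensor_cls R M N c"
      unfolding tensor_carrier by (auto simp: tensor_free_def)
    have "\<exists>x\<in>carrier V. c - \<phi> x \<in> ?rel"
      by (rule lift[OF c(1)]) (use onto in auto)
    then show "X \<in> (\<lambda>x. tensor_cls R M N (\<phi> x)) ` carrier V"
      unfolding c(2) by (auto simp: tensor_cls_eq_iff image_iff)
  qed (use car in \<open>auto simp: tensor_carrier\<close>)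
  have hpartT: "hpart (tensor R M N) d = (\<lambda>x. tensor_cls R M N (\<phi> x)) ` hpart V d" for d
  proof (intro equalityI subsetI)
    fix X assume "X \<in> hpart (tensor R M N) d"
    then obtain c where c: "Poly_Mapping.keys c \<subseteq> (\<Union>i. hpart M i \<times> hpart N (d - i))" "X = tensor_cls R M N c"
      unfolding tensor_hpart by (auto simp: tensor_free_def)
    interpret D: additive_subgroup "hpart V d" V by (rule V.hpart_subgroup)
    have "\<exists>x\<in>hpart V d. c - \<phi> x \<in> ?rel"
      by (rule lift[OF c(1)]) (use hpart_onto V.hpart_carrier D.a_inv_closed in \<open>auto simp: V.M.minus_eq\<close>)
    then show "X \<in> (\<lambda>x. tensor_cls R M N (\<phi> x)) ` hpart V d"
      unfolding c(2) by (auto simp: tensor_cls_eq_iff image_iff)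
  next
    fix X assume "X \<in> (\<lambda>x. tensor_cls R M N (\<phi> x)) ` hpart V d"
    then show "X \<in> hpart (tensor R M N) d"
      using hpart unfolding tensor_hpart by (fastforce simp: image_iff tensor_cls_eq_iff)
  qed
  have addT: "tensor_cls R M N (\<phi> (x \<oplus>\<^bsub>V\<^esub> y)) = tensor_cls R M N (\<phi> x) \<oplus>\<^bsub>tensor R M N\<^esub> tensor_cls R M N (\<phi> y)"
    if "x \<in> carrier V" "y \<in> carrier V" for x y
    using add[OF that] by (simp add: tensor_add tensor_cls_eq_iff algebra_simps)
  have smultT: "tensor_cls R M N (\<phi> (r \<odot>\<^bsub>V\<^esub> x)) = r \<odot>\<^bsub>tensor R M N\<^esub> tensor_cls R M N (\<phi> x)"
    if "r \<in> carrier R" "x \<in> carrier V" for r x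
    using smult[OF that] that(1) M.module_axioms by (simp add: tensor_smult tensor_cls_eq_iff)
  have zeroT: "tensor_cls R M N (\<phi> \<zero>\<^bsub>V\<^esub>) = \<zero>\<^bsub>tensor R M N\<^esub>" by (simp add: tensor_cls_zero_iff zero)
  note im = graded_module_image[OF V.graded_module_axioms R ontoT zeroT addT smultT hpartT]
  have kg: "tensor_cls R M N (\<phi> (gcomp V d x)) = \<zero>\<^bsub>tensor R M N\<^esub>"
    if "x \<in> carrier V" "tensor_cls R M N (\<phi> x) = \<zero>\<^bsub>tensor R M N\<^esub>" for x d
    using ker that by (simp add: tensor_cls_zero_iff)
  show "graded_map R V (tensor R M N) (\<lambda>x. tensor_cls R M N (\<phi> x))"
    by (intro graded_map_intro V.graded_module_axioms im) (use kg in auto)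
  show "(\<lambda>x. tensor_cls R M N (\<phi> x)) ` carrier V = carrier (tensor R M N)" by (rule ontoT)
qed

section \<open>Tensoring with the residue field\<close>

abbreviation max_ideal :: "('v::finite, 'k::comm_ring_1) mpoly set" where
  "max_ideal \<equiv> Idl\<^bsub>polyR\<^esub> (range var)"

abbreviation residue :: "('v::finite, 'k::comm_ring_1) mpoly \<Rightarrow> ('v, 'k) mpoly set" where
  "residue r \<equiv> max_ideal +>\<^bsub>polyR\<^esub> r"

lemma ideal_max_ideal: "ideal max_ideal polyR"
  by (rule polyR.R.genideal_ideal) simp

lemma var_max_ideal: "var v \<in> max_ideal"
  using polyR.R.genideal_self[of "range var"] by auto

lemma graded_submodule_max_ideal:
  "graded_submodule polyR polyR (max_ideal :: ('v::finite, 'k::comm_ring_1) mpoly set)"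
proof (rule graded_submodule_ideal)
  let ?J = "max_ideal :: ('v, 'k) mpoly set"
  have "?J \<subseteq> Idl\<^bsub>polyR\<^esub> (?J \<inter> (\<Union>d. homog d))"
  proof (rule polyR.R.genideal_minimal)
    show "ideal (Idl\<^bsub>polyR\<^esub> (?J \<inter> (\<Union>d. homog d))) polyR"
      by (rule polyR.R.genideal_ideal) simp
    have "range var \<subseteq> ?J \<inter> (\<Union>d. homog d)" using var_max_ideal var_homog by blast
    then show "range var \<subseteq> Idl\<^bsub>polyR\<^esub> (?J \<inter> (\<Union>d. homog d))"
      using polyR.R.genideal_self[of "?J \<inter> (\<Union>d. homog d)"] by simp blast
  qed
  moreover have "Idl\<^bsub>polyR\<^esub> (?J \<inter> (\<Union>d. homog d)) \<subseteq> ?J"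
    by (rule polyR.R.genideal_minimal[OF ideal_max_ideal]) auto
  ultimately show "homogeneous_ideal ?J"
    unfolding homogeneous_ideal_def using ideal_max_ideal by blast
qed

abbreviation constant_term :: "('v, 'k::comm_ring_1) mpoly \<Rightarrow> 'k" where
  "constant_term f \<equiv> Poly_Mapping.lookup f 0"

lemma constant_term_mult: "constant_term (f * g) = constant_term f * constant_term (g :: ('v::finite, 'k::comm_ring_1) mpoly)"
proof -
  have zero: "k + l = 0 \<longleftrightarrow> k = 0 \<and> l = 0" for k l :: "'v \<Rightarrow>\<^sub>0 nat"
    by (auto simp: poly_mapping_eq_iff fun_eq_iff lookup_add)
  have "f * g = (\<Sum>k\<in>Poly_Mapping.keys f. \<Sum>l\<in>Poly_Mapping.keys g.
      Poly_Mapping.single (k + l) (Poly_Mapping.lookup f k * Poly_Mapping.lookup g l))"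
    by (subst (1) poly_eq_sum_single[of f], subst (1) poly_eq_sum_single[of g])
       (simp add: sum_product mult_single)
  then have "constant_term (f * g) = (\<Sum>k\<in>Poly_Mapping.keys f. \<Sum>l\<in>Poly_Mapping.keys g.
      if l = 0 then if k = 0 then Poly_Mapping.lookup f k * Poly_Mapping.lookup g l else 0 else 0)"
    by (simp add: lookup_sum lookup_single when_def zero) (intro sum.cong refl, auto)
  also have "\<dots> = (\<Sum>k\<in>Poly_Mapping.keys f. if k = 0 then Poly_Mapping.lookup f 0 * Poly_Mapping.lookup g 0 else 0)"
    by (intro sum.cong refl) (auto simp: in_keys_iff)
  also have "\<dots> = constant_term f * constant_term g" by (auto simp: in_keys_iff)
  finally show ?thesis .
qed

lemma max_ideal_constant_term:
  assumes "f \<in> (max_ideal :: ('v::finite, 'k::comm_ring_1) mpoly set)" shows "constant_term f = 0"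
proof -
  have "ideal {f :: ('v, 'k) mpoly. constant_term f = 0} polyR"
  proof (rule idealI)
    show "ring (polyR :: (('v, 'k) mpoly, _) gmodule)" by (rule cring.axioms(1)[OF cring_polyR])
    show "subgroup {f :: ('v, 'k) mpoly. constant_term f = 0} (add_monoid polyR)"
    proof (rule polyR.R.add.subgroupI)
      fix f :: "('v, 'k) mpoly" assume f: "f \<in> {f. constant_term f = 0}"
      have "\<ominus>\<^bsub>polyR\<^esub> f = - f" by (rule polyR.R.minus_equality) auto
      then show "\<ominus>\<^bsub>polyR\<^esub> f \<in> {f. constant_term f = 0}" using f by simp
    qed (auto simp: lookup_add intro: exI[of _ 0])
  qed (auto simp: constant_term_mult)
  moreover have "range var \<subseteq> {f :: ('v, 'k) mpoly. constant_term f = 0}"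
    by (auto simp: var_def lookup_single when_def poly_mapping_eq_iff fun_eq_iff)
  ultimately have "max_ideal \<subseteq> {f :: ('v, 'k) mpoly. constant_term f = 0}"
    by (rule polyR.R.genideal_minimal)
  then show ?thesis using assms by blast
qed

context
begin

private lemmas gq = graded_module_gquot[OF graded_module_polyR homog_carrier graded_submodule_max_ideal]

lemma residue_carrier: "Y \<in> carrier residue_k \<longleftrightarrow> (\<exists>r. Y = residue r)"
  using gq(3) unfolding residue_k_def by (auto simp del: gquot_simps)

lemma residue_add: "residue r \<oplus>\<^bsub>residue_k\<^esub> residue s = residue (r + s)"
  using graded_homD(2)[OF gq(2), of r s] unfolding residue_k_def by (simp del: gquot_simps)

lemma residue_smult: "r \<odot>\<^bsub>residue_k\<^esub> residue s = residue (r * s)"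
  using graded_homD(3)[OF gq(2), of r s] unfolding residue_k_def by (simp del: gquot_simps)

lemma residue_hpart: "hpart residue_k d = residue ` homog d"
  by (simp add: residue_k_def)

lemma residue_eq_iff: "residue r = residue s \<longleftrightarrow> r - s \<in> max_ideal"
proof -
  interpret graded_map polyR polyR residue_k residue
    unfolding residue_k_def by (rule graded_map_intro[OF graded_module_polyR gq(1,2)])
  have m: "r \<ominus>\<^bsub>polyR\<^esub> s = r - s"
    using polyR.R.minus_equality[of "- s" s] by (simp add: a_minus_def)
  have "residue r = residue s \<longleftrightarrow> residue r \<ominus>\<^bsub>residue_k\<^esub> residue s = \<zero>\<^bsub>residue_k\<^esub>"
    using N.M.minus_zero_iff[of "residue r" "residue s"] closed[of r] closed[of s] by simp
  also have "\<dots> \<longleftrightarrow> residue (r - s) = \<zero>\<^bsub>residue_k\<^esub>" using minus[of r s] m by simp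
  also have "\<dots> \<longleftrightarrow> r - s \<in> max_ideal" using gq(4)[of "r - s"] unfolding residue_k_def by (simp del: gquot_simps)
  finally show ?thesis .
qed

end

text \<open>The residue class as an element of the coefficient ring, that is the common constant term of its
  representatives.\<close>

definition residue_value :: "('v::finite, 'k::comm_ring_1) mpoly set \<Rightarrow> 'k" where
  "residue_value Y = constant_term (SOME r. Y = residue r)"

lemma residue_value [simp]: "residue_value (residue r) = constant_term r"
proof -
  define s where "s = (SOME s. residue r = residue s)"
  have "residue r = residue s" unfolding s_def by (rule someI[of _ r]) simp
  then have "constant_term (r - s) = 0" using residue_eq_iff max_ideal_constant_term by blast
  then show ?thesis by (simp add: residue_value_def s_def[symmetric] lookup_minus)
qed

text \<open>The multiples of the maximal ideal, written as the coefficients of the contractions of 1-forms.\<close>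

definition max_multiples :: "('v::{finite,linorder}, 'k::comm_ring_1, 'm) pmodule \<Rightarrow> 'm set" where
  "max_multiples M = (\<lambda>\<omega>. \<omega> {}) ` koszul_boundaries 0 M"

lemma zero_form_graded_map:
  assumes "graded_module polyR (M :: ('v::{finite,linorder}, 'k::comm_ring_1, 'm) pmodule)"
  shows "graded_map polyR (vforms 0 M) M (\<lambda>\<omega> :: 'v set \<Rightarrow> 'm. \<omega> {})"
  by (intro graded_map_intro graded_module_pforms assms graded_homI) auto

lemma graded_submodule_boundaries:
  assumes "graded_module polyR (M :: ('v::{finite,linorder}, 'k::comm_ring_1, 'm) pmodule)"
  shows "graded_submodule polyR (vforms q M) (koszul_boundaries q M)"
  unfolding koszul_boundaries_def
  by (rule graded_map.image_graded_submodule[OF vcontract_graded_map[OF assms]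
        graded_module.graded_submodule_carrier[OF graded_module_pforms[OF assms]]])

lemma graded_submodule_max_multiples:
  assumes "graded_module polyR (M :: ('v::{finite,linorder}, 'k::comm_ring_1, 'm) pmodule)"
  shows "graded_submodule polyR M (max_multiples M)"
  unfolding max_multiples_def
  by (rule graded_map.image_graded_submodule[OF zero_form_graded_map[OF assms] graded_submodule_boundaries[OF assms]])

lemma zero_form_boundary_iff:
  assumes "graded_module polyR (M :: ('v::{finite,linorder}, 'k::comm_ring_1, 'm) pmodule)"
    and w: "\<omega> \<in> carrier (vforms 0 M)"
  shows "\<omega> \<in> koszul_boundaries 0 M \<longleftrightarrow> \<omega> {} \<in> max_multiples M"
proof
  assume "\<omega> {} \<in> max_multiples M"
  then obtain \<eta> where e: "\<eta> \<in> koszul_boundaries 0 M" "\<omega> {} = \<eta> {}" unfolding max_multiples_def by auto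
  then have "\<eta> \<in> carrier (vforms 0 M)" using graded_submoduleD(1)[OF graded_submodule_boundaries[OF assms(1)]] by blast
  then have "\<omega> S = \<eta> S" for S using w e(2) by (cases "S = {}") auto
  then have "\<omega> = \<eta>" by (rule ext)
  then show "\<omega> \<in> koszul_boundaries 0 M" using e(1) by simp
qed (auto simp: max_multiples_def)

context
  fixes M :: "('v::{finite,linorder}, 'k::comm_ring_1, 'm) pmodule"
  assumes free: "graded_free polyR M"
begin

interpretation M: graded_module polyR M using free by (simp add: graded_free_def)

text \<open>If \<open>x \<otimes> 1\<close> vanishes, then so do the constant terms of the coordinates of \<open>x\<close>, since they are bilinear
  functions of \<open>x\<close> and the residue class. Then \<open>x\<close>, seen as a 0-form, is a contraction.\<close>

lemma tensor_residue_kernel: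
  assumes x: "x \<in> carrier M"
  shows "frag_of (x, residue 1) \<in> tensor_rel polyR M residue_k \<longleftrightarrow> x \<in> max_multiples M"
proof
  let ?rel = "tensor_rel polyR M residue_k"
  obtain B coord where "free_coordinates M B coord" using graded_free_coordinates[OF free] by blast
  then interpret C: free_coordinates M B coord .
  define \<beta> where "\<beta> = (\<lambda>(x, Y :: ('v, 'k) mpoly set) b. constant_term (coord x b) * residue_value Y)"
  assume "frag_of (x, residue 1) \<in> ?rel"
  then have "(\<lambda>b. zlin (\<lambda>x. \<beta> x b) (frag_of (x, residue 1))) \<in> {\<lambda>b. 0}"
    by (rule tensor_rel_zlin[where \<beta> = \<beta> and R = polyR and M = M and N = residue_k, rotated -1])
       (auto simp: \<beta>_def fun_eq_iff residue_carrier residue_add residue_smult C.coord_add C.coord_smult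
         lookup_add constant_term_mult algebra_simps)
  then have const: "constant_term (coord x b) = 0" for b by (auto simp: \<beta>_def fun_eq_iff)
  let ?w = "\<lambda>S. if S = {} then x else \<zero>\<^bsub>M\<^esub>"
  have w: "?w \<in> carrier (vforms 0 M)" using x by auto
  have "?w \<in> koszul_boundaries 0 M"
    unfolding koszul_boundaries_def
    by (rule C.koszul_exact[OF w vcontract_zero_form[OF M.graded_module_axioms w]]) (simp add: const)
  then show "x \<in> max_multiples M" using zero_form_boundary_iff[OF M.graded_module_axioms w] by simp
next
  let ?rel = "tensor_rel polyR M residue_k"
  assume "x \<in> max_multiples M"
  then obtain \<omega> where w: "\<omega> \<in> carrier (vforms (Suc 0) M)" "x = vcontract M \<omega> {}"
    unfolding max_multiples_def koszul_boundaries_def by auto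
  define K where "K = {x \<in> carrier M. frag_of (x, residue 1) \<in> ?rel}"
  have rc: "residue r \<in> carrier residue_k" for r :: "('v, 'k) mpoly" using residue_carrier by blast
  have K_add: "x \<oplus>\<^bsub>M\<^esub> y \<in> K" if "x \<in> K" "y \<in> K" for x y
  proof -
    have "frag_of (x \<oplus>\<^bsub>M\<^esub> y, residue 1) - frag_of (x, residue 1) - frag_of (y, residue 1) \<in> ?rel"
      by (rule tensor_rel.add_left) (use that rc in \<open>auto simp: K_def\<close>)
    then have "frag_of (x \<oplus>\<^bsub>M\<^esub> y, residue 1) - frag_of (x, residue 1) - frag_of (y, residue 1)
        + frag_of (x, residue 1) + frag_of (y, residue 1) \<in> ?rel"
      using that by (intro tensor_rel_add) (auto simp: K_def)
    then show ?thesis using that by (auto simp: K_def)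
  qed
  have K_var: "(s * var v) \<odot>\<^bsub>M\<^esub> y \<in> K" if "y \<in> carrier M" for s v y
  proof -
    have "s * var v \<in> max_ideal"
      using ideal.I_l_closed[OF ideal_max_ideal var_max_ideal, of s v] by simp
    then have z: "(s * var v) \<odot>\<^bsub>residue_k\<^esub> residue 1 = residue 0"
      by (simp add: residue_smult residue_eq_iff)
    have "frag_of ((s * var v) \<odot>\<^bsub>M\<^esub> y, residue 1) - frag_of (y, residue 0) \<in> ?rel"
      using tensor_rel.balanced[of "s * var v" polyR y M "residue 1" residue_k] that rc z by simp
    moreover have "frag_of (y, residue 0) \<in> ?rel"
      using tensor_rel_uminus[OF tensor_rel.add_right[of y M "residue 0" residue_k "residue 0" polyR]] that rc
      by (simp add: residue_add)
    ultimately show ?thesis using tensor_rel_add that by (fastforce simp: K_def)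
  qed
  have K_zero: "\<zero>\<^bsub>M\<^esub> \<in> K" using K_var[OF M.M.zero_closed] by (simp add: M.smult_r_null)
  have sums: "finsum M c A \<in> K" if "\<And>a. a \<in> A \<Longrightarrow> c a \<in> K" for c and A :: "'v set"
    using finite[of A] that
  proof (induction A)
    case (insert a A)
    have "c \<in> A \<rightarrow> carrier M" "c a \<in> carrier M" using insert by (auto simp: K_def)
    then show ?case using insert K_add by (simp add: M.M.finsum_insert)
  qed (simp add: K_zero)
  have "x \<in> K" unfolding w(2) vcontract_def by (rule sums, rule K_var) (use w(1) in auto)
  then show "frag_of (x, residue 1) \<in> ?rel" by (simp add: K_def)
qed

lemma tensor_residue:
  defines "u \<equiv> \<lambda>x. tensor_cls polyR M residue_k (frag_of (x, residue 1))"
  shows "graded_map polyR M (tensor polyR M residue_k) u"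
    "u ` carrier M = carrier (tensor polyR M residue_k)"
    "\<And>x. x \<in> carrier M \<Longrightarrow> u x = \<zero>\<^bsub>tensor polyR M residue_k\<^esub> \<longleftrightarrow> x \<in> max_multiples M"
proof -
  let ?rel = "tensor_rel polyR M residue_k"
  have rc: "residue r \<in> carrier residue_k" for r :: "('v, 'k) mpoly" using residue_carrier by blast
  have bal: "frag_of (m, residue r) - frag_of (r \<odot>\<^bsub>M\<^esub> m, residue 1) \<in> ?rel" if "m \<in> carrier M" for m r
    using tensor_rel_uminus[OF tensor_rel.balanced[of r polyR m M "residue 1" residue_k]] that rc
    by (simp add: residue_smult)
  note pr = tensor_presentation[of polyR M M "\<lambda>x. frag_of (x, residue 1)" residue_k, OF M.graded_module_axioms homog_carrier M.graded_module_axioms]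
  have 1: "frag_of (x, residue 1) \<in> carrier (tensor_free M residue_k)" if "x \<in> carrier M" for x
    using that rc by (auto simp: tensor_free_def)
  have 2: "frag_of (x \<oplus>\<^bsub>M\<^esub> y, residue 1) - frag_of (x, residue 1) - frag_of (y, residue 1) \<in> ?rel"
    if "x \<in> carrier M" "y \<in> carrier M" for x y
    using that rc by (rule tensor_rel.add_left)
  have 3: "frag_of (r \<odot>\<^bsub>M\<^esub> x, residue 1) - frag_extend (\<lambda>(m, n). frag_of (r \<odot>\<^bsub>M\<^esub> m, n)) (frag_of (x, residue 1)) \<in> ?rel"
    for r x by (simp add: tensor_rel.zero)
  have 4: "\<exists>x\<in>carrier M. frag_of (m, n) - frag_of (x, residue 1) \<in> ?rel" if "m \<in> carrier M" "n \<in> carrier residue_k" for m n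
    using that bal unfolding residue_carrier by (metis M.smult_closed UNIV_I polyR_simps(1))
  have 5: "\<exists>c\<in>hpart (tensor_free M residue_k) d. frag_of (x, residue 1) - c \<in> ?rel" if "x \<in> hpart M d" for x d
  proof (intro bexI)
    show "frag_of (x, residue 1) - frag_of (x, residue 1) \<in> ?rel" by (simp add: tensor_rel.zero)
    show "frag_of (x, residue 1) \<in> hpart (tensor_free M residue_k) d"
      using that by (auto simp: tensor_free_def residue_hpart intro!: exI[of _ d])
  qed
  have 6: "\<exists>x\<in>hpart M d. frag_of (m, n) - frag_of (x, residue 1) \<in> ?rel"
    if m: "m \<in> hpart M i" and n: "n \<in> hpart residue_k (d - i)" for m n i d
  proof -
    obtain r where r: "r \<in> homog (d - i)" "n = residue r" using n unfolding residue_hpart by auto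
    then have "r \<odot>\<^bsub>M\<^esub> m \<in> hpart M d" using M.hpart_smult[of r "d - i" m i] m by simp
    then show ?thesis using bal[OF M.hpart_carrier[OF m]] r by blast
  qed
  have 7: "frag_of (gcomp M d x, residue 1) \<in> ?rel" if "x \<in> carrier M" "frag_of (x, residue 1) \<in> ?rel" for x d
    using that graded_submoduleD(5)[OF graded_submodule_max_multiples[OF M.graded_module_axioms]]
    by (simp add: tensor_residue_kernel M.gcomp_carrier)
  note pr = pr[OF 1 2 3 4 5 6 7]
  show "graded_map polyR M (tensor polyR M residue_k) u" unfolding u_def by (rule pr(1))
  show "u ` carrier M = carrier (tensor polyR M residue_k)" unfolding u_def by (rule pr(2))
  show "u x = \<zero>\<^bsub>tensor polyR M residue_k\<^esub> \<longleftrightarrow> x \<in> max_multiples M" if "x \<in> carrier M" for x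
    unfolding u_def tensor_cls_zero_iff by (rule tensor_residue_kernel[OF that])
qed

end

section \<open>Comparison of Tor with Koszul homology\<close>

text \<open>As \<open>F q \<otimes> k\<close> is \<open>F q\<close> modulo the multiples of the maximal ideal, these are the elements of \<open>F q\<close> that
  represent cycles of \<open>F \<otimes> k\<close>.\<close>

definition tor_cycles where
  "tor_cycles F \<delta> q = (case q of 0 \<Rightarrow> carrier (F 0) | Suc i \<Rightarrow> {x \<in> carrier (F q). \<delta> i x \<in> max_multiples (F i)})"

lemma tor_presentation:
  fixes F :: "nat \<Rightarrow> ('v::{finite,linorder}, 'k::comm_ring_1, 'm) pmodule"
  assumes res: "graded_free_resolution polyR F \<delta> \<epsilon> M"
  obtains \<theta> where
    "graded_map polyR (gsub (F q) (tor_cycles F \<delta> q)) (Tor polyR F \<delta> residue_k q) \<theta>"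
    "\<theta> ` tor_cycles F \<delta> q = carrier (Tor polyR F \<delta> residue_k q)"
    "\<And>x. x \<in> tor_cycles F \<delta> q \<Longrightarrow> \<theta> x = \<zero>\<^bsub>Tor polyR F \<delta> residue_k q\<^esub> \<longleftrightarrow>
      (\<exists>y\<in>max_multiples (F q). \<exists>z\<in>carrier (F (Suc q)). x = y \<oplus>\<^bsub>F q\<^esub> \<delta> q z)"
proof -
  define T where "T i = tensor polyR (F i) residue_k" for i
  define u where "u i x = tensor_cls polyR (F i) residue_k (frag_of (x, residue 1))" for i x
  define t where "t i = tensor_map polyR (F i) residue_k (\<delta> i)" for i
  interpret u: graded_map polyR "F i" "T i" "u i" for i
    unfolding T_def u_def by (rule tensor_residue(1)[OF resolutionD(1)[OF res]])
  have u_onto: "u i ` carrier (F i) = carrier (T i)" for i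
    unfolding T_def u_def by (rule tensor_residue(2)[OF resolutionD(1)[OF res]])
  have u_zero: "u i x = \<zero>\<^bsub>T i\<^esub> \<longleftrightarrow> x \<in> max_multiples (F i)" if "x \<in> carrier (F i)" for i x
    unfolding T_def u_def by (rule tensor_residue(3)[OF resolutionD(1)[OF res] that])
  interpret d: poly_map "F (Suc i)" "F i" "\<delta> i" for i by (rule resolutionD(3)[OF res])
  have tu: "t i (u (Suc i) x) = u i (\<delta> i x)" for i x
    unfolding t_def u_def by (subst tensor_map_cls[OF d.graded_map_axioms]) simp
  let ?D = "tor_cycles F \<delta> q"
  have D: "graded_submodule polyR (F q) ?D"
    using u.M.graded_submodule_carrier[of 0]
      d.preimage_graded_submodule[OF graded_submodule_max_multiples[OF u.M.graded_module_axioms]]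
    by (auto simp: tor_cycles_def split: nat.split)
  let ?K = "case q of 0 \<Rightarrow> carrier (T 0) | Suc i \<Rightarrow> a_kernel (T (Suc i)) (T i) (t i)"
  let ?H = "t q ` carrier (T (Suc q))"
  have K: "?K = u q ` ?D"
  proof (cases q)
    case 0
    then show ?thesis using u_onto by (simp add: tor_cycles_def)
  next
    case (Suc i)
    show ?thesis
    proof (intro equalityI subsetI)
      fix X assume "X \<in> ?K"
      then have X: "X \<in> carrier (T q)" "t i X = \<zero>\<^bsub>T i\<^esub>" using Suc by (auto simp: a_kernel_def')
      then obtain x where x: "x \<in> carrier (F q)" "X = u q x" using u_onto[of q] by blast
      then show "X \<in> u q ` ?D"
        using X(2) Suc tu u_zero d.closed by (auto simp: tor_cycles_def)
    next
      fix X assume "X \<in> u q ` ?D"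
      then obtain x where "x \<in> carrier (F (Suc i))" "\<delta> i x \<in> max_multiples (F i)" "X = u (Suc i) x"
        using Suc by (auto simp: tor_cycles_def)
      then show "X \<in> ?K" using Suc tu u_zero d.closed u.closed by (auto simp: a_kernel_def')
    qed
  qed
  have H: "?H = u q ` \<delta> q ` carrier (F (Suc q))"
    unfolding u_onto[symmetric] image_image tu ..
  have im: "graded_submodule polyR (F q) (\<delta> q ` carrier (F (Suc q)))"
    by (rule d.image_graded_submodule[OF u.M.graded_submodule_carrier])
  have sub: "\<delta> q ` carrier (F (Suc q)) \<subseteq> ?D"
  proof (cases q)
    case (Suc i)
    have "\<delta> i (\<delta> (Suc i) x) = \<zero>\<^bsub>F i\<^esub>" if "x \<in> carrier (F (Suc (Suc i)))" for x
      using resolutionD(5)[OF res, of i] that unfolding a_kernel_def' by blast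
    then show ?thesis
      using Suc d.closed graded_submoduleD(2)[OF graded_submodule_max_multiples[OF u.M.graded_module_axioms]]
      by (auto simp: tor_cycles_def)
  qed (use d.closed in \<open>auto simp: tor_cycles_def\<close>)
  have gK: "graded_submodule polyR (T q) (u q ` ?D)" by (rule u.image_graded_submodule[OF D])
  have gH: "graded_submodule polyR (T q) ?H" unfolding H by (rule u.image_graded_submodule[OF im])
  have HK: "?H \<subseteq> u q ` ?D" unfolding H using sub by (rule image_mono)
  let ?Q = "gquot (gsub (T q) (u q ` ?D)) ?H"
  have Tor: "Tor polyR F \<delta> residue_k q = ?Q"
    unfolding Tor_def T_def[symmetric] t_def[symmetric] K[symmetric] ..
  have gs: "graded_module polyR (gsub (T q) (u q ` ?D))"
    by (rule graded_module_gsub(1)[OF u.N.graded_module_axioms homog_carrier gK])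
  have gs': "graded_submodule polyR (gsub (T q) (u q ` ?D)) ?H"
    by (rule graded_submodule_gsub[OF u.N.graded_module_axioms homog_carrier gK gH HK])
  note Q = graded_module_gquot[OF gs homog_carrier gs']
  interpret Q: graded_map polyR "gsub (T q) (u q ` ?D)" ?Q "\<lambda>X. ?H +>\<^bsub>gsub (T q) (u q ` ?D)\<^esub> X"
    by (rule graded_map_intro[OF gs Q(1,2)])
  have gD: "graded_module polyR (gsub (F q) ?D)"
    by (rule graded_module_gsub(1)[OF u.M.graded_module_axioms homog_carrier D])
  interpret uD: graded_map polyR "gsub (F q) ?D" "gsub (T q) (u q ` ?D)" "u q"
    by (intro graded_map_intro gD gs graded_hom_gsub u.hom) (use graded_submoduleD(1)[OF D] in auto)
  define \<theta> where "\<theta> x = ?H +>\<^bsub>gsub (T q) (u q ` ?D)\<^esub> u q x" for x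
  show thesis
  proof (rule that[of \<theta>], unfold Tor)
    show "graded_map polyR (gsub (F q) ?D) ?Q \<theta>"
      unfolding \<theta>_def by (intro graded_map_intro gD Q(1) graded_homI) (auto simp del: gsub_simps gquot_simps simp: Q.closed uD.closed Q.add uD.add Q.smult uD.smult Q.hpart uD.hpart)
    show "\<theta> ` ?D = carrier ?Q"
      unfolding Q(3)[symmetric] \<theta>_def by (simp add: image_image del: gquot_simps)
    fix x assume x: "x \<in> ?D"
    then have xc: "x \<in> carrier (F q)" using graded_submoduleD(1)[OF D] by blast
    have "\<theta> x = \<zero>\<^bsub>?Q\<^esub> \<longleftrightarrow> u q x \<in> ?H"
      unfolding \<theta>_def by (rule Q(4)) (use x in simp)
    also have "\<dots> \<longleftrightarrow> (\<exists>z\<in>carrier (F (Suc q)). u q x = u q (\<delta> q z))" unfolding H by auto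
    also have "\<dots> \<longleftrightarrow> (\<exists>z\<in>carrier (F (Suc q)). x \<ominus>\<^bsub>F q\<^esub> \<delta> q z \<in> max_multiples (F q))"
    proof (rule bex_cong[OF refl])
      fix z assume "z \<in> carrier (F (Suc q))"
      then have dz: "\<delta> q z \<in> carrier (F q)" by (rule d.closed)
      have "u q x = u q (\<delta> q z) \<longleftrightarrow> u q (x \<ominus>\<^bsub>F q\<^esub> \<delta> q z) = \<zero>\<^bsub>T q\<^esub>"
        using u.minus[OF xc dz] u.N.M.minus_zero_iff[OF u.closed[OF xc] u.closed[OF dz]] by simp
      then show "u q x = u q (\<delta> q z) \<longleftrightarrow> x \<ominus>\<^bsub>F q\<^esub> \<delta> q z \<in> max_multiples (F q)"
        using u_zero[OF graded_module_diff(1)[OF u.M.graded_module_axioms xc dz]] by simp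
    qed
    also have "\<dots> \<longleftrightarrow> (\<exists>y\<in>max_multiples (F q). \<exists>z\<in>carrier (F (Suc q)). x = y \<oplus>\<^bsub>F q\<^esub> \<delta> q z)"
    proof
      assume "\<exists>z\<in>carrier (F (Suc q)). x \<ominus>\<^bsub>F q\<^esub> \<delta> q z \<in> max_multiples (F q)"
      then obtain z where z: "z \<in> carrier (F (Suc q))" "x \<ominus>\<^bsub>F q\<^esub> \<delta> q z \<in> max_multiples (F q)" by blast
      then show "\<exists>y\<in>max_multiples (F q). \<exists>z\<in>carrier (F (Suc q)). x = y \<oplus>\<^bsub>F q\<^esub> \<delta> q z"
        using graded_module_diff(3)[OF u.M.graded_module_axioms xc d.closed[OF z(1)], symmetric] by blast
    next
      assume "\<exists>y\<in>max_multiples (F q). \<exists>z\<in>carrier (F (Suc q)). x = y \<oplus>\<^bsub>F q\<^esub> \<delta> q z"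
      then obtain y z where y: "y \<in> max_multiples (F q)" and z: "z \<in> carrier (F (Suc q))" and eq: "x = y \<oplus>\<^bsub>F q\<^esub> \<delta> q z" by blast
      have yc: "y \<in> carrier (F q)"
        using graded_submoduleD(1)[OF graded_submodule_max_multiples[OF u.M.graded_module_axioms] y] .
      have "x \<ominus>\<^bsub>F q\<^esub> \<delta> q z = y"
        unfolding eq using yc d.closed[OF z] by (simp add: u.M.M.minus_eq u.M.M.a_assoc u.M.M.r_neg)
      then show "\<exists>z\<in>carrier (F (Suc q)). x \<ominus>\<^bsub>F q\<^esub> \<delta> q z \<in> max_multiples (F q)" using y z by blast
    qed
    finally show "\<theta> x = \<zero>\<^bsub>?Q\<^esub> \<longleftrightarrow> (\<exists>y\<in>max_multiples (F q). \<exists>z\<in>carrier (F (Suc q)). x = y \<oplus>\<^bsub>F q\<^esub> \<delta> q z)" .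
  qed
qed

text \<open>The zigzag ends in 0-forms with values in \<open>F q\<close>, which present Tor.\<close>

theorem koszul_homology_tor:
  fixes F :: "nat \<Rightarrow> ('v::{finite,linorder}, 'k::comm_ring_1, 'm) pmodule" and M :: "('v, 'k, 'i) pmodule"
  assumes res: "graded_free_resolution polyR F \<delta> \<epsilon> M"
  obtains \<theta> where
    "graded_map polyR (gsub (vforms q M) (koszul_cycles q M)) (Tor polyR F \<delta> residue_k q) \<theta>"
    "\<theta> ` koszul_cycles q M = carrier (Tor polyR F \<delta> residue_k q)"
    "\<And>x. x \<in> koszul_cycles q M \<Longrightarrow> \<theta> x = \<zero>\<^bsub>Tor polyR F \<delta> residue_k q\<^esub> \<longleftrightarrow> x \<in> koszul_boundaries q M"
proof -
  interpret d: poly_map "F (Suc i)" "F i" "\<delta> i" for i by (rule resolutionD(3)[OF res])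
  interpret e: poly_map "F 0" M \<epsilon> by (rule resolutionD(4)[OF res])
  let ?T = "Tor polyR F \<delta> residue_k q"
  let ?C = "case q of 0 \<Rightarrow> cycles_over 0 (F 0) M \<epsilon> | Suc i \<Rightarrow> cycles_mod 0 (F q) (F i) (\<delta> i)"
  obtain Z where Z: "graded_corr polyR (gsub (vforms q M) (koszul_cycles q M)) (koszul_boundaries q M)
    (gsub (vforms 0 (F q)) ?C) (total_boundaries 0 (F q) (F (Suc q)) (\<delta> q)) Z"
    using resolution_corr[OF res, of q 0] by auto
  obtain \<tau> where \<tau>: "graded_map polyR (gsub (F q) (tor_cycles F \<delta> q)) ?T \<tau>"
    "\<tau> ` tor_cycles F \<delta> q = carrier ?T"
    "\<And>x. x \<in> tor_cycles F \<delta> q \<Longrightarrow> \<tau> x = \<zero>\<^bsub>?T\<^esub> \<longleftrightarrow>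
      (\<exists>y\<in>max_multiples (F q). \<exists>z\<in>carrier (F (Suc q)). x = y \<oplus>\<^bsub>F q\<^esub> \<delta> q z)"
    by (rule tor_presentation[OF res, where q = q], rule that)
  interpret \<tau>: graded_map polyR "gsub (F q) (tor_cycles F \<delta> q)" ?T \<tau> by (rule \<tau>(1))
  have C_iff: "\<omega> \<in> ?C \<longleftrightarrow> \<omega> \<in> carrier (vforms 0 (F q)) \<and> \<omega> {} \<in> tor_cycles F \<delta> q" for \<omega>
  proof (cases q)
    case 0
    have "cycles_over 0 (F 0) M \<epsilon> = carrier (vforms 0 (F 0))"
      unfolding cycles_over_def using vcontract_zero_form[OF e.N.graded_module_axioms e.forms_closed[of _ 0]] by blast
    then show ?thesis using 0 by (simp add: tor_cycles_def) metis
  next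
    case (Suc i)
    have "(\<lambda>S. \<delta> i (\<omega> S)) \<in> vcontract (F i) ` carrier (vforms (Suc 0) (F i)) \<longleftrightarrow> \<delta> i (\<omega> {}) \<in> max_multiples (F i)"
      if "\<omega> \<in> carrier (vforms 0 (F (Suc i)))"
      using zero_form_boundary_iff[OF d.N.graded_module_axioms d.forms_closed[OF that]] unfolding koszul_boundaries_def by simp
    then show ?thesis using Suc by (auto simp: tor_cycles_def cycles_mod_def)
  qed
  have C_sub: "?C \<subseteq> carrier (vforms 0 (F q))" using C_iff by blast
  \<comment> \<open>Evaluation at the empty set identifies 0-forms with elements of \<open>F q\<close>.\<close>
  have "graded_corr polyR (gsub (vforms 0 (F q)) ?C) (total_boundaries 0 (F q) (F (Suc q)) (\<delta> q)) ?T {\<zero>\<^bsub>?T\<^esub>}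
     {(\<omega>, \<tau> (\<omega> {})) | \<omega>. \<omega> \<in> carrier (gsub (vforms 0 (F q)) ?C)}"
  proof (rule graded_corr_map)
    have gC: "graded_module polyR (gsub (vforms 0 (F q)) ?C)" by (rule graded_corrD(2)[OF Z])
    interpret ev: graded_map polyR "vforms 0 (F q)" "F q" "\<lambda>\<omega> :: 'v set \<Rightarrow> 'm. \<omega> {}"
      by (rule zero_form_graded_map[OF d.N.graded_module_axioms])
    have "(\<lambda>\<omega>. \<omega> {}) \<in> graded_hom polyR (gsub (vforms 0 (F q)) ?C) (gsub (F q) (tor_cycles F \<delta> q))"
      by (rule graded_hom_gsub[OF ev.hom C_sub]) (simp add: C_iff)
    then interpret ev': graded_map polyR "gsub (vforms 0 (F q)) ?C" "gsub (F q) (tor_cycles F \<delta> q)" "\<lambda>\<omega>. \<omega> {}"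
      by (intro graded_map_intro gC \<tau>.M.graded_module_axioms)
    show "graded_map polyR (gsub (vforms 0 (F q)) ?C) ?T (\<lambda>\<omega>. \<tau> (\<omega> {}))"
      by (intro graded_map_intro gC \<tau>.N.graded_module_axioms graded_homI)
         (simp_all only: ev'.closed ev'.add ev'.smult ev'.hpart \<tau>.closed \<tau>.add \<tau>.smult \<tau>.hpart)
    have ev_onto: "\<exists>\<omega>\<in>?C. \<omega> {} = x" if "x \<in> tor_cycles F \<delta> q" for x
    proof -
      have "x \<in> carrier (F q)" using that by (auto simp: tor_cycles_def split: nat.splits)
      then have "(\<lambda>S. if S = {} then x else \<zero>\<^bsub>F q\<^esub>) \<in> ?C"
        unfolding C_iff using that d.N.M.zero_closed by auto
      then show ?thesis by (rule bexI[rotated]) simp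
    qed
    have "(\<lambda>\<omega>. \<tau> (\<omega> {})) ` ?C = \<tau> ` (\<lambda>\<omega>. \<omega> {}) ` ?C" by (simp add: image_image)
    also have "(\<lambda>\<omega>. \<omega> {}) ` ?C = tor_cycles F \<delta> q" using ev_onto C_iff by blast
    finally show "(\<lambda>\<omega>. \<tau> (\<omega> {})) ` carrier (gsub (vforms 0 (F q)) ?C) = carrier ?T" using \<tau>(2) by simp
    fix \<omega> assume "\<omega> \<in> carrier (gsub (vforms 0 (F q)) ?C)"
    then have w: "\<omega> \<in> carrier (vforms 0 (F q))" "\<omega> {} \<in> tor_cycles F \<delta> q" using C_iff[of \<omega>] by auto
    show "\<omega> \<in> total_boundaries 0 (F q) (F (Suc q)) (\<delta> q) \<longleftrightarrow> \<tau> (\<omega> {}) \<in> {\<zero>\<^bsub>?T\<^esub>}"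
    proof
      assume "\<omega> \<in> total_boundaries 0 (F q) (F (Suc q)) (\<delta> q)"
      then obtain c y where c: "c \<in> carrier (vforms (Suc 0) (F q))" and y: "y \<in> carrier (vforms 0 (F (Suc q)))"
        and eq: "\<omega> = (\<lambda>S. vcontract (F q) c S \<oplus>\<^bsub>F q\<^esub> \<delta> q (y S))" unfolding total_boundaries_def by blast
      have "vcontract (F q) c {} \<in> max_multiples (F q)"
        unfolding max_multiples_def koszul_boundaries_def using c by blast
      moreover have "y {} \<in> carrier (F (Suc q))" using y by simp
      moreover have "\<omega> {} = vcontract (F q) c {} \<oplus>\<^bsub>F q\<^esub> \<delta> q (y {})" using eq by simp
      ultimately show "\<tau> (\<omega> {}) \<in> {\<zero>\<^bsub>?T\<^esub>}" using \<tau>(3)[OF w(2)] by blast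
    next
      assume "\<tau> (\<omega> {}) \<in> {\<zero>\<^bsub>?T\<^esub>}"
      then obtain y z where y: "y \<in> max_multiples (F q)" and z: "z \<in> carrier (F (Suc q))"
        and eq: "\<omega> {} = y \<oplus>\<^bsub>F q\<^esub> \<delta> q z" using \<tau>(3)[OF w(2)] by blast
      obtain c where c: "c \<in> carrier (vforms (Suc 0) (F q))" "y = vcontract (F q) c {}"
        using y unfolding max_multiples_def koszul_boundaries_def by blast
      let ?z = "\<lambda>S :: 'v set. if S = {} then z else \<zero>\<^bsub>F (Suc q)\<^esub>"
      have zc: "?z \<in> carrier (vforms 0 (F (Suc q)))" using z d.M.M.zero_closed by auto
      have cc: "vcontract (F q) c \<in> carrier (vforms 0 (F q))"
        using graded_map.closed[OF vcontract_graded_map[OF d.N.graded_module_axioms] c(1)] .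
      have eqw: "\<omega> = (\<lambda>S. vcontract (F q) c S \<oplus>\<^bsub>F q\<^esub> \<delta> q (?z S))"
      proof (rule ext)
        fix S
        show "\<omega> S = vcontract (F q) c S \<oplus>\<^bsub>F q\<^esub> \<delta> q (?z S)"
      proof (cases "S = {}")
        case False
        then have "\<omega> S = \<zero>\<^bsub>F q\<^esub>" "vcontract (F q) c S = \<zero>\<^bsub>F q\<^esub>" using w(1) cc by auto
        then show ?thesis using False d.zero d.N.M.zero_closed by simp
      qed (use eq c(2) in simp)
      qed
      show "\<omega> \<in> total_boundaries 0 (F q) (F (Suc q)) (\<delta> q)"
        unfolding total_boundaries_def
        by (rule CollectI, rule bexI[OF _ c(1)], rule bexI[OF _ zc], rule eqw)
    qed
  qed
  from graded_corr_function[OF graded_corr_trans[OF Z this]] that show thesis by auto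
qed

section \<open>The tensor product with the contracted forms\<close>

lemma vcontract_polyR: "vcontract polyR \<omega> = contract_rad \<omega>"
  using vcontract_functional[OF graded_module_polyR, of \<omega> "\<lambda>x. x"] by (auto simp: fun_eq_iff)

lemma forms_carrier: "carrier (forms q) = carrier (vforms q polyR)"
  by (auto simp: forms_def)

lemma forms_simps [simp]:
  "\<zero>\<^bsub>forms q\<^esub> = (\<lambda>S. 0)" "\<omega> \<oplus>\<^bsub>forms q\<^esub> \<eta> = (\<lambda>S. \<omega> S + \<eta> S)" "f \<odot>\<^bsub>forms q\<^esub> \<omega> = (\<lambda>S. f * \<omega> S)"
  "hpart (forms q) d = {\<omega>. (\<forall>S. card S \<noteq> q \<longrightarrow> \<omega> S = 0) \<and> (\<forall>S. \<omega> S \<in> homog d)}"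
  by (simp_all add: forms_def)

interpretation contract: graded_map polyR
    "vforms (Suc q) polyR :: (('v::{finite,linorder}, 'k::comm_ring_1) mpoly, ('v, 'k) form) gmodule"
    "vforms q polyR" contract_rad for q
  using vcontract_graded_map[OF graded_module_polyR, of q] unfolding vcontract_polyR[abs_def] .

lemma contract_rad_add: "contract_rad (\<lambda>S. \<omega> S + \<eta> S) = (\<lambda>T. contract_rad \<omega> T + contract_rad \<eta> T)"
  by (rule ext) (simp add: contract_rad_def sum.distrib algebra_simps)

lemma contract_rad_scale: "contract_rad (\<lambda>S. f * \<omega> S) = (\<lambda>T. f * contract_rad \<omega> T)"
  by (rule ext) (simp add: contract_rad_def sum_distrib_left mult.left_commute)

lemma contract_rad_diff: "contract_rad (\<lambda>S. \<omega> S - \<eta> S) = (\<lambda>T. contract_rad \<omega> T - contract_rad \<eta> T)"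
  by (rule ext) (simp add: contract_rad_def sum_subtractf algebra_simps)

definition dx :: "'v set \<Rightarrow> ('v, 'k::comm_ring_1) form" where
  "dx S T = (if T = S then 1 else 0)"

lemma form_expansion:
  assumes "\<And>S. card S \<noteq> q \<Longrightarrow> \<eta> S = 0"
  shows "\<eta> T = (\<Sum>S\<in>{S :: 'v::finite set. card S = q}. \<eta> S * (dx S T :: ('v, 'k::comm_ring_1) mpoly))"
proof -
  have "(\<Sum>S\<in>{S. card S = q}. \<eta> S * dx S T) = (\<Sum>S\<in>{S. card S = q}. if S = T then \<eta> T else 0)"
    by (rule sum.cong) (auto simp: dx_def)
  then show ?thesis using assms by simp
qed

lemma contract_rad_expansion:
  fixes \<eta> :: "('v::{finite,linorder}, 'k::comm_ring_1) form"
  assumes "\<And>S. card S \<noteq> q \<Longrightarrow> \<eta> S = 0"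
  shows "contract_rad \<eta> T = (\<Sum>S\<in>{S. card S = q}. \<eta> S * contract_rad (dx S) T)"
proof -
  have "contract_rad \<eta> T = (\<Sum>v\<in>-T. \<Sum>S\<in>{S. card S = q}.
      (-1) ^ card {w \<in> T. w < v} * var v * (\<eta> S * dx S (insert v T)))"
    unfolding contract_rad_def sum_distrib_left[symmetric]
    by (intro sum.cong refl arg_cong2[of _ _ _ _ "(*)"] form_expansion assms)
  also have "\<dots> = (\<Sum>S\<in>{S. card S = q}. \<Sum>v\<in>-T. (-1) ^ card {w \<in> T. w < v} * var v * (\<eta> S * dx S (insert v T)))"
    by (rule sum.swap)
  finally show ?thesis by (simp add: contract_rad_def sum_distrib_left mult_ac)
qed

lemma dx_form: "dx S \<in> carrier (vforms (card S) polyR)"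
  by (auto simp: dx_def)

lemma rad_image_simps [simp]:
  "carrier (rad_image p) = contract_rad ` carrier (vforms (Suc p) polyR)"
  "\<omega> \<oplus>\<^bsub>rad_image p\<^esub> \<eta> = (\<lambda>S. \<omega> S + \<eta> S)" "f \<odot>\<^bsub>rad_image p\<^esub> \<omega> = (\<lambda>S. f * \<omega> S)"
  "hpart (rad_image p) d = hpart (forms p) (1 + d) \<inter> contract_rad ` carrier (vforms (Suc p) polyR)"
  unfolding rad_image_def forms_carrier by (simp_all add: gsub_def gshift_def forms_def del: vforms_simps)

context
  fixes I :: "('v::{finite,linorder}, 'k::comm_ring_1) mpoly set" and p :: nat
  assumes hI: "homogeneous_ideal I"
begin

abbreviation (input) "MI \<equiv> gsub polyR I"
abbreviation (input) "rel \<equiv> tensor_rel polyR MI (rad_image p)"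
abbreviation (input) "tops \<equiv> {S :: 'v set. card S = Suc p}"

lemma ideal_closed:
  "0 \<in> I" "f \<in> I \<Longrightarrow> g \<in> I \<Longrightarrow> f + g \<in> I" "f \<in> I \<Longrightarrow> h * f \<in> I" "f \<in> I \<Longrightarrow> f * h \<in> I"
proof -
  note D = graded_submoduleD[OF graded_submodule_ideal[OF hI]]
  show m: "f \<in> I \<Longrightarrow> h * f \<in> I" for f h using D(4)[of h f] by simp
  show "0 \<in> I" "f \<in> I \<Longrightarrow> g \<in> I \<Longrightarrow> f + g \<in> I" using D(2,3) by auto
  show "f \<in> I \<Longrightarrow> f * h \<in> I" using m[of f h] by (simp add: mult.commute)
qed

lemma graded_module_ideal: "graded_module polyR MI"
  by (rule graded_module_gsub(1)[OF graded_module_polyR homog_carrier graded_submodule_ideal[OF hI]])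

lemma vcontract_ideal: "(\<And>S. \<omega> S \<in> I) \<Longrightarrow> vcontract MI \<omega> = contract_rad \<omega>"
  using vcontract_functional[OF graded_module_ideal, of \<omega> "\<lambda>x. x"] by (auto simp: fun_eq_iff)

lemma boundaries_ideal:
  "koszul_boundaries q MI = contract_rad ` carrier (vforms (Suc q) MI)"
  unfolding koszul_boundaries_def by (rule image_cong) (auto intro!: vcontract_ideal)

lemma cycles_ideal:
  "koszul_cycles q MI = {\<omega> \<in> carrier (vforms q MI). contract_rad \<omega> = (\<lambda>S. 0)}"
  unfolding koszul_cycles_def by (auto simp: vcontract_ideal)

lemma boundaries_closed:
  "(\<lambda>S. 0) \<in> koszul_boundaries q MI"
  "\<omega> \<in> koszul_boundaries q MI \<Longrightarrow> \<eta> \<in> koszul_boundaries q MI \<Longrightarrow> (\<lambda>S. \<omega> S + \<eta> S) \<in> koszul_boundaries q MI"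
  "\<omega> \<in> koszul_boundaries q MI \<Longrightarrow> (\<lambda>S. f * \<omega> S) \<in> koszul_boundaries q MI"
  "\<omega> \<in> koszul_boundaries q MI \<Longrightarrow> \<omega> \<in> carrier (vforms q MI)"
  using graded_submoduleD(1-4)[OF graded_submodule_boundaries[OF graded_module_ideal, of q]] by auto

lemma boundaries_sum:
  assumes "\<And>a. a \<in> A \<Longrightarrow> c a \<in> koszul_boundaries q MI"
  shows "(\<lambda>S. \<Sum>a\<in>A. c a S) \<in> koszul_boundaries q MI"
  using assms by (induction A rule: infinite_finite_induct) (auto intro: boundaries_closed(1,2))

text \<open>The contracting homotopy divides monomials by variables, so it does not preserve forms with
  coefficients in \<open>I\<close>. It can be applied to \<open>h\<close> before multiplying by \<open>f\<close>.\<close>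

lemma closed_multiple_boundary:
  assumes f: "f \<in> I" and h: "h \<in> carrier (vforms (Suc q) polyR)" "contract_rad h = (\<lambda>S. 0)"
  shows "(\<lambda>S. f * h S) \<in> koszul_boundaries (Suc q) MI"
proof -
  have "contract_rad (koszul_homotopy h) = h" using h by (intro koszul_homotopy_contract) auto
  then have "(\<lambda>S. f * h S) = contract_rad (\<lambda>S. f * koszul_homotopy h S)" by (simp add: contract_rad_scale)
  moreover have "(\<lambda>S. f * koszul_homotopy h S) \<in> carrier (vforms (Suc (Suc q)) MI)"
    using f h koszul_homotopy_degree[of "Suc q" h] by (auto intro: ideal_closed)
  ultimately show ?thesis unfolding boundaries_ideal by blast
qed

text \<open>The representative \<open>\<Sum>\<^sub>S \<omega>\<^sub>S \<otimes> \<iota> dx\<^sub>S\<close> in the free abelian group.\<close>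

definition tensor_form :: "('v, 'k) form \<Rightarrow> (('v, 'k) mpoly \<times> ('v, 'k) form) \<Rightarrow>\<^sub>0 int" where
  "tensor_form \<omega> = (\<Sum>S\<in>tops. frag_of (\<omega> S, contract_rad (dx S)))"

lemma contract_dx: "S \<in> tops \<Longrightarrow> contract_rad (dx S :: ('v, 'k) form) \<in> carrier (rad_image p)"
  using dx_form[of S] by auto

lemma rad_zero: "(\<lambda>S :: 'v set. 0 :: ('v, 'k) mpoly) \<in> carrier (rad_image p)"
proof -
  have "contract_rad (\<lambda>S :: 'v set. 0 :: ('v, 'k) mpoly) = (\<lambda>S. 0)" by (rule ext) (simp add: contract_rad_def)
  then show ?thesis by (auto intro!: image_eqI[of _ _ "\<lambda>S. 0"])
qed

lemma rad_add: "v \<in> carrier (rad_image p) \<Longrightarrow> w \<in> carrier (rad_image p) \<Longrightarrow> (\<lambda>S. v S + w S) \<in> carrier (rad_image p)"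
  by (auto simp: contract_rad_add[symmetric] simp del: vforms_simps) (auto intro!: imageI)

lemma rad_scale: "v \<in> carrier (rad_image p) \<Longrightarrow> (\<lambda>S. f * v S) \<in> carrier (rad_image p)"
  by (auto simp: contract_rad_scale[symmetric] simp del: vforms_simps) (auto intro!: imageI)

lemma rel_zero_right: "f \<in> I \<Longrightarrow> frag_of (f, \<lambda>S. 0) \<in> rel"
  using tensor_rel_uminus[OF tensor_rel.add_right[of f MI "\<lambda>S. 0" "rad_image p" "\<lambda>S. 0" polyR]] rad_zero by simp

lemma rel_sum_right:
  assumes "f \<in> I" "finite A" "\<And>a. a \<in> A \<Longrightarrow> w a \<in> carrier (rad_image p)"
  shows "(\<lambda>S. \<Sum>a\<in>A. w a S) \<in> carrier (rad_image p) \<and> frag_of (f, \<lambda>S. \<Sum>a\<in>A. w a S) - (\<Sum>a\<in>A. frag_of (f, w a)) \<in> rel"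
  using assms(2,3)
proof (induction A rule: finite_induct)
  case empty
  show ?case using rel_zero_right[OF assms(1)] rad_zero by simp
next
  case (insert a A)
  have IH: "(\<lambda>S. \<Sum>a\<in>A. w a S) \<in> carrier (rad_image p)" "frag_of (f, \<lambda>S. \<Sum>a\<in>A. w a S) - (\<Sum>a\<in>A. frag_of (f, w a)) \<in> rel"
    using insert by auto
  have wa: "w a \<in> carrier (rad_image p)" using insert by blast
  have "frag_of (f, \<lambda>S. w a S + (\<Sum>a\<in>A. w a S)) - frag_of (f, w a) - frag_of (f, \<lambda>S. \<Sum>a\<in>A. w a S) \<in> rel"
    using tensor_rel.add_right[of f MI "w a" "rad_image p" "\<lambda>S. \<Sum>a\<in>A. w a S" polyR] IH(1) wa assms(1) by simp
  from tensor_rel_add[OF this IH(2)] rad_add[OF wa IH(1)] insert(1,2) show ?case by (simp add: algebra_simps)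
qed

lemma tensor_form_lift:
  assumes f: "f \<in> I" and \<eta>: "\<eta> \<in> carrier (vforms (Suc p) polyR)"
  shows "frag_of (f, contract_rad \<eta>) - tensor_form (\<lambda>S. \<eta> S * f) \<in> rel"
proof -
  have "contract_rad \<eta> = (\<lambda>T. \<Sum>S\<in>tops. \<eta> S * contract_rad (dx S) T)"
    by (rule ext, rule contract_rad_expansion) (use \<eta> in auto)
  moreover have "frag_of (f, \<lambda>T. \<Sum>S\<in>tops. \<eta> S * contract_rad (dx S) T) - (\<Sum>S\<in>tops. frag_of (f, \<lambda>T. \<eta> S * contract_rad (dx S) T)) \<in> rel"
    by (rule conjunct2[OF rel_sum_right[OF f finite rad_scale[OF contract_dx]]])
  ultimately have 1: "frag_of (f, contract_rad \<eta>) - (\<Sum>S\<in>tops. frag_of (f, \<lambda>T. \<eta> S * contract_rad (dx S) T)) \<in> rel"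
    by simp
  have "frag_of (f, \<lambda>T. \<eta> S * contract_rad (dx S) T) - frag_of (\<eta> S * f, contract_rad (dx S)) \<in> rel"
    if "S \<in> tops" for S
    using tensor_rel_uminus[OF tensor_rel.balanced[of "\<eta> S" polyR f MI "contract_rad (dx S)" "rad_image p"]]
      f contract_dx[OF that] by simp
  then have "(\<Sum>S\<in>tops. frag_of (f, \<lambda>T. \<eta> S * contract_rad (dx S) T) - frag_of (\<eta> S * f, contract_rad (dx S))) \<in> rel"
    by (rule tensor_rel_sum)
  from tensor_rel_add[OF 1 this] show ?thesis by (simp add: tensor_form_def sum_subtractf)
qed

lemma tensor_form_add:
  assumes "\<And>S. \<omega> S \<in> I" "\<And>S. \<eta> S \<in> I"
  shows "tensor_form (\<lambda>S. \<omega> S + \<eta> S) - tensor_form \<omega> - tensor_form \<eta> \<in> rel"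
proof -
  have "(\<Sum>S\<in>tops. frag_of (\<omega> S + \<eta> S, contract_rad (dx S)) - frag_of (\<omega> S, contract_rad (dx S)) - frag_of (\<eta> S, contract_rad (dx S))) \<in> rel"
  proof (rule tensor_rel_sum)
    fix S assume S: "S \<in> tops"
    show "frag_of (\<omega> S + \<eta> S, contract_rad (dx S)) - frag_of (\<omega> S, contract_rad (dx S)) - frag_of (\<eta> S, contract_rad (dx S)) \<in> rel"
      using tensor_rel.add_left[of "\<omega> S" MI "\<eta> S" "contract_rad (dx S)" "rad_image p" polyR] assms contract_dx[OF S] by simp
  qed
  then show ?thesis by (simp add: tensor_form_def sum_subtractf)
qed

text \<open>Right exactness of the tensor product, by hand. In one direction, \<open>f \<otimes> w \<mapsto> f s(w)\<close>, with \<open>s(w)\<close> any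
  form whose contraction is \<open>w\<close>, is bilinear and balanced modulo boundaries, because the closed forms that
  measure the failure are boundaries after multiplication by \<open>f\<close>. It inverts \<open>tensor_form\<close> modulo
  boundaries. In the other direction, the contraction of \<open>f dx\<^sub>U\<close> is sent to \<open>f \<otimes> \<iota>\<iota> dx\<^sub>U = 0\<close>.\<close>

lemma tensor_form_kernel:
  assumes w: "\<omega> \<in> carrier (vforms (Suc p) MI)"
  shows "tensor_form \<omega> \<in> rel \<longleftrightarrow> \<omega> \<in> koszul_boundaries (Suc p) MI"
proof
  have wI: "\<omega> S \<in> I" for S using w by simp
  define s where "s w = (SOME \<eta>. \<eta> \<in> carrier (vforms (Suc p) polyR) \<and> contract_rad \<eta> = w)" for w :: "('v, 'k) form"
  have s: "s w \<in> carrier (vforms (Suc p) polyR)" "contract_rad (s w) = w" if "w \<in> carrier (rad_image p)" for w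
  proof -
    have "\<exists>\<eta>. \<eta> \<in> carrier (vforms (Suc p) polyR) \<and> contract_rad \<eta> = w" using that unfolding rad_image_simps by blast
    from someI_ex[OF this] show "s w \<in> carrier (vforms (Suc p) polyR)" "contract_rad (s w) = w" unfolding s_def by auto
  qed
  define \<beta> where "\<beta> = (\<lambda>(f, w) S. f * s w S)"
  let ?K = "koszul_boundaries (Suc p) MI"
  assume "tensor_form \<omega> \<in> rel"
  then have "(\<lambda>S. zlin (\<lambda>x. \<beta> x S) (tensor_form \<omega>)) \<in> ?K"
  proof (rule tensor_rel_zlin[where \<beta> = \<beta> and R = polyR and M = MI and N = "rad_image p", rotated -1])
    show "(\<lambda>S. 0) \<in> ?K" by (rule boundaries_closed)
    show "(\<lambda>S. f S - g S) \<in> ?K" if "f \<in> ?K" "g \<in> ?K" for f g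
      using boundaries_closed(2)[OF that(1) boundaries_closed(3)[OF that(2), of "-1"]] by simp
    show "(\<lambda>S. \<beta> (m \<oplus>\<^bsub>MI\<^esub> m', n) S - \<beta> (m, n) S - \<beta> (m', n) S) \<in> ?K" for m m' n
      using boundaries_closed(1) by (simp add: \<beta>_def algebra_simps)
    fix m assume "m \<in> carrier MI"
    then have m: "m \<in> I" by simp
    show "(\<lambda>S. \<beta> (m, n \<oplus>\<^bsub>rad_image p\<^esub> n') S - \<beta> (m, n) S - \<beta> (m, n') S) \<in> ?K"
      if n: "n \<in> carrier (rad_image p)" "n' \<in> carrier (rad_image p)" for n n'
    proof -
      let ?h = "\<lambda>S. s (\<lambda>S. n S + n' S) S - s n S - s n' S"
      have "?h \<in> carrier (vforms (Suc p) polyR)"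
        using s(1)[OF rad_add[OF n]] s(1)[OF n(1)] s(1)[OF n(2)] by auto
      moreover have "contract_rad ?h = (\<lambda>S. 0)"
        using s(2)[OF rad_add[OF n]] s(2)[OF n(1)] s(2)[OF n(2)] by (simp add: contract_rad_diff)
      ultimately have "(\<lambda>S. m * ?h S) \<in> ?K" by (rule closed_multiple_boundary[OF m])
      then show ?thesis by (simp add: \<beta>_def algebra_simps)
    qed
    show "(\<lambda>S. \<beta> (r \<odot>\<^bsub>MI\<^esub> m, n) S - \<beta> (m, r \<odot>\<^bsub>rad_image p\<^esub> n) S) \<in> ?K"
      if n: "n \<in> carrier (rad_image p)" for n r
    proof -
      let ?h = "\<lambda>S. r * s n S - s (\<lambda>S. r * n S) S"
      have "?h \<in> carrier (vforms (Suc p) polyR)"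
        using s(1)[OF rad_scale[OF n]] s(1)[OF n] by auto
      moreover have "contract_rad ?h = (\<lambda>S. 0)"
        using s(2)[OF rad_scale[OF n]] s(2)[OF n] by (simp add: contract_rad_diff contract_rad_scale)
      ultimately have "(\<lambda>S. m * ?h S) \<in> ?K" by (rule closed_multiple_boundary[OF m])
      then show ?thesis by (simp add: \<beta>_def algebra_simps)
    qed
  qed
  then have 1: "(\<lambda>S. \<Sum>U\<in>tops. \<omega> U * s (contract_rad (dx U)) S) \<in> ?K"
    by (simp add: tensor_form_def zlin_sum \<beta>_def)
  have 2: "(\<lambda>S. \<Sum>U\<in>tops. \<omega> U * (dx U S - s (contract_rad (dx U)) S)) \<in> ?K"
  proof (rule boundaries_sum)
    fix U assume U: "U \<in> tops"
    note sU = s[OF contract_dx[OF U]]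
    show "(\<lambda>S. \<omega> U * (dx U S - s (contract_rad (dx U)) S)) \<in> ?K"
    proof (rule closed_multiple_boundary[OF wI])
      show "(\<lambda>S. dx U S - s (contract_rad (dx U)) S) \<in> carrier (vforms (Suc p) polyR)"
        using sU(1) U by (auto simp: dx_def)
      show "contract_rad (\<lambda>S. dx U S - s (contract_rad (dx U)) S) = (\<lambda>S. 0)"
        using sU(2) by (simp add: contract_rad_diff)
    qed
  qed
  have "\<omega> = (\<lambda>S. (\<Sum>U\<in>tops. \<omega> U * s (contract_rad (dx U)) S) + (\<Sum>U\<in>tops. \<omega> U * (dx U S - s (contract_rad (dx U)) S)))"
  proof
    fix S
    have "\<omega> S = (\<Sum>U\<in>tops. \<omega> U * dx U S)" by (rule form_expansion) (use w in auto)
    then show "\<omega> S = (\<Sum>U\<in>tops. \<omega> U * s (contract_rad (dx U)) S) + (\<Sum>U\<in>tops. \<omega> U * (dx U S - s (contract_rad (dx U)) S))"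
      by (simp add: sum.distrib[symmetric] algebra_simps)
  qed
  then show "\<omega> \<in> ?K" using boundaries_closed(2)[OF 1 2] by metis
next
  assume "\<omega> \<in> koszul_boundaries (Suc p) MI"
  then obtain \<eta> where e: "\<eta> \<in> carrier (vforms (Suc (Suc p)) MI)" "\<omega> = contract_rad \<eta>"
    unfolding boundaries_ideal by blast
  let ?w = "\<lambda>B S. \<Sum>U\<in>B. contract_rad (dx U) S * \<eta> U"
  \<comment> \<open>The summands of the contraction of \<open>\<eta>\<close> are added one at a time.\<close>
  have "(\<forall>S. ?w B S \<in> I) \<and> tensor_form (?w B) \<in> rel" if "B \<subseteq> {U. card U = Suc (Suc p)}" for B
    using finite[of B] that
  proof (induction B rule: finite_induct)
    case empty
    have "tensor_form (\<lambda>S. 0) \<in> rel"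
      using tensor_rel_uminus[OF tensor_form_add[of "\<lambda>S. 0" "\<lambda>S. 0"]] by (simp add: ideal_closed)
    then show ?case by (simp add: ideal_closed)
  next
    case (insert U B)
    have U: "\<eta> U \<in> I" "card U = Suc (Suc p)" using e(1) insert by auto
    have cU: "contract_rad (dx U) \<in> carrier (vforms (Suc p) polyR)"
      by (rule contract.closed) (use dx_form[of U] U(2) in simp)
    have "frag_of (\<eta> U, contract_rad (contract_rad (dx U))) - tensor_form (\<lambda>S. contract_rad (dx U) S * \<eta> U) \<in> rel"
      by (rule tensor_form_lift[OF U(1) cU])
    then have "tensor_form (\<lambda>S. contract_rad (dx U) S * \<eta> U) \<in> rel"
      using tensor_rel.diff[OF rel_zero_right[OF U(1)]] by (fastforce simp: contract_rad_contract_rad)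
    moreover have IH: "\<And>S. ?w B S \<in> I" "tensor_form (?w B) \<in> rel" using insert by auto
    moreover have UI: "contract_rad (dx U) S * \<eta> U \<in> I" for S using U(1) by (rule ideal_closed(3))
    moreover note tensor_form_add[of "\<lambda>S. contract_rad (dx U) S * \<eta> U" "?w B", OF UI IH(1)]
    ultimately have "tensor_form (\<lambda>S. contract_rad (dx U) S * \<eta> U + ?w B S) - tensor_form (\<lambda>S. contract_rad (dx U) S * \<eta> U)
        - tensor_form (?w B) + tensor_form (\<lambda>S. contract_rad (dx U) S * \<eta> U) + tensor_form (?w B) \<in> rel"
      by (intro tensor_rel_add)
    then show ?case using insert(1,2) IH(1) UI by (simp add: ideal_closed(2))
  qed
  from this[OF subset_refl] have "tensor_form (?w {U. card U = Suc (Suc p)}) \<in> rel" by blast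
  moreover have "\<omega> = ?w {U. card U = Suc (Suc p)}"
    unfolding e(2) by (rule ext, subst contract_rad_expansion[of "Suc (Suc p)"]) (use e(1) in \<open>auto simp: mult.commute\<close>)
  ultimately show "tensor_form \<omega> \<in> rel" by simp
qed

lemma contract_dx_hpart: "S \<in> tops \<Longrightarrow> contract_rad (dx S :: ('v, 'k) form) \<in> hpart (rad_image p) 0"
proof -
  assume S: "S \<in> tops"
  then have "(dx S :: ('v, 'k) form) \<in> hpart (vforms (Suc p) polyR) (int (Suc p))" by (auto simp: dx_def)
  then have "contract_rad (dx S :: ('v, 'k) form) \<in> hpart (vforms p polyR) (int (Suc p))" by (rule contract.hpart)
  then show ?thesis using contract_dx[OF S] by simp
qed

lemma homogeneous_preimage:
  assumes w: "w \<in> hpart (rad_image p) e"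
  obtains \<eta> where "\<eta> \<in> carrier (vforms (Suc p) polyR)" "contract_rad \<eta> = w" "\<And>S. \<eta> S \<in> homog e"
proof -
  obtain \<eta> where \<eta>: "\<eta> \<in> carrier (vforms (Suc p) polyR)" "contract_rad \<eta> = w"
    using w unfolding rad_image_simps by blast
  let ?e = "gcomp (vforms (Suc p) polyR) (1 + e + int p) \<eta>"
  have "contract_rad \<eta> \<in> hpart (vforms p polyR) (1 + e + int p)"
    unfolding \<eta>(2) using w by simp
  from contract.hpart_preimage[OF this \<eta>(1)]
  have h: "?e \<in> hpart (vforms (Suc p) polyR) (1 + e + int p)" "contract_rad ?e = w" using \<eta>(2) by auto
  then have "?e \<in> carrier (vforms (Suc p) polyR)" by (auto simp: vforms_def)
  with h that show thesis by (auto simp: algebra_simps)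
qed

lemma tensor_ideal:
  defines "V \<equiv> gshift (int p + 1) (vforms (Suc p) MI)"
    and "T \<equiv> tensor polyR MI (rad_image p)"
    and "\<Phi> \<equiv> \<lambda>\<omega>. tensor_cls polyR MI (rad_image p) (tensor_form \<omega>)"
  shows "graded_map polyR V T \<Phi>" "\<Phi> ` carrier V = carrier T"
    "\<And>\<omega>. \<omega> \<in> carrier V \<Longrightarrow> \<Phi> \<omega> = \<zero>\<^bsub>T\<^esub> \<longleftrightarrow> \<omega> \<in> koszul_boundaries (Suc p) MI"
proof -
  have gF: "graded_module polyR (vforms (Suc p) MI :: (('v, 'k) mpoly, ('v, 'k) form) gmodule)"
    by (rule graded_module_pforms[OF graded_module_ideal])
  have gV: "graded_module polyR V" unfolding V_def by (rule graded_module_gshift[OF gF])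
  have Vc: "\<omega> \<in> carrier V \<longleftrightarrow> (\<forall>S. \<omega> S \<in> I \<and> (card S \<noteq> Suc p \<longrightarrow> \<omega> S = 0))" for \<omega> by (simp add: V_def)
  have Vh: "\<omega> \<in> hpart V d \<longleftrightarrow> (\<forall>S. \<omega> S \<in> homog d \<inter> I \<and> (card S \<noteq> Suc p \<longrightarrow> \<omega> S = 0))" for \<omega> d
    by (simp add: V_def)
  have Va: "\<omega> \<oplus>\<^bsub>V\<^esub> \<eta> = (\<lambda>S. \<omega> S + \<eta> S)" "r \<odot>\<^bsub>V\<^esub> \<omega> = (\<lambda>S. r * \<omega> S)" for \<omega> \<eta> r by (simp_all add: V_def)
  note pr = tensor_presentation[of polyR V MI tensor_form "rad_image p", OF gV homog_carrier graded_module_ideal]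
  have keys: "Poly_Mapping.keys (tensor_form \<omega>) \<subseteq> (\<lambda>S. (\<omega> S, contract_rad (dx S))) ` tops" for \<omega>
    unfolding tensor_form_def by (rule order_trans[OF keys_sum]) auto
  have 1: "tensor_form \<omega> \<in> carrier (tensor_free MI (rad_image p))" if "\<omega> \<in> carrier V" for \<omega>
  proof -
    have "(\<lambda>S. (\<omega> S, contract_rad (dx S :: ('v, 'k) form))) ` tops \<subseteq> I \<times> carrier (rad_image p)"
      by (rule image_subsetI) (use that contract_dx in \<open>simp add: Vc del: rad_image_simps\<close>)
    then have "Poly_Mapping.keys (tensor_form \<omega>) \<subseteq> I \<times> carrier (rad_image p)" by (rule order_trans[OF keys])
    then show ?thesis by (simp add: tensor_free_def)
  qed
  have 2: "tensor_form (\<omega> \<oplus>\<^bsub>V\<^esub> \<eta>) - tensor_form \<omega> - tensor_form \<eta> \<in> rel" if "\<omega> \<in> carrier V" "\<eta> \<in> carrier V" for \<omega> \<eta>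
    unfolding Va by (rule tensor_form_add) (use that Vc in auto)
  have 3: "tensor_form (r \<odot>\<^bsub>V\<^esub> \<omega>) - frag_extend (\<lambda>(m, n). frag_of (r \<odot>\<^bsub>MI\<^esub> m, n)) (tensor_form \<omega>) \<in> rel" for r \<omega>
    by (simp add: Va tensor_form_def frag_extend_sum o_def tensor_rel.zero)
  have 4: "\<exists>\<omega>\<in>carrier V. frag_of (m, n) - tensor_form \<omega> \<in> rel" if mn: "m \<in> carrier MI" "n \<in> carrier (rad_image p)" for m n
  proof -
    obtain \<eta> where \<eta>: "\<eta> \<in> carrier (vforms (Suc p) polyR)" "n = contract_rad \<eta>"
      using mn(2) unfolding rad_image_simps by blast
    have m: "m \<in> I" using mn(1) by simp
    show ?thesis
      using tensor_form_lift[OF m \<eta>(1)] \<eta> m by (intro bexI[of _ "\<lambda>S. \<eta> S * m"]) (auto simp: Vc ideal_closed)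
  qed
  have 5: "\<exists>c\<in>hpart (tensor_free MI (rad_image p)) d. tensor_form \<omega> - c \<in> rel" if "\<omega> \<in> hpart V d" for \<omega> d
  proof (intro bexI)
    show "tensor_form \<omega> - tensor_form \<omega> \<in> rel" by (simp add: tensor_rel.zero)
    have "(\<lambda>S. (\<omega> S, contract_rad (dx S :: ('v, 'k) form))) ` tops \<subseteq> hpart MI d \<times> hpart (rad_image p) (d - d)"
      by (rule image_subsetI) (use that contract_dx_hpart in \<open>simp add: Vh del: rad_image_simps\<close>)
    also have "\<dots> \<subseteq> (\<Union>i. hpart MI i \<times> hpart (rad_image p) (d - i))" by blast
    finally have "Poly_Mapping.keys (tensor_form \<omega>) \<subseteq> (\<Union>i. hpart MI i \<times> hpart (rad_image p) (d - i))"
      by (rule order_trans[OF keys])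
    then show "tensor_form \<omega> \<in> hpart (tensor_free MI (rad_image p)) d" by (simp add: tensor_free_def)
  qed
  have 6: "\<exists>\<omega>\<in>hpart V d. frag_of (m, n) - tensor_form \<omega> \<in> rel"
    if mn: "m \<in> hpart MI i" "n \<in> hpart (rad_image p) (d - i)" for m n i d
  proof -
    obtain \<eta> where \<eta>: "\<eta> \<in> carrier (vforms (Suc p) polyR)" "contract_rad \<eta> = n" "\<And>S. \<eta> S \<in> homog (d - i)"
      using homogeneous_preimage[OF mn(2)] by blast
    have m: "m \<in> I" "m \<in> homog i" using mn(1) by auto
    have "\<eta> S * m \<in> homog d" for S using homog_mult[OF \<eta>(3) m(2)] by simp
    then show ?thesis
      using tensor_form_lift[OF m(1) \<eta>(1)] \<eta>(1,2) m(1) by (intro bexI[of _ "\<lambda>S. \<eta> S * m"]) (auto simp: Vh ideal_closed)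
  qed
  have Vk: "\<omega> \<in> carrier V \<Longrightarrow> tensor_form \<omega> \<in> rel \<longleftrightarrow> \<omega> \<in> koszul_boundaries (Suc p) MI" for \<omega>
    by (rule tensor_form_kernel) (simp add: V_def)
  have 7: "tensor_form (gcomp V d \<omega>) \<in> rel" if w: "\<omega> \<in> carrier V" "tensor_form \<omega> \<in> rel" for \<omega> d
  proof -
    have "gcomp V d \<omega> = gcomp (vforms (Suc p) MI) (int p + 1 + d) \<omega>"
      unfolding V_def by (rule gcomp_gshift[OF gF]) (use w in \<open>simp add: V_def\<close>)
    then have "gcomp V d \<omega> \<in> koszul_boundaries (Suc p) MI"
      using graded_submoduleD(5)[OF graded_submodule_boundaries[OF graded_module_ideal]] w Vk by simp
    then show ?thesis using Vk[OF graded_module.gcomp_carrier[OF gV w(1)]] by blast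
  qed
  note pr = pr[OF 1 2 3 4 5 6 7]
  show "graded_map polyR V T \<Phi>" unfolding T_def \<Phi>_def by (rule pr(1))
  show "\<Phi> ` carrier V = carrier T" unfolding T_def \<Phi>_def by (rule pr(2))
  show "\<Phi> \<omega> = \<zero>\<^bsub>T\<^esub> \<longleftrightarrow> \<omega> \<in> koszul_boundaries (Suc p) MI" if "\<omega> \<in> carrier V" for \<omega>
    unfolding T_def \<Phi>_def tensor_cls_zero_iff by (rule Vk[OF that])
qed

end

section \<open>Forms vanishing on a subscheme\<close>

lemma homog_0_constant:
  assumes "f \<in> homog 0" shows "f = const (Poly_Mapping.lookup f 0)"
proof (rule poly_mapping_eqI)
  fix m
  have "m = 0" if "Poly_Mapping.lookup f m \<noteq> 0"
  proof (rule poly_mapping_eqI)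
    fix v
    have "(\<Sum>v\<in>UNIV. Poly_Mapping.lookup m v) = 0" using assms that by (simp add: homog_iff mdeg_def del: of_nat_sum)
    then show "Poly_Mapping.lookup m v = Poly_Mapping.lookup 0 v" by simp
  qed
  then show "Poly_Mapping.lookup f m = Poly_Mapping.lookup (const (Poly_Mapping.lookup f 0)) m"
    by (auto simp: const_def lookup_single when_def)
qed

lemma ideal_constant:
  fixes I :: "('v::{finite,linorder}, 'k::field) mpoly set"
  assumes hI: "homogeneous_ideal I" and "I \<noteq> UNIV" "f \<in> I" "f \<in> homog 0"
  shows "f = 0"
proof (rule ccontr)
  assume "f \<noteq> 0"
  define a where "a = Poly_Mapping.lookup f 0"
  have f: "f = const a" unfolding a_def by (rule homog_0_constant[OF assms(4)])
  with \<open>f \<noteq> 0\<close> have "a \<noteq> 0" by (auto simp: const_def)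
  then have "const (1 / a) * f = 1" unfolding f by (simp add: const_def mult_single)
  then have "1 \<in> I" using ideal_closed(3)[OF hI assms(3), of "const (1 / a)"] by simp
  then have "g \<in> I" for g using ideal_closed(3)[OF hI, of 1 g] by simp
  then show False using \<open>I \<noteq> UNIV\<close> by auto
qed

text \<open>The module of vanishing forms is cut off below degree 0, but nothing is lost. A form with constant
  coefficients that contraction kills would be the contraction of a form with coefficients of degree -1 if \<open>p > 0\<close>; if
  \<open>p = 0\<close>, its coefficient is a constant in a proper ideal.\<close>

lemma cycles_low_degree:
  fixes I :: "('v::{finite,linorder}, 'k::field) mpoly set"
  assumes hI: "homogeneous_ideal I" and pI: "p = 0 \<longrightarrow> I \<noteq> UNIV" and d: "d < 0"
    and w: "\<omega> \<in> carrier (vforms p polyR)" "\<And>S. \<omega> S \<in> I" "\<And>S. \<omega> S \<in> homog (d + 1)" "contract_rad \<omega> = (\<lambda>S. 0)"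
  shows "\<omega> = (\<lambda>S. 0)"
proof (cases "d + 1 < 0 \<or> p = 0")
  case True
  have "\<omega> S = 0" for S
  proof (cases "d + 1 < 0")
    case True
    then show ?thesis by (rule homog_neg[OF _ w(3)])
  next
    case False
    then have "d + 1 = 0" using d by simp
    then show ?thesis
      using True False pI ideal_constant[OF hI _ w(2)[of S]] w(3)[of S] by simp
  qed
  then show ?thesis by (rule ext)
next
  case False
  then have d1: "d + 1 = 0" and p: "p > 0" using d by auto
  define \<eta> where "\<eta> = gcomp (vforms (Suc p) polyR) (int p) (koszul_homotopy \<omega>)"
  have h: "koszul_homotopy \<omega> \<in> carrier (vforms (Suc p) polyR)" "contract_rad (koszul_homotopy \<omega>) = \<omega>"
    using w(1,4) p koszul_homotopy_degree[of p \<omega>] koszul_homotopy_contract[of \<omega>] by auto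
  have "contract_rad (koszul_homotopy \<omega>) \<in> hpart (vforms p polyR) (int p)"
    unfolding h(2) using w(1,3) d1 by simp
  from contract.hpart_preimage[OF this h(1)]
  have e: "\<eta> \<in> hpart (vforms (Suc p) polyR) (int p)" "contract_rad \<eta> = \<omega>" using h(2) by (auto simp: \<eta>_def)
  have "\<eta> S = 0" for S using e(1) homog_neg[of "-1" "\<eta> S"] by simp
  then have "\<eta> = (\<lambda>S. 0)" by (rule ext)
  then show ?thesis using e(2) by (auto simp: contract_rad_def)
qed

lemma is_section_iff:
  assumes "homogeneous_ideal I" "saturated I"
  shows "is_section I f \<longleftrightarrow> f \<in> I"
proof
  assume "f \<in> I"
  then show "is_section I f" unfolding is_section_def by (intro allI exI[of _ 0]) simp
qed (use assms(2) in \<open>simp add: saturated_def\<close>)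

lemma vanishing_forms_simps [simp]:
  "\<zero>\<^bsub>vanishing_forms I p\<^esub> = (\<lambda>S. 0)" "\<omega> \<oplus>\<^bsub>vanishing_forms I p\<^esub> \<eta> = (\<lambda>S. \<omega> S + \<eta> S)"
  "f \<odot>\<^bsub>vanishing_forms I p\<^esub> \<omega> = (\<lambda>S. f * \<omega> S)"
  "hpart (vanishing_forms I p) = vanishing_part I p"
  by (simp_all add: vanishing_forms_def forms_def)

lemma graded_submodule_cycles:
  assumes hI: "homogeneous_ideal I"
  shows "graded_submodule polyR (vforms q (gsub polyR I)) (koszul_cycles q (gsub polyR I))"
proof -
  interpret i: poly_map "gsub polyR I" "gsub polyR I" "\<lambda>x. x"
    by (intro poly_mapI graded_map_intro graded_module_ideal[OF hI] graded_homI) auto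
  have "koszul_cycles q (gsub polyR I) = cycles_over q (gsub polyR I) (gsub polyR I) (\<lambda>x. x)"
    by (simp add: koszul_cycles_def cycles_over_def)
  then show ?thesis using i.cycles_over_submodule by simp
qed

context
  fixes I :: "('v::{finite,linorder}, 'k::field) mpoly set" and p :: nat
  assumes hI: "homogeneous_ideal I" and sat: "saturated I" and pI: "p = 0 \<longrightarrow> I \<noteq> UNIV"
begin

lemma vanishing_part_cycles:
  "vanishing_part I p d = hpart (gshift (int p + 1) (gsub (vforms p (gsub polyR I)) (koszul_cycles p (gsub polyR I)))) d"
proof -
  have *: "\<omega> \<in> hpart (gshift (int p + 1) (gsub (vforms p (gsub polyR I)) (koszul_cycles p (gsub polyR I)))) d \<longleftrightarrow>
      \<omega> \<in> carrier (vforms p polyR) \<and> (\<forall>S. \<omega> S \<in> I) \<and> (\<forall>S. \<omega> S \<in> homog (d + 1)) \<and> contract_rad \<omega> = (\<lambda>S. 0)" for \<omega>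
    by (auto simp: cycles_ideal[OF hI] algebra_simps)
  have "0 \<in> I" by (rule ideal_closed[OF hI])
  show ?thesis
  proof (cases "d < 0")
    case True
    have "(\<lambda>S. 0) \<in> hpart (gshift (int p + 1) (gsub (vforms p (gsub polyR I)) (koszul_cycles p (gsub polyR I)))) d"
      unfolding * using \<open>0 \<in> I\<close> by (auto simp: contract_rad_def)
    then show ?thesis
      using True cycles_low_degree[OF hI pI True] * unfolding vanishing_part_def by (simp only: if_True) blast
  next
    case False
    then show ?thesis
      using is_section_iff[OF hI sat] by (auto simp: vanishing_part_def cycles_ideal[OF hI] algebra_simps)
  qed
qed

lemma finsum_forms:
  assumes "finite D" "\<And>a. a \<in> D \<Longrightarrow> w a \<in> koszul_cycles p (gsub polyR I)"
  shows "finsum (forms p) w D = finsum (gsub (vforms p (gsub polyR I)) (koszul_cycles p (gsub polyR I))) w D"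
proof -
  have gF: "graded_module polyR (vforms p polyR :: (('v, 'k) mpoly, ('v, 'k) form) gmodule)"
    by (rule graded_module_pforms[OF graded_module_polyR])
  have add: "add_monoid (forms p) = add_monoid (vforms p polyR :: (('v, 'k) mpoly, ('v, 'k) form) gmodule)"
    by (simp add: forms_carrier fun_eq_iff del: vforms_simps(1))
  have ag: "abelian_group (forms p :: (('v, 'k) mpoly, ('v, 'k) form) gmodule)"
    using abelian_group.a_comm_group[OF module.axioms(2)[OF graded_module.axioms(1)[OF gF]]] unfolding add[symmetric]
    by (intro abelian_group.intro abelian_monoid.intro abelian_group_axioms.intro comm_group.axioms(1))
  interpret Z: graded_module polyR "gsub (vforms p (gsub polyR I)) (koszul_cycles p (gsub polyR I))"
    by (rule graded_module_gsub(1)[OF graded_module_pforms[OF graded_module_ideal[OF hI]] homog_carrier graded_submodule_cycles[OF hI]])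
  have "finsum (gsub (vforms p (gsub polyR I)) (koszul_cycles p (gsub polyR I))) w D = finsum (forms p) w D"
    by (rule finsum_hom[OF Z.M.abelian_group_axioms ag, of "\<lambda>x. x"])
       (use assms(2) in \<open>auto simp: cycles_ideal[OF hI] forms_carrier\<close>)
  then show ?thesis by simp
qed

lemma vanishing_forms_carrier: "carrier (vanishing_forms I p) = koszul_cycles p (gsub polyR I)"
proof -
  let ?Z = "gsub (vforms p (gsub polyR I)) (koszul_cycles p (gsub polyR I))"
  have gZ: "graded_module polyR ?Z"
    by (rule graded_module_gsub(1)[OF graded_module_pforms[OF graded_module_ideal[OF hI]] homog_carrier graded_submodule_cycles[OF hI]])
  interpret Z: graded_module polyR ?Z by (rule gZ)
  interpret S: graded_module polyR "gshift (int p + 1) ?Z" by (rule graded_module_gshift[OF gZ])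
  have car: "carrier (vanishing_forms I p) = {finsum (forms p) w D | w D. finite D \<and> (\<forall>d\<in>D. w d \<in> vanishing_part I p d)}"
    by (simp add: vanishing_forms_def)
  have part: "vanishing_part I p d \<subseteq> koszul_cycles p (gsub polyR I)" for d
    unfolding vanishing_part_cycles using S.hpart_carrier[of _ d] by auto
  show ?thesis
  proof (intro equalityI subsetI)
    fix \<omega> assume "\<omega> \<in> carrier (vanishing_forms I p)"
    then obtain w D where D: "finite D" "\<And>d. d \<in> D \<Longrightarrow> w d \<in> vanishing_part I p d" "\<omega> = finsum (forms p) w D"
      unfolding car by blast
    then have wZ: "w d \<in> carrier ?Z" if "d \<in> D" for d using part that by auto
    then have "\<omega> = finsum ?Z w D" using finsum_forms[OF D(1)] D(3) by simp
    then show "\<omega> \<in> koszul_cycles p (gsub polyR I)" using Z.M.finsum_closed[of w D] wZ by auto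
  next
    fix \<omega> assume w: "\<omega> \<in> koszul_cycles p (gsub polyR I)"
    then have wc: "\<omega> \<in> carrier (gshift (int p + 1) ?Z)" by simp
    let ?c = "\<lambda>d. gcomp (gshift (int p + 1) ?Z) d \<omega>"
    let ?D = "{d. ?c d \<noteq> \<zero>\<^bsub>gshift (int p + 1) ?Z\<^esub>}"
    have cZ: "?c d \<in> koszul_cycles p (gsub polyR I)" for d using S.gcomp_carrier[OF wc, of d] by simp
    have "\<omega> = finsum (gshift (int p + 1) ?Z) ?c ?D" by (rule S.gcomp_props(3)[OF wc])
    also have "\<dots> = finsum ?Z ?c ?D"
      by (rule finsum_hom[OF S.M.abelian_group_axioms Z.M.abelian_group_axioms, of "\<lambda>x. x"]) (use cZ in auto)
    also have "\<dots> = finsum (forms p) ?c ?D"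
      by (rule finsum_forms[symmetric, OF S.gcomp_props(2)[OF wc] cZ])
    finally show "\<omega> \<in> carrier (vanishing_forms I p)"
      unfolding car using S.gcomp_props(1,2)[OF wc] unfolding vanishing_part_cycles by blast
  qed
qed

lemma vanishing_forms_cycles:
  "graded_map polyR (gshift (int p + 1) (gsub (vforms p (gsub polyR I)) (koszul_cycles p (gsub polyR I))))
    (vanishing_forms I p) (\<lambda>\<omega>. \<omega>)"
  "graded_map polyR (vanishing_forms I p)
    (gshift (int p + 1) (gsub (vforms p (gsub polyR I)) (koszul_cycles p (gsub polyR I)))) (\<lambda>\<omega>. \<omega>)"
proof -
  let ?Z = "gshift (int p + 1) (gsub (vforms p (gsub polyR I)) (koszul_cycles p (gsub polyR I)))"
  have gZ: "graded_module polyR ?Z"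
    by (intro graded_module_gshift graded_module_gsub(1)[OF graded_module_pforms[OF graded_module_ideal[OF hI]] homog_carrier graded_submodule_cycles[OF hI]])
  interpret Z: graded_module polyR ?Z by (rule gZ)
  have gA: "graded_module polyR (vanishing_forms I p)"
  proof (rule graded_module_image(1)[OF gZ homog_carrier, of "\<lambda>\<omega>. \<omega>"])
    show "hpart (vanishing_forms I p) d = (\<lambda>\<omega>. \<omega>) ` hpart ?Z d" for d
      unfolding vanishing_forms_simps vanishing_part_cycles by (simp only: image_ident)
    show "gcomp ?Z d x = \<zero>\<^bsub>vanishing_forms I p\<^esub>" if "x = \<zero>\<^bsub>vanishing_forms I p\<^esub>" for x d
      using that Z.gcomp_zero[of d] by simp
  qed (simp_all only: vanishing_forms_carrier image_ident gshift_simps gsub_simps vanishing_forms_simps vforms_simps polyR_simps)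
  show "graded_map polyR ?Z (vanishing_forms I p) (\<lambda>\<omega>. \<omega>)"
    by (intro graded_map_intro gZ gA graded_homI)
       (simp_all only: vanishing_forms_carrier gshift_simps(1-4) gsub_simps(1-4) vanishing_forms_simps vforms_simps(2-4) polyR_simps vanishing_part_cycles)
  show "graded_map polyR (vanishing_forms I p) ?Z (\<lambda>\<omega>. \<omega>)"
    by (intro graded_map_intro gZ gA graded_homI)
       (simp_all only: vanishing_forms_carrier gshift_simps(1-4) gsub_simps(1-4) vanishing_forms_simps vforms_simps(2-4) polyR_simps vanishing_part_cycles)
qed

end

section \<open>The exact sequence\<close>

theorem theoremA:
  fixes I :: "('v::{finite,linorder}, 'k::field) mpoly set"
    and p :: nat
    and F :: "nat \<Rightarrow> (('v, 'k) mpoly, 'f) gmodule"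
    and \<delta> :: "nat \<Rightarrow> 'f \<Rightarrow> 'f"
    and \<epsilon> :: "'f \<Rightarrow> ('v, 'k) mpoly"
  assumes "homogeneous_ideal I" and "saturated I"
    and "p = 0 \<longrightarrow> I \<noteq> UNIV"
    and "graded_free_resolution polyR F \<delta> \<epsilon> (gsub polyR I)"
  shows "(\<exists>\<kappa> \<mu> \<pi>.
      exact_at polyR
        (gshift (int p + 1) (Tor polyR F \<delta> residue_k (Suc p))) \<kappa>
        (tensor polyR (gsub polyR I) (rad_image p)) \<mu>
        (vanishing_forms I p) \<and>
      inj_on \<kappa> (carrier (Tor polyR F \<delta> residue_k (Suc p))) \<and>
      exact_at polyR
        (tensor polyR (gsub polyR I) (rad_image p)) \<mu>
        (vanishing_forms I p) \<pi>
        (gshift (int p + 1) (Tor polyR F \<delta> residue_k p)) \<and>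
      \<pi> ` carrier (vanishing_forms I p) = carrier (Tor polyR F \<delta> residue_k p) \<and>
      (\<forall>f\<in>I. \<forall>w\<in>carrier (rad_image p).
        \<mu> (pure_tensor polyR (gsub polyR I) (rad_image p) f w) = f \<odot>\<^bsub>forms p\<^esub> w)) \<and>
    (\<forall>d. hpart (gsub polyR I) d = {0} \<longrightarrow>
      part_iso (vanishing_forms I p) d (Tor polyR F \<delta> residue_k p) (d + int p + 1))"
proof -
  note hI = assms(1)
  note gI = graded_module_ideal[OF hI]
  define M where "M = gsub polyR I"
  define A where "A = vanishing_forms I p"
  define Tor' where "Tor' q = Tor polyR F \<delta> residue_k q" for q
  define Z where "Z q = gsub (vforms q M) (koszul_cycles q M)" for q
  define V :: "(('v, 'k) mpoly, ('v, 'k) form) gmodule" where "V = gshift (int p + 1) (vforms (Suc p) M)"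
  define T where "T = tensor polyR M (rad_image p)"
  define \<Phi> where "\<Phi> \<omega> = tensor_cls polyR M (rad_image p) (tensor_form p \<omega>)" for \<omega>
  have res: "graded_free_resolution polyR F \<delta> \<epsilon> M" using assms(4) by (simp add: M_def)
  have gM: "graded_module polyR M" unfolding M_def by (rule gI)
  have vc: "vcontract M \<omega> = contract_rad \<omega>" if "\<omega> \<in> carrier (vforms q M)" for \<omega> q
    unfolding M_def by (rule vcontract_ideal[OF hI]) (use that in \<open>simp add: M_def\<close>)
  have cyc: "koszul_cycles q M = {\<omega> \<in> carrier (vforms q M). contract_rad \<omega> = (\<lambda>S. 0)}" for q
    unfolding M_def by (rule cycles_ideal[OF hI])
  have bd: "koszul_boundaries q M = contract_rad ` carrier (vforms (Suc q) M)" for q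
    unfolding M_def by (rule boundaries_ideal[OF hI])
  have bd_cyc: "koszul_boundaries q M \<subseteq> koszul_cycles q M" for q
    using graded_submoduleD(1)[OF graded_submodule_boundaries[OF gM]] contract_rad_contract_rad
    unfolding cyc by (auto simp: bd simp del: vforms_simps)
  have gcyc: "graded_submodule polyR (vforms q M) (koszul_cycles q M)" for q
    unfolding M_def by (rule graded_submodule_cycles[OF hI])
  have gZ: "graded_module polyR (Z q)" for q
    unfolding Z_def by (rule graded_module_gsub(1)[OF graded_module_pforms[OF gM] homog_carrier gcyc])
  have cZ: "carrier (Z q) = koszul_cycles q M" for q by (simp add: Z_def)
  have cA: "carrier A = koszul_cycles p M"
    unfolding A_def M_def by (rule vanishing_forms_carrier[OF assms(1-3)])
  have AZ: "graded_map polyR A (gshift (int p + 1) (Z p)) (\<lambda>\<omega>. \<omega>)"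
    "graded_map polyR (gshift (int p + 1) (Z p)) A (\<lambda>\<omega>. \<omega>)"
    unfolding A_def Z_def M_def by (rule vanishing_forms_cycles[OF assms(1-3)])+

  \<comment> \<open>\<open>\<theta>\<close> and \<open>\<theta>'\<close> identify Koszul homology with Tor in form degrees \<open>p\<close> and \<open>p + 1\<close>.\<close>
  obtain \<theta> where \<theta>: "graded_map polyR (Z p) (Tor' p) \<theta>" "\<theta> ` koszul_cycles p M = carrier (Tor' p)"
    "\<And>x. x \<in> koszul_cycles p M \<Longrightarrow> \<theta> x = \<zero>\<^bsub>Tor' p\<^esub> \<longleftrightarrow> x \<in> koszul_boundaries p M"
    by (rule koszul_homology_tor[OF res, where q = p, folded Z_def Tor'_def], rule that)
  obtain \<theta>' where \<theta>': "graded_map polyR (Z (Suc p)) (Tor' (Suc p)) \<theta>'" "\<theta>' ` koszul_cycles (Suc p) M = carrier (Tor' (Suc p))"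
    "\<And>x. x \<in> koszul_cycles (Suc p) M \<Longrightarrow> \<theta>' x = \<zero>\<^bsub>Tor' (Suc p)\<^esub> \<longleftrightarrow> x \<in> koszul_boundaries (Suc p) M"
    by (rule koszul_homology_tor[OF res, where q = "Suc p", folded Z_def Tor'_def], rule that)
  note \<Phi>3 = tensor_ideal[OF hI, where p = p, folded M_def, folded V_def T_def \<Phi>_def]
  have cV: "carrier V = carrier (vforms (Suc p) M)" by (simp add: V_def)

  have \<pi>: "graded_map polyR A (gshift (int p + 1) (Tor' p)) \<theta>"
    by (rule graded_map_comp[OF AZ(1) graded_map_gshift[OF \<theta>(1)]])

  interpret c: graded_map polyR "vforms (Suc p) M" "vforms p M" "vcontract M" by (rule vcontract_graded_map[OF gM])
  have ccyc: "vcontract M \<omega> \<in> koszul_cycles p M" if "\<omega> \<in> carrier (vforms (Suc p) M)" for \<omega>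
    using bd_cyc[of p] that unfolding koszul_boundaries_def by blast
  have "graded_map polyR (vforms (Suc p) M) (Z p) (vcontract M)"
  proof (intro graded_map_intro gZ graded_module_pforms gM graded_homI)
    fix \<omega> :: "('v, 'k) form" and d assume w: "\<omega> \<in> hpart (vforms (Suc p) M) d"
    then show "vcontract M \<omega> \<in> hpart (Z p) d"
      using c.hpart[OF w] ccyc[OF c.M.hpart_carrier[OF w]] by (simp add: Z_def)
  qed (simp_all only: Z_def gsub_simps c.add c.smult ccyc)
  then have contr: "graded_map polyR V A (vcontract M)"
    unfolding V_def by (rule graded_map_comp[OF graded_map_gshift AZ(2)])

  have Vker: "\<Phi> \<omega> = \<zero>\<^bsub>T\<^esub> \<longleftrightarrow> \<omega> \<in> koszul_boundaries (Suc p) M" if "\<omega> \<in> carrier V" for \<omega>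
    by (rule \<Phi>3(3)[OF that])
  have zA: "\<zero>\<^bsub>A\<^esub> = (\<lambda>S. 0)" by (simp add: A_def)
  \<comment> \<open>Contraction kills the kernel of \<open>\<Phi>\<close> and therefore factors through the tensor product.\<close>
  obtain \<mu> where \<mu>: "\<mu> \<in> graded_hom polyR T A" "\<And>\<omega>. \<omega> \<in> carrier V \<Longrightarrow> \<mu> (\<Phi> \<omega>) = vcontract M \<omega>"
  proof (rule graded_hom_factor[OF \<Phi>3(1) contr \<Phi>3(2)])
    fix \<omega> assume w: "\<omega> \<in> carrier V" "\<Phi> \<omega> = \<zero>\<^bsub>T\<^esub>"
    then have "\<omega> \<in> koszul_cycles (Suc p) M" using Vker bd_cyc[of "Suc p"] by blast
    then show "vcontract M \<omega> = \<zero>\<^bsub>A\<^esub>" using vc[of \<omega> "Suc p"] zA by (simp add: cyc)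
  qed (rule that)

  have incl: "graded_map polyR (gshift (int p + 1) (Z (Suc p))) V (\<lambda>\<omega>. \<omega>)"
    unfolding V_def Z_def
    by (intro graded_map_gshift graded_map_intro graded_module_gsub(1,2) graded_module_pforms gM homog_carrier gcyc)
  have sZ: "carrier (gshift (int p + 1) (Z (Suc p))) = koszul_cycles (Suc p) M" by (simp add: cZ)
  \<comment> \<open>On cycles, \<open>\<theta>'\<close> and \<open>\<Phi>\<close> have the same kernel, so \<open>\<Phi>\<close> factors through \<open>\<theta>'\<close>.\<close>
  obtain \<kappa> where \<kappa>: "\<kappa> \<in> graded_hom polyR (gshift (int p + 1) (Tor' (Suc p))) T"
    "\<And>\<omega>. \<omega> \<in> carrier (gshift (int p + 1) (Z (Suc p))) \<Longrightarrow> \<kappa> (\<theta>' \<omega>) = \<Phi> \<omega>"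
  proof (rule graded_hom_factor[OF graded_map_gshift[OF \<theta>'(1), of "int p + 1"] graded_map_comp[OF incl \<Phi>3(1)]])
    show "\<theta>' ` carrier (gshift (int p + 1) (Z (Suc p))) = carrier (gshift (int p + 1) (Tor' (Suc p)))"
      unfolding sZ using \<theta>'(2) by simp
    fix \<omega> assume w: "\<omega> \<in> carrier (gshift (int p + 1) (Z (Suc p)))" "\<theta>' \<omega> = \<zero>\<^bsub>gshift (int p + 1) (Tor' (Suc p))\<^esub>"
    then have "\<omega> \<in> koszul_boundaries (Suc p) M" using \<theta>'(3) unfolding sZ by simp
    then show "\<Phi> \<omega> = \<zero>\<^bsub>T\<^esub>" using Vker graded_map.closed[OF incl w(1)] by blast
  qed (rule that)

  interpret \<Phi>: graded_map polyR V T \<Phi> by (rule \<Phi>3(1))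
  interpret \<mu>: graded_map polyR T A \<mu>
    by (intro graded_map_intro \<Phi>.N.graded_module_axioms graded_map.hom[OF AZ(2)] \<mu>(1)) (rule AZ(1)[unfolded graded_map_def, THEN conjunct1])
  interpret \<pi>: graded_map polyR A "gshift (int p + 1) (Tor' p)" \<theta> by (rule \<pi>)
  interpret t: graded_map polyR "gshift (int p + 1) (Z (Suc p))" "gshift (int p + 1) (Tor' (Suc p))" \<theta>'
    by (rule graded_map_gshift[OF \<theta>'(1)])
  interpret \<kappa>: graded_map polyR "gshift (int p + 1) (Tor' (Suc p))" T \<kappa>
    by (intro graded_map_intro t.N.graded_module_axioms \<Phi>.N.graded_module_axioms \<kappa>(1))

  have cycV: "\<omega> \<in> carrier V" if "\<omega> \<in> koszul_cycles (Suc p) M" for \<omega> using that by (simp add: cyc cV del: vforms_simps)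
  have ex1: "exact_at polyR (gshift (int p + 1) (Tor' (Suc p))) \<kappa> T \<mu> A"
  proof (rule graded_map_exact_at[OF \<kappa>.graded_map_axioms \<mu>.graded_map_axioms])
    fix X assume "X \<in> carrier T"
    then obtain \<omega> where w: "\<omega> \<in> carrier V" "X = \<Phi> \<omega>" using \<Phi>3(2) by blast
    have K: "\<kappa> ` carrier (gshift (int p + 1) (Tor' (Suc p))) = \<Phi> ` koszul_cycles (Suc p) M"
      unfolding gshift_simps \<theta>'(2)[symmetric] image_image
      by (rule image_cong[OF refl]) (use \<kappa>(2) sZ in blast)
    have "\<mu> X = \<zero>\<^bsub>A\<^esub> \<longleftrightarrow> \<omega> \<in> koszul_cycles (Suc p) M"
      using w \<mu>(2) vc[of \<omega> "Suc p"] zA by (simp add: cyc cV del: vforms_simps)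
    also have "\<dots> \<longleftrightarrow> X \<in> \<Phi> ` koszul_cycles (Suc p) M"
    proof
      assume "X \<in> \<Phi> ` koszul_cycles (Suc p) M"
      then obtain \<eta> where e: "\<eta> \<in> koszul_cycles (Suc p) M" "\<Phi> \<omega> = \<Phi> \<eta>" using w by auto
      have "\<mu> (\<Phi> \<omega>) = \<mu> (\<Phi> \<eta>)" using e(2) by simp
      then have "contract_rad \<omega> = contract_rad \<eta>"
        using \<mu>(2)[OF w(1)] \<mu>(2)[OF cycV[OF e(1)]] vc[of \<omega> "Suc p"] vc[of \<eta> "Suc p"] w(1) cycV[OF e(1)] cV by simp
      then show "\<omega> \<in> koszul_cycles (Suc p) M" using e(1) w(1) by (simp add: cyc cV del: vforms_simps)
    qed (use w in blast)
    finally show "\<mu> X = \<zero>\<^bsub>A\<^esub> \<longleftrightarrow> X \<in> \<kappa> ` carrier (gshift (int p + 1) (Tor' (Suc p)))" unfolding K .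
  qed

  have inj: "inj_on \<kappa> (carrier (Tor' (Suc p)))"
  proof (rule inj_onI)
    fix x y assume xy: "x \<in> carrier (Tor' (Suc p))" "y \<in> carrier (Tor' (Suc p))" "\<kappa> x = \<kappa> y"
    then have "\<kappa> (x \<ominus>\<^bsub>gshift (int p + 1) (Tor' (Suc p))\<^esub> y) = \<zero>\<^bsub>T\<^esub>" by (intro \<kappa>.diff_kernel) auto
    moreover have "x \<ominus>\<^bsub>gshift (int p + 1) (Tor' (Suc p))\<^esub> y \<in> carrier (gshift (int p + 1) (Tor' (Suc p)))"
      using xy by (intro graded_module_diff(1)[OF t.N.graded_module_axioms]) auto
    then obtain \<omega> where w: "\<omega> \<in> koszul_cycles (Suc p) M" "x \<ominus>\<^bsub>gshift (int p + 1) (Tor' (Suc p))\<^esub> y = \<theta>' \<omega>"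
      using \<theta>'(2) by auto
    ultimately have "\<Phi> \<omega> = \<zero>\<^bsub>T\<^esub>" using \<kappa>(2) sZ by simp
    then have "\<theta>' \<omega> = \<zero>\<^bsub>Tor' (Suc p)\<^esub>" using Vker[OF cycV[OF w(1)]] \<theta>'(3)[OF w(1)] by simp
    then show "x = y" using w(2) t.N.M.minus_zero_iff xy by simp
  qed

  have im: "\<mu> ` carrier T = koszul_boundaries p M"
    unfolding \<Phi>3(2)[symmetric] image_image koszul_boundaries_def cV[symmetric]
    by (rule image_cong[OF refl]) (rule \<mu>(2))
  have ex2: "exact_at polyR T \<mu> A \<theta> (gshift (int p + 1) (Tor' p))"
    by (rule graded_map_exact_at[OF \<mu>.graded_map_axioms \<pi>]) (use \<theta>(3) im in \<open>simp add: cA\<close>)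

  have pure: "\<mu> (pure_tensor polyR M (rad_image p) f w) = f \<odot>\<^bsub>forms p\<^esub> w"
    if f: "f \<in> I" and w: "w \<in> carrier (rad_image p)" for f w
  proof -
    obtain \<eta> where \<eta>: "\<eta> \<in> carrier (vforms (Suc p) polyR)" "w = contract_rad \<eta>"
      using w unfolding rad_image_simps by blast
    have fe: "(\<lambda>S. \<eta> S * f) \<in> carrier V"
      using \<eta>(1) f ideal_closed(3)[OF hI] by (auto simp: V_def M_def)
    have "pure_tensor polyR M (rad_image p) f w = \<Phi> (\<lambda>S. \<eta> S * f)"
      using tensor_form_lift[OF hI f \<eta>(1)]
      by (simp add: pure_tensor_def tensor_cls_def[symmetric] \<Phi>_def tensor_cls_eq_iff M_def \<eta>(2))
    then have "\<mu> (pure_tensor polyR M (rad_image p) f w) = contract_rad (\<lambda>S. \<eta> S * f)"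
      using \<mu>(2)[OF fe] vc[of _ "Suc p"] fe cV by simp
    also have "\<dots> = f \<odot>\<^bsub>forms p\<^esub> w"
      using contract_rad_scale[of f \<eta>] by (simp add: \<eta>(2) mult.commute)
    finally show ?thesis .
  qed

  have iso: "part_iso A d (Tor' p) (d + int p + 1)" if d: "hpart M d = {0}" for d
    unfolding part_iso_def
  proof (intro exI[of _ \<theta>] conjI ballI allI)
    have hT: "hpart (gshift (int p + 1) (Tor' p)) d = hpart (Tor' p) (d + int p + 1)" by (simp add: ac_simps)
    show "bij_betw \<theta> (hpart A d) (hpart (Tor' p) (d + int p + 1))"
      unfolding hT[symmetric]
    proof (rule bij_betw_imageI)
      show "inj_on \<theta> (hpart A d)"
      proof (rule inj_onI)
        fix x y assume xy: "x \<in> hpart A d" "y \<in> hpart A d" "\<theta> x = \<theta> y"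
        have xyA: "x \<in> carrier A" "y \<in> carrier A" using xy \<mu>.N.hpart_carrier by auto
        let ?z = "x \<ominus>\<^bsub>A\<^esub> y"
        have zA': "?z \<in> carrier A" by (rule graded_module_diff(1)[OF \<mu>.N.graded_module_axioms xyA])
        interpret D: additive_subgroup "hpart A d" A by (rule \<mu>.N.hpart_subgroup)
        have zd: "?z \<in> hpart A d" using xy D.a_inv_closed by (simp add: \<mu>.N.M.minus_eq)
        have "\<theta> ?z = \<zero>\<^bsub>Tor' p\<^esub>" using \<pi>.diff_kernel[OF xyA xy(3)] by simp
        then have "?z \<in> koszul_boundaries p M" using \<theta>(3) zA' cA by simp
        then obtain \<eta> where e: "\<eta> \<in> carrier V" "?z = vcontract M \<eta>" unfolding koszul_boundaries_def cV by auto
        interpret k: graded_map polyR V A "vcontract M" by (rule contr)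
        \<comment> \<open>The kernel of \<open>\<theta>\<close> consists of contractions, and in degree \<open>d\<close> of contractions of forms with
          coefficients in the degree \<open>d\<close> part of the ideal.\<close>
        let ?e = "gcomp V d \<eta>"
        have h: "?e \<in> hpart V d" "vcontract M ?e = ?z"
          using k.hpart_preimage[of \<eta> d] e zd by auto
        then have "?e S \<in> hpart M d" for S by (simp add: V_def)
        then have "?e = (\<lambda>S. 0)" using d by (auto simp: fun_eq_iff)
        then have "?e = \<zero>\<^bsub>V\<^esub>" by (simp add: V_def M_def)
        then have "?z = \<zero>\<^bsub>A\<^esub>" using h(2) k.zero by simp
        then show "x = y" using \<mu>.N.M.minus_zero_iff[OF xyA] by simp
      qed
      show "\<theta> ` hpart A d = hpart (gshift (int p + 1) (Tor' p)) d"
      proof (intro equalityI subsetI)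
        fix t assume t: "t \<in> hpart (gshift (int p + 1) (Tor' p)) d"
        then have "t \<in> carrier (Tor' p)" using \<pi>.N.hpart_carrier by fastforce
        then have "t \<in> \<theta> ` carrier A" unfolding cA \<theta>(2) .
        then obtain x where x: "x \<in> carrier A" "t = \<theta> x" by blast
        then show "t \<in> \<theta> ` hpart A d" using \<pi>.hpart_preimage[of x d] t by (metis image_eqI)
      qed (use \<pi>.hpart in blast)
    qed
    fix x assume x: "x \<in> hpart A d"
    show "\<theta> (x \<oplus>\<^bsub>A\<^esub> y) = \<theta> x \<oplus>\<^bsub>Tor' p\<^esub> \<theta> y" if "y \<in> hpart A d" for y
      using \<pi>.add[OF \<mu>.N.hpart_carrier[OF x] \<mu>.N.hpart_carrier[OF that]] by simp
    show "\<theta> (const a \<odot>\<^bsub>A\<^esub> x) = const a \<odot>\<^bsub>Tor' p\<^esub> \<theta> x" for a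
      using \<pi>.smult[OF _ \<mu>.N.hpart_carrier[OF x], of "const a"] by simp
  qed

  have onto: "\<theta> ` carrier A = carrier (Tor' p)" using \<theta>(2) cA by simp
  show ?thesis
    using ex1 inj ex2 onto pure iso
    unfolding A_def[symmetric] Tor'_def[symmetric] M_def[symmetric] T_def[symmetric] by blast
qed

end
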